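(* Let $G$ be a Cayley graph such that for all $n$ the ball of radius $n$ in $G$ has cardinality at least $\zeta^n$, where $\zeta>1$. Then for every $p\in(1/\zeta,1]$, almost surely every infinite cluster of $p$-Bernoulli bond percolation on $G$ is transient.
   Context: A Cayley graph is the Cayley graph of a finitely generated group with respect to a finite generating set. The ball of radius $n$ is the set of vertices at graph distance at most $n$ from a fixed vertex. $p$-Bernoulli bond percolation on $G$ is the random subgraph with vertex set $V(G)$ in which each edge of $G$ is kept independently with probability $p$; clusters are its connected components. A cluster is transient if simple random walk on it is transient. *)

theory Defs
  imports "HOL-Probability.Probability" "HOL-Algebra.Generated_Groups"
begin

text \<open>
  A graph is given by a vertex set \<open>V\<close> and a set \<open>E\<close> of undirected edges, each edge being the set
  of its two endpoints. Only the members of \<open>E\<close> that lie inside \<open>V\<close> count, so that for \<open>C \<subseteq> V\<close>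
  the pair \<open>C\<close>, \<open>E\<close> denotes the subgraph induced on \<open>C\<close>.
\<close>

definition nbrs :: "'a set \<Rightarrow> 'a set set \<Rightarrow> 'a \<Rightarrow> 'a set" where
  "nbrs V E v = {w \<in> V. {v, w} \<in> E}"

definition adj :: "'a set \<Rightarrow> 'a set set \<Rightarrow> ('a \<times> 'a) set" where
  "adj V E = {(v, w). v \<in> V \<and> w \<in> nbrs V E v}"

definition graph_dist :: "'a set \<Rightarrow> 'a set set \<Rightarrow> 'a \<Rightarrow> 'a \<Rightarrow> enat" where
  "graph_dist V E v w = (INF k \<in> {k. (v, w) \<in> adj V E ^^ k}. enat k)"

definition graph_ball :: "'a set \<Rightarrow> 'a set set \<Rightarrow> 'a \<Rightarrow> nat \<Rightarrow> 'a set" where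
  "graph_ball V E v n = {w \<in> V. graph_dist V E v w \<le> enat n}"

definition graph_components :: "'a set \<Rightarrow> 'a set set \<Rightarrow> 'a set set" where
  "graph_components V E = {{w \<in> V. (v, w) \<in> (adj V E)\<^sup>*} | v. v \<in> V}"

text \<open>
  The generating set need not be symmetric: the edge joining \<open>x\<close> and \<open>x s\<close> is undirected. The
  graph is simple; an identity element in \<open>S\<close> contributes no loop.
\<close>

definition cayley_edges :: "('a, 'b) monoid_scheme \<Rightarrow> 'a set \<Rightarrow> 'a set set" where
  "cayley_edges G S =
    {{x, x \<otimes>\<^bsub>G\<^esub> s} | x s. x \<in> carrier G \<and> s \<in> S \<and> x \<otimes>\<^bsub>G\<^esub> s \<noteq> x}"

definition bond_percolation :: "'a set set \<Rightarrow> real \<Rightarrow> ('a set \<Rightarrow> bool) measure" where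
  "bond_percolation E p = PiM E (\<lambda>_. measure_pmf (bernoulli_pmf p))"

definition open_edges :: "'a set set \<Rightarrow> ('a set \<Rightarrow> bool) \<Rightarrow> 'a set set" where
  "open_edges E \<omega> = {e \<in> E. \<omega> e}"

text \<open>
  A vertex without neighbours is absorbing. The same convention covers vertices of infinite
  degree, where there is no uniform distribution; they do not occur in locally finite graphs.
\<close>

definition srw_step :: "'a set \<Rightarrow> 'a set set \<Rightarrow> 'a \<Rightarrow> 'a pmf" where
  "srw_step V E v =
    (if finite (nbrs V E v) \<and> nbrs V E v \<noteq> {} then pmf_of_set (nbrs V E v) else return_pmf v)"

text \<open>Law of \<open>X\<^sub>n\<close> for the walk started at \<open>v\<close>, given the trajectory \<open>\<omega>\<close> up to time \<open>n - 1\<close>.\<close>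

definition srw_kernel ::
  "'a set \<Rightarrow> 'a set set \<Rightarrow> 'a \<Rightarrow> nat \<Rightarrow> (nat \<Rightarrow> 'a) \<Rightarrow> 'a measure" where
  "srw_kernel V E v n \<omega> =
    measure_pmf (case n of 0 \<Rightarrow> return_pmf v | Suc m \<Rightarrow> srw_step V E (\<omega> m))"

interpretation srw: Ionescu_Tulcea "srw_kernel V E v" "\<lambda>_. count_space UNIV"
  for V :: "'a set" and E v
proof (rule Ionescu_Tulcea.intro)
  fix n
  show "srw_kernel V E v n \<in> measurable (PiM {0..<n} (\<lambda>_. count_space UNIV))
          (subprob_algebra (count_space UNIV))"
  proof (cases n)
    case 0
    then show ?thesis
      unfolding srw_kernel_def 0 nat.case by (intro measurable_const measure_pmf_in_subprob_algebra)
  next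
    case (Suc m)
    have "(\<lambda>\<omega>. \<omega> m) \<in> measurable (PiM {0..<n} (\<lambda>_. count_space (UNIV :: 'a set))) (count_space UNIV)"
      using Suc by (intro measurable_component_singleton) auto
    moreover have "(\<lambda>x. measure_pmf (srw_step V E x)) \<in>
        measurable (count_space UNIV) (subprob_algebra (count_space UNIV))"
      by (simp add: measure_pmf_in_subprob_algebra)
    ultimately show ?thesis
      unfolding srw_kernel_def Suc by (auto intro: measurable_compose)
  qed
next
  fix n :: nat and \<omega> :: "nat \<Rightarrow> 'a"
  show "prob_space (srw_kernel V E v n \<omega>)"
    unfolding srw_kernel_def by (rule prob_space_measure_pmf)
qed

text \<open>
  Law of the whole trajectory of simple random walk on the graph \<open>V\<close>, \<open>E\<close> started at \<open>v\<close>, on the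
  product space \<open>PiM UNIV (\<lambda>_. count_space UNIV)\<close>.
\<close>

definition srw_law :: "'a set \<Rightarrow> 'a set set \<Rightarrow> 'a \<Rightarrow> (nat \<Rightarrow> 'a) measure" where
  "srw_law V E v = srw.PF.lim V E v"

text \<open>For connected graphs (such as clusters), quantifying over the starting vertex is immaterial.\<close>

definition transient_graph :: "'a set \<Rightarrow> 'a set set \<Rightarrow> bool" where
  "transient_graph V E \<longleftrightarrow>
    (\<forall>v\<in>V. measure (srw_law V E v) {X \<in> space (srw_law V E v). \<exists>n\<ge>1. X n = v} < 1)"

end

theory Submission
  imports Defs
begin

text \<open>
  Call a vertex \<^emph>\<open>capacious\<close> in a configuration if the squared value at that vertex of every finitely
  supported function is at most a constant times its Dirichlet energy on the open edges. A cluster that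
  contains such a vertex is transient: were the walk recurrent, the probabilities of hitting a given
  vertex within \<open>n\<close> steps would be test functions whose energies tend to zero and whose values do not
  (\<open>capacious_imp_transient\<close>). Moreover opening edges preserves capacity, which is Rayleigh's
  principle (\<open>capacious_mono\<close>). It remains to find a capacious vertex in every infinite cluster.

  \<^emph>\<open>Capacious vertices exist.\<close> Let \<open>1 / \<zeta> < p1 < p\<close>. A geodesic spanning tree of the Cayley graph has the
  spheres as its levels, and by homogeneity a vertex of level \<open>k\<close> has at most as many descendants in level
  \<open>n\<close> as there are vertices in level \<open>n - k\<close>. There are infinitely many radii \<open>n\<close> at which the
  size of the sphere divided by \<open>\<rho> ^ n\<close> is a record, for \<open>1 / p1 < \<rho> < \<zeta>\<close>
  (\<open>exists_growth_record\<close>). For such \<open>n\<close> the uniform measure on the sphere has bounded energy for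
  \<open>p1\<close>-percolation, so by a second moment computation the open tree paths carry, with probability bounded
  below, a flow of strength at least one half and bounded energy from the root to level \<open>n\<close>
  (\<open>prob_energy_controls_ge\<close>). Letting \<open>n\<close> grow, a given vertex is capacious with positive
  probability (\<open>capacious_pos_prob\<close>), and since capacity conditions at distant vertices are
  almost independent, almost surely some vertex is (\<open>AE_exists_capacious\<close>).

  \<^emph>\<open>Every infinite cluster contains one.\<close> This is the argument of Haggstrom and Peres for the simultaneous
  birth of infinite clusters. Obtain \<open>p\<close>-percolation from \<open>p1\<close>-percolation by sprinkling independent extra
  edges. By mass transport, an infinite cluster of the result meets a neighbourhood of the set of
  capacious vertices of the first layer either not at all or infinitely often
  (\<open>AE_cluster_meets_never_finitely\<close>). So a cluster at positive distance from this set comes next to a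
  smaller neighbourhood infinitely often without entering it, and infinitely many sprinkling trials
  would all have failed (\<open>AE_no_untaken_bridges\<close>). Hence the distance is zero, and by
  monotonicity the capacious vertex of the first layer that lies in the cluster is capacious in it.
\<close>

section \<open>The law of simple random walk\<close>

lemma (in Ionescu_Tulcea) distr_lim_initial:
  "distr PF.lim (PiM {0..<n} M) (\<lambda>X. restrict X {0..<n}) = C 0 n (\<lambda>_. undefined)"
proof -
  have up: "up_to {0..<n} = n"
  proof (rule antisym)
    show "n \<le> up_to {0..<n}"
      using up_to_less[of "{0..<n}" "n - 1"] by (cases n) auto
  qed (simp add: up_to_iff_Ico)
  have "distr PF.lim (PiM {0..<n} M) (\<lambda>X. restrict X {0..<n}) = CI {0..<n}"
    by (rule distr_lim) simp
  also have "\<dots> = C 0 n (\<lambda>_. undefined)"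
    unfolding CI_def up using distr_C[of n n "\<lambda>_. undefined" 0] by (simp add: space_PiM)
  finally show ?thesis .
qed

text \<open>
  The one-step Markov property in integrated form: inside an integral over the trajectory law, the
  coordinate \<open>X n\<close> may be averaged out with the kernel \<open>P n\<close> applied to the past. This is the only
  property of the trajectory law that the estimate of return probabilities uses, apart from the
  starting point.
\<close>

lemma (in Ionescu_Tulcea) nn_integral_lim_step:
  assumes f[measurable]: "f \<in> borel_measurable (PiM {0..<Suc n} M)"
  shows "(\<integral>\<^sup>+X. f (restrict X {0..<Suc n}) \<partial>PF.lim) =
    (\<integral>\<^sup>+X. (\<integral>\<^sup>+y. f ((restrict X {0..<n})(n := y)) \<partial>P n (restrict X {0..<n})) \<partial>PF.lim)"
proof -
  let ?u = "\<lambda>_. undefined"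
  have u[simp]: "?u \<in> space (PiM {0..<0} M)" by (simp add: space_PiM)
  have r[measurable]: "(\<lambda>X. restrict X {0..<k}) \<in> measurable PF.lim (PiM {0..<k} M)" for k
    by (simp add: measurable_cong_sets[OF PF.sets_lim refl] measurable_restrict_subset)
  have I: "(\<integral>\<^sup>+y. f (fun_upd \<omega> n y) \<partial>P n \<omega>) = (\<integral>\<^sup>+x. f x \<partial>eP n \<omega>)" if "\<omega> \<in> space (PiM {0..<n} M)" for \<omega>
    using that by (simp add: nn_integral_eP)
  have meas: "(\<lambda>\<omega>. \<integral>\<^sup>+x. f x \<partial>eP n \<omega>) \<in> borel_measurable (PiM {0..<n} M)"
    by (rule measurable_compose[OF measurable_eP nn_integral_measurable_subprob_algebra[OF f]])
  have "(\<integral>\<^sup>+X. f (restrict X {0..<Suc n}) \<partial>PF.lim) = (\<integral>\<^sup>+x. f x \<partial>C 0 (Suc n) ?u)"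
    by (subst distr_lim_initial[symmetric], subst nn_integral_distr) (auto intro: r f)
  also have "\<dots> = (\<integral>\<^sup>+\<omega>. (\<integral>\<^sup>+x. f x \<partial>eP n \<omega>) \<partial>C 0 n ?u)"
    using measurable_eP[of n] sets_C[OF u, of n]
    by (simp, subst nn_integral_bind[OF f]) (auto simp: measurable_cong_sets[OF sets_C[OF u, of n] refl])
  also have "\<dots> = (\<integral>\<^sup>+X. (\<integral>\<^sup>+x. f x \<partial>eP n (restrict X {0..<n})) \<partial>PF.lim)"
    by (subst distr_lim_initial[symmetric], subst nn_integral_distr) (auto intro: r meas)
  also have "\<dots> = (\<integral>\<^sup>+X. (\<integral>\<^sup>+y. f ((restrict X {0..<n})(n := y)) \<partial>P n (restrict X {0..<n})) \<partial>PF.lim)"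
  proof (rule nn_integral_cong)
    fix X assume "X \<in> space PF.lim"
    then have "restrict X {0..<n} \<in> space (PiM {0..<n} M)"
      using measurable_space[OF r] by blast
    then show "(\<integral>\<^sup>+x. f x \<partial>eP n (restrict X {0..<n})) =
      (\<integral>\<^sup>+y. f ((restrict X {0..<n})(n := y)) \<partial>P n (restrict X {0..<n}))" by (rule I[symmetric])
  qed
  finally show ?thesis .
qed

lemma srw_markov:
  fixes g :: "'a \<Rightarrow> ennreal"
  shows "(\<integral>\<^sup>+X. (\<Prod>i=1..n. indicator (-{v}) (X i)) * g (X (Suc n)) \<partial>srw_law V E v) =
    (\<integral>\<^sup>+X. (\<Prod>i=1..n. indicator (-{v}) (X i)) * (\<integral>\<^sup>+y. g y \<partial>srw_step V E (X n)) \<partial>srw_law V E v)"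
proof -
  let ?M = "\<lambda>_::nat. count_space (UNIV :: 'a set)"
  let ?f = "\<lambda>X::nat\<Rightarrow>'a. (\<Prod>i=1..n. indicator (-{v}) (X i)) * g (X (Suc n)) :: ennreal"
  have c: "(\<lambda>X. h (X i)) \<in> borel_measurable (PiM {0..<Suc (Suc n)} ?M)" if "i \<le> Suc n" for h :: "'a \<Rightarrow> ennreal" and i
    using that by (intro measurable_compose[OF measurable_component_singleton, where g=h]) auto
  have f: "?f \<in> borel_measurable (PiM {0..<Suc (Suc n)} ?M)"
    by (intro borel_measurable_times_ennreal borel_measurable_prod_ennreal c) auto
  have "(\<integral>\<^sup>+X. ?f (restrict X {0..<Suc (Suc n)}) \<partial>srw_law V E v) =
     (\<integral>\<^sup>+X. (\<integral>\<^sup>+y. ?f ((restrict X {0..<Suc n})(Suc n := y))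
        \<partial>srw_kernel V E v (Suc n) (restrict X {0..<Suc n})) \<partial>srw_law V E v)"
    unfolding srw_law_def by (rule srw.nn_integral_lim_step[OF f])
  moreover have "?f (restrict X {0..<Suc (Suc n)}) = ?f X" for X
    by simp
  moreover have "(\<integral>\<^sup>+y. ?f ((restrict X {0..<Suc n})(Suc n := y))
        \<partial>srw_kernel V E v (Suc n) (restrict X {0..<Suc n})) =
      (\<Prod>i=1..n. indicator (-{v}) (X i)) * (\<integral>\<^sup>+y. g y \<partial>srw_step V E (X n))" for X
  proof -
    have "(\<integral>\<^sup>+y. ?f ((restrict X {0..<Suc n})(Suc n := y))
        \<partial>srw_kernel V E v (Suc n) (restrict X {0..<Suc n})) =
      (\<integral>\<^sup>+y. (\<Prod>i=1..n. indicator (-{v}) (X i)) * g y \<partial>srw_step V E (X n))"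
      by (simp add: srw_kernel_def)
    then show ?thesis by (simp add: nn_integral_cmult)
  qed
  ultimately show ?thesis by simp
qed

lemma prob_space_srw_law: "prob_space (srw_law V E v)"
proof (rule prob_space_distrD)
  have "prob_space (distr (srw_law V E v) (PiM {0..<0} (\<lambda>_. count_space UNIV)) (\<lambda>X. restrict X {0..<0}))"
    unfolding srw_law_def srw.distr_lim_initial by (rule srw.prob_space_C) (simp add: space_PiM)
  then show "prob_space (distr (srw_law V E v) (PiM {0..<0} (\<lambda>_. count_space UNIV)) (\<lambda>X. restrict X {0..<0}))" .
  show "(\<lambda>X. restrict X {0..<0}) \<in> measurable (srw_law V E v) (PiM {0..<0} (\<lambda>_. count_space UNIV))"
    unfolding srw_law_def measurable_cong_sets[OF srw.PF.sets_lim refl] by (rule measurable_restrict_subset) simp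
qed

lemma AE_srw_start: "AE X in srw_law V E v. X 0 = v"
proof -
  have 1: "{X \<in> space (PiM {0..<1} (\<lambda>_::nat. count_space UNIV)). X 0 = v} \<in> sets (PiM {0..<1} (\<lambda>_. count_space UNIV))"
    by measurable
  let ?f = "\<lambda>X::nat\<Rightarrow>'a. indicator (-{v}) (X 0) :: ennreal"
  have f: "?f \<in> borel_measurable (PiM {0..<Suc 0} (\<lambda>_. count_space UNIV))"
    by (intro measurable_compose[OF measurable_component_singleton, where g="indicator (-{v})"]) auto
  have "(\<integral>\<^sup>+X. ?f (restrict X {0..<Suc 0}) \<partial>srw_law V E v) = 0"
    unfolding srw_law_def by (subst srw.nn_integral_lim_step[OF f]) (simp add: srw_kernel_def)
  then have 0: "(\<integral>\<^sup>+X. ?f X \<partial>srw_law V E v) = 0" by simp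
  have "?f \<in> borel_measurable (srw_law V E v)"
    unfolding srw_law_def measurable_cong_sets[OF srw.PF.sets_lim refl]
    by (intro measurable_compose[OF measurable_component_singleton, where g="indicator (-{v})"]) auto
  from nn_integral_0_iff_AE[OF this] 0 show ?thesis
    by (auto elim!: eventually_mono split: split_indicator_asm)
qed

section \<open>Capacity and transience\<close>

text \<open>
  Dirichlet energy of a function that vanishes off \<open>F\<close>: edges inside \<open>F\<close> are counted twice, edges
  leaving \<open>F\<close> once. Summing over ordered pairs avoids choosing orientations, and the factor two
  is harmless. Every term is a square, so the energy is monotone in the edge set.
\<close>

definition dirichlet :: "'a set \<Rightarrow> 'a set set \<Rightarrow> 'a set \<Rightarrow> ('a \<Rightarrow> real) \<Rightarrow> real" where
  "dirichlet V E F g = (\<Sum>y\<in>F. \<Sum>w\<in>nbrs V E y. (g y - g w)\<^sup>2)"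

text \<open>
  A bound on the value at a vertex by the energy says that the vertex has positive capacity: the
  effective conductance from \<open>x\<close> to the complement of \<open>F\<close> is at least of order \<open>1 / M\<close>. With a
  constant that serves all finite \<open>F\<close> this is transience. Stating it for test functions rather than
  for flows makes it an intersection of conditions that each involve finitely many edges, and makes
  Rayleigh monotonicity immediate.
\<close>

definition energy_controls :: "real \<Rightarrow> 'a set \<Rightarrow> 'a set set \<Rightarrow> 'a \<Rightarrow> 'a set \<Rightarrow> bool" where
  "energy_controls M V E x F \<longleftrightarrow>
    (\<forall>g. (\<forall>y. y \<notin> F \<longrightarrow> g y = 0) \<longrightarrow> (g x)\<^sup>2 \<le> M * dirichlet V E F g)"

definition capacious :: "real \<Rightarrow> 'a set \<Rightarrow> 'a set set \<Rightarrow> 'a \<Rightarrow> bool" where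
  "capacious M V E x \<longleftrightarrow> (\<forall>F. finite F \<and> F \<subseteq> V \<longrightarrow> energy_controls M V E x F)"

lemma capaciousD:
  "\<lbrakk>capacious M V E x; finite F; F \<subseteq> V; \<And>y. y \<notin> F \<Longrightarrow> g y = 0\<rbrakk> \<Longrightarrow> (g x)\<^sup>2 \<le> M * dirichlet V E F g"
  unfolding capacious_def energy_controls_def by blast

lemma capaciousI:
  "(\<And>F g. \<lbrakk>finite F; F \<subseteq> V; \<And>y. y \<notin> F \<Longrightarrow> g y = 0\<rbrakk> \<Longrightarrow> (g x)\<^sup>2 \<le> M * dirichlet V E F g) \<Longrightarrow>
    capacious M V E x"
  unfolding capacious_def energy_controls_def by blast

text \<open>
  The probability that the walk started at \<open>y\<close> visits \<open>v\<close> during its first \<open>n\<close> steps, time zero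
  included. As a function of \<open>y\<close> it is supported in the ball of radius \<open>n\<close> about \<open>v\<close>, so it is an
  admissible test function, and it is subharmonic off \<open>v\<close>.
\<close>

primrec hit_prob :: "'a set \<Rightarrow> 'a set set \<Rightarrow> 'a \<Rightarrow> nat \<Rightarrow> 'a \<Rightarrow> real" where
  "hit_prob V E v 0 y = of_bool (y = v)"
| "hit_prob V E v (Suc n) y = (if y = v then 1
     else (\<Sum>w\<in>nbrs V E y. hit_prob V E v n w) / card (nbrs V E y))"

definition return_prob :: "'a set \<Rightarrow> 'a set set \<Rightarrow> 'a \<Rightarrow> nat \<Rightarrow> real" where
  "return_prob V E v n = (\<Sum>w\<in>nbrs V E v. hit_prob V E v n w) / card (nbrs V E v)"

lemma nbrs_sym: "y \<in> V \<Longrightarrow> w \<in> nbrs V E y \<Longrightarrow> y \<in> nbrs V E w"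
  by (auto simp: nbrs_def insert_commute)

lemma nbrs_sym_iff: "y \<in> V \<Longrightarrow> w \<in> V \<Longrightarrow> w \<in> nbrs V E y \<longleftrightarrow> y \<in> nbrs V E w"
  by (auto simp: nbrs_def insert_commute)

lemma hit_prob_target [simp]: "hit_prob V E v n v = 1"
  by (cases n) auto

lemma average_le_1:
  fixes f :: "'a \<Rightarrow> real"
  assumes "\<And>w. w \<in> A \<Longrightarrow> f w \<le> 1"
  shows "sum f A / card A \<le> 1"
proof (cases "card A = 0")
  case False
  have "sum f A \<le> real (card A) * 1" by (rule sum_bounded_above) (use assms in auto)
  with False show ?thesis by (simp add: field_simps)
qed auto

lemma hit_prob_bounds: "0 \<le> hit_prob V E v n y \<and> hit_prob V E v n y \<le> 1"
proof (induction n arbitrary: y)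
  case (Suc n)
  then show ?case by (auto intro!: average_le_1 divide_nonneg_nonneg sum_nonneg)
qed auto

lemma hit_prob_nonneg: "0 \<le> hit_prob V E v n y" and hit_prob_le_1: "hit_prob V E v n y \<le> 1"
  using hit_prob_bounds[of V E v n y] by auto

lemma hit_prob_mono: "hit_prob V E v n y \<le> hit_prob V E v (Suc n) y"
proof (induction n arbitrary: y)
  case 0
  show ?case using hit_prob_bounds[of V E v "Suc 0" y] by auto
next
  case (Suc n)
  then show ?case
    unfolding hit_prob.simps(2)[of V E v n y] hit_prob.simps(2)[of V E v "Suc n" y]
    by (auto intro!: divide_right_mono sum_mono simp del: hit_prob.simps)
qed

lemma hit_prob_incseq: "m \<le> n \<Longrightarrow> hit_prob V E v m y \<le> hit_prob V E v n y"
  by (rule lift_Suc_mono_le[of "\<lambda>n. hit_prob V E v n y"]) (auto intro: hit_prob_mono simp del: hit_prob.simps)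

lemma hit_prob_finite_support:
  assumes "\<And>y. y \<in> V \<Longrightarrow> finite (nbrs V E y)"
  shows "finite {y \<in> V. hit_prob V E v n y \<noteq> 0}"
proof (induction n)
  case (Suc n)
  have "{y \<in> V. hit_prob V E v (Suc n) y \<noteq> 0} \<subseteq>
      insert v (\<Union>w\<in>{y \<in> V. hit_prob V E v n y \<noteq> 0}. nbrs V E w)"
  proof
    fix y assume "y \<in> {y \<in> V. hit_prob V E v (Suc n) y \<noteq> 0}"
    then have y: "y \<in> V" "hit_prob V E v (Suc n) y \<noteq> 0" by auto
    show "y \<in> insert v (\<Union>w\<in>{y \<in> V. hit_prob V E v n y \<noteq> 0}. nbrs V E w)"
    proof (cases "y = v")
      case False
      with y obtain w where "w \<in> nbrs V E y" "hit_prob V E v n w \<noteq> 0"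
        by (auto dest: sum.not_neutral_contains_not_neutral)
      with y(1) show ?thesis using nbrs_sym[OF y(1)] by (auto simp: nbrs_def)
    qed simp
  qed
  then show ?case by (rule finite_subset) (use Suc assms in auto)
next
  case 0
  show ?case by (rule finite_subset[of _ "{v}"]) auto
qed

lemma hit_prob_pos:
  assumes "(y, v) \<in> (adj V E)\<^sup>*" and fin: "\<And>y. y \<in> V \<Longrightarrow> finite (nbrs V E y)"
  shows "\<exists>n. hit_prob V E v n y > 0"
  using assms(1)
proof (induction rule: converse_rtrancl_induct)
  case base
  show ?case by (rule exI[of _ 0]) simp
next
  case (step y w)
  then obtain n where n: "hit_prob V E v n w > 0" by blast
  have w: "w \<in> nbrs V E y" "finite (nbrs V E y)" using step fin by (auto simp: adj_def)
  then have "card (nbrs V E y) > 0" by (auto simp: card_gt_0_iff)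
  moreover have "(\<Sum>w\<in>nbrs V E y. hit_prob V E v n w) > 0"
    using w n by (intro sum_pos2[of _ w]) (auto intro: hit_prob_nonneg)
  ultimately have "hit_prob V E v (Suc n) y > 0" by auto
  then show ?case by blast
qed

text \<open>
  Summation by parts. The inequality absorbs the edges that leave \<open>F\<close>, which occur in the inner
  product with full weight.
\<close>

lemma dirichlet_le_twice_inner_product:
  assumes F: "finite F" "F \<subseteq> V" and supp: "\<And>y. y \<notin> F \<Longrightarrow> g y = 0"
    and fin: "\<And>y. y \<in> V \<Longrightarrow> finite (nbrs V E y)"
  shows "dirichlet V E F g \<le> 2 * (\<Sum>y\<in>F. \<Sum>w\<in>nbrs V E y. g y * (g y - g w))"
proof -
  let ?N = "nbrs V E"
  have "(\<Sum>y\<in>F. \<Sum>w\<in>?N y. g w * (g w - g y)) = (\<Sum>y\<in>F. \<Sum>w\<in>F \<inter> ?N y. g w * (g w - g y))"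
    using F fin supp by (intro sum.cong refl sum.mono_neutral_right) auto
  also have "\<dots> = (\<Sum>y\<in>F. \<Sum>w\<in>F. if w \<in> ?N y then g w * (g w - g y) else 0)"
    by (rule sum.cong[OF refl], rule sum.inter_restrict[OF F(1)])
  also have "\<dots> = (\<Sum>w\<in>F. \<Sum>y\<in>F. if w \<in> ?N y then g w * (g w - g y) else 0)"
    by (rule sum.swap)
  also have "\<dots> = (\<Sum>w\<in>F. \<Sum>y\<in>F. if y \<in> ?N w then g w * (g w - g y) else 0)"
    using F nbrs_sym_iff[of _ V _ E] by (intro sum.cong refl if_cong) auto
  also have "\<dots> = (\<Sum>w\<in>F. \<Sum>y\<in>F \<inter> ?N w. g w * (g w - g y))"
    by (rule sum.cong[OF refl], rule sum.inter_restrict[OF F(1), symmetric])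
  also have "\<dots> \<le> (\<Sum>w\<in>F. \<Sum>y\<in>?N w. g w * (g w - g y))"
    using F fin supp by (intro sum_mono sum_mono2) auto
  finally have le: "(\<Sum>y\<in>F. \<Sum>w\<in>?N y. g w * (g w - g y)) \<le> (\<Sum>w\<in>F. \<Sum>y\<in>?N w. g w * (g w - g y))" .
  have "dirichlet V E F g = (\<Sum>y\<in>F. \<Sum>w\<in>?N y. g y * (g y - g w) + g w * (g w - g y))"
    unfolding dirichlet_def by (intro sum.cong refl) (simp add: power2_eq_square algebra_simps)
  also have "\<dots> = (\<Sum>y\<in>F. \<Sum>w\<in>?N y. g y * (g y - g w)) + (\<Sum>y\<in>F. \<Sum>w\<in>?N y. g w * (g w - g y))"
    by (simp add: sum.distrib)
  finally show ?thesis using le by simp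
qed

text \<open>
  Off \<open>v\<close> the function increases under one more step of averaging, so its Laplacian has a favourable
  sign there; only the term at \<open>v\<close> survives, and that term is the escape probability up to time
  \<open>n + 1\<close> times the degree.
\<close>

lemma dirichlet_hit_prob_le:
  fixes n :: nat
  assumes fin: "\<And>y. y \<in> V \<Longrightarrow> finite (nbrs V E y)" and ne: "\<And>y. y \<in> V \<Longrightarrow> nbrs V E y \<noteq> {}"
    and v: "v \<in> V"
  defines "F \<equiv> {y \<in> V. hit_prob V E v n y \<noteq> 0}"
  defines "g \<equiv> \<lambda>y. if y \<in> V then hit_prob V E v n y else 0"
  shows "dirichlet V E F g \<le> 2 * (card (nbrs V E v) * (1 - return_prob V E v n))"
proof -
  let ?N = "nbrs V E"
  have F: "finite F" "F \<subseteq> V" unfolding F_def using hit_prob_finite_support[OF fin] by auto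
  have vF: "v \<in> F" using v by (simp add: F_def)
  have "dirichlet V E F g \<le> 2 * (\<Sum>y\<in>F. \<Sum>w\<in>?N y. g y * (g y - g w))"
    by (rule dirichlet_le_twice_inner_product[OF F _ fin]) (auto simp: F_def g_def)
  also have "(\<Sum>y\<in>F. \<Sum>w\<in>?N y. g y * (g y - g w)) \<le>
     (\<Sum>y\<in>F. if y = v then card (?N v) * (1 - return_prob V E v n) else 0)"
  proof (rule sum_mono)
    fix y assume "y \<in> F"
    then have y: "y \<in> V" by (simp add: F_def)
    have c: "card (?N y) > 0" using fin ne y by (auto simp: card_gt_0_iff)
    have "(\<Sum>w\<in>?N y. g y * (g y - g w)) = g y * (\<Sum>w\<in>?N y. g y - g w)"
      by (simp add: sum_distrib_left)
    also have "(\<Sum>w\<in>?N y. g y - g w) = card (?N y) * hit_prob V E v n y - (\<Sum>w\<in>?N y. hit_prob V E v n w)"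
    proof -
      have "(\<Sum>w\<in>?N y. g w) = (\<Sum>w\<in>?N y. hit_prob V E v n w)"
        by (rule sum.cong) (auto simp: g_def nbrs_def)
      then show ?thesis using y by (simp add: sum_subtractf g_def)
    qed
    also have "\<dots> = card (?N y) * (hit_prob V E v n y - (\<Sum>w\<in>?N y. hit_prob V E v n w) / card (?N y))"
      using c by (simp add: field_simps)
    finally have eq: "(\<Sum>w\<in>?N y. g y * (g y - g w)) =
      g y * (card (?N y) * (hit_prob V E v n y - (\<Sum>w\<in>?N y. hit_prob V E v n w) / card (?N y)))" .
    show "(\<Sum>w\<in>?N y. g y * (g y - g w)) \<le> (if y = v then card (?N v) * (1 - return_prob V E v n) else 0)"
    proof (cases "y = v")
      case True
      then show ?thesis using eq y by (simp add: return_prob_def g_def)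
    next
      case False
      then have "(\<Sum>w\<in>?N y. hit_prob V E v n w) / card (?N y) = hit_prob V E v (Suc n) y" by simp
      then have "hit_prob V E v n y - (\<Sum>w\<in>?N y. hit_prob V E v n w) / card (?N y) \<le> 0"
        using hit_prob_mono[of V E v n y] by (simp del: hit_prob.simps)
      moreover have "g y \<ge> 0" by (simp add: g_def hit_prob_nonneg)
      ultimately have "(\<Sum>w\<in>?N y. g y * (g y - g w)) \<le> 0"
        unfolding eq by (intro mult_nonneg_nonpos) auto
      with False show ?thesis by simp
    qed
  qed
  also have "\<dots> = card (?N v) * (1 - return_prob V E v n)"
    using F vF by simp
  finally show ?thesis by simp
qed

lemma nn_integral_srw_step_survival:
  assumes "finite (nbrs V E y)" "nbrs V E y \<noteq> {}"
  shows "(\<integral>\<^sup>+w. ennreal (1 - hit_prob V E v n w) \<partial>srw_step V E y) =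
    ennreal (1 - (\<Sum>w\<in>nbrs V E y. hit_prob V E v n w) / card (nbrs V E y))"
proof -
  have c: "card (nbrs V E y) > 0" using assms by (auto simp: card_gt_0_iff)
  have "(\<integral>\<^sup>+w. ennreal (1 - hit_prob V E v n w) \<partial>srw_step V E y) =
    (\<Sum>w\<in>nbrs V E y. ennreal (1 - hit_prob V E v n w)) / card (nbrs V E y)"
    using assms by (simp add: srw_step_def nn_integral_pmf_of_set)
  also have "(\<Sum>w\<in>nbrs V E y. ennreal (1 - hit_prob V E v n w)) =
     ennreal (\<Sum>w\<in>nbrs V E y. (1 - hit_prob V E v n w))"
    by (intro sum_ennreal) (simp add: hit_prob_le_1)
  also have "\<dots> / card (nbrs V E y) = ennreal ((\<Sum>w\<in>nbrs V E y. (1 - hit_prob V E v n w)) / card (nbrs V E y))"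
    using c
    by (simp add: ennreal_of_nat_eq_real_of_nat divide_ennreal sum_nonneg hit_prob_le_1 del: sum_subtractf)
  finally show ?thesis using c by (simp add: sum_subtractf diff_divide_distrib)
qed

text \<open>
  At a vertex where the walk is absorbed by convention both sides equal one, since there the
  division by the degree yields zero in the recursion for the hitting probability.
\<close>

lemma nn_integral_srw_step_miss:
  assumes "y \<noteq> v"
  shows "(\<integral>\<^sup>+w. ennreal (1 - hit_prob V E v n w) \<partial>srw_step V E y) = ennreal (1 - hit_prob V E v (Suc n) y)"
proof (cases "finite (nbrs V E y) \<and> nbrs V E y \<noteq> {}")
  case True
  then show ?thesis using assms by (simp add: nn_integral_srw_step_survival)
next
  case False
  then have 0: "hit_prob V E v m y = 0" for m using assms by (cases m) auto
  have "srw_step V E y = return_pmf y" using False unfolding srw_step_def by (rule if_not_P)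
  then show ?thesis using 0 by (simp del: hit_prob.simps)
qed

text \<open>
  The integral of \<open>[X avoids v at times 1..n] * P(no visit to v within r steps from X (n+1))\<close> depends
  only on \<open>n + r\<close>, by one application of the Markov property. Comparing \<open>n = 0\<close> with \<open>r = 0\<close> gives the
  claim.
\<close>

lemma no_return_prob:
  assumes "finite (nbrs V E v)" "nbrs V E v \<noteq> {}"
  shows "(\<integral>\<^sup>+X. (\<Prod>i=1..Suc r. indicator (-{v}) (X i)) \<partial>srw_law V E v) = ennreal (1 - return_prob V E v r)"
proof -
  let ?s = "\<lambda>r w. ennreal (1 - hit_prob V E v r w)"
  let ?T = "\<lambda>n r. (\<integral>\<^sup>+X. (\<Prod>i=1..n. indicator (-{v}) (X i)) * ?s r (X (Suc n)) \<partial>srw_law V E v)"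
  have shift: "?T n (Suc r) = ?T (Suc n) r" for n r
  proof -
    have "?T (Suc n) r = (\<integral>\<^sup>+X. (\<Prod>i=1..Suc n. indicator (-{v}) (X i)) *
        (\<integral>\<^sup>+y. ?s r y \<partial>srw_step V E (X (Suc n))) \<partial>srw_law V E v)"
      by (rule srw_markov)
    also have "\<dots> = ?T n (Suc r)"
    proof (rule nn_integral_cong)
      fix X
      show "(\<Prod>i=1..Suc n. indicator (-{v}) (X i)) * (\<integral>\<^sup>+y. ?s r y \<partial>srw_step V E (X (Suc n))) =
        (\<Prod>i=1..n. indicator (-{v}) (X i)) * ?s (Suc r) (X (Suc n))"
        by (cases "X (Suc n) = v") (simp_all add: nn_integral_srw_step_miss mult.assoc del: hit_prob.simps)
    qed
    finally show ?thesis by simp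
  qed
  have "?T 0 r = ?T r 0"
  proof -
    have "?T n r = ?T (n + r) 0" for n
    proof (induction r arbitrary: n)
      case (Suc r)
      show ?case unfolding shift Suc.IH by simp
    qed simp
    from this[of 0] show ?thesis by simp
  qed
  moreover have "?T r 0 = (\<integral>\<^sup>+X. (\<Prod>i=1..Suc r. indicator (-{v}) (X i)) \<partial>srw_law V E v)"
    by (intro nn_integral_cong) (simp add: indicator_def)
  moreover have "?T 0 r = (\<integral>\<^sup>+X. (\<integral>\<^sup>+y. ?s r y \<partial>srw_step V E (X 0)) \<partial>srw_law V E v)"
    using srw_markov[where n=0 and g="?s r" and V=V and E=E and v=v] by simp
  moreover have "\<dots> = (\<integral>\<^sup>+X. ennreal (1 - return_prob V E v r) \<partial>srw_law V E v)"
  proof (rule nn_integral_cong_AE)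
    have "(\<integral>\<^sup>+y. ?s r y \<partial>srw_step V E v) = ennreal (1 - return_prob V E v r)"
      unfolding return_prob_def by (rule nn_integral_srw_step_survival[OF assms])
    then show "AE X in srw_law V E v. (\<integral>\<^sup>+y. ?s r y \<partial>srw_step V E (X 0)) = ennreal (1 - return_prob V E v r)"
      using AE_srw_start[where V=V and E=E and v=v] by (auto elim: eventually_mono)
  qed
  moreover have "\<dots> = ennreal (1 - return_prob V E v r)"
  proof -
    interpret prob_space "srw_law V E v" by (rule prob_space_srw_law)
    show ?thesis by (simp add: emeasure_space_1)
  qed
  ultimately show ?thesis by simp
qed

text \<open>
  If the walk returned to \<open>v\<close> almost surely, the energies of the functions \<open>hit_prob V E v n\<close> would
  tend to zero. Their values at \<open>x\<close> increase with \<open>n\<close> and are eventually positive, because \<open>v\<close> can be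
  reached from \<open>x\<close>; this contradicts the bound of the value at \<open>x\<close> by the energy. Testing at \<open>x\<close>
  rather than at \<open>v\<close> makes it unnecessary to transport the capacity bound from \<open>x\<close> to \<open>v\<close>.
\<close>

lemma capacious_imp_transient:
  assumes fin: "\<And>y. y \<in> V \<Longrightarrow> finite (nbrs V E y)" and ne: "\<And>y. y \<in> V \<Longrightarrow> nbrs V E y \<noteq> {}"
    and x: "capacious M V E x" and conn: "\<And>v. v \<in> V \<Longrightarrow> (x, v) \<in> (adj V E)\<^sup>*" and xV: "x \<in> V"
  shows "transient_graph V E"
  unfolding transient_graph_def
proof
  fix v assume v: "v \<in> V"
  interpret L: prob_space "srw_law V E v" by (rule prob_space_srw_law)
  let ?L = "srw_law V E v"
  have sp: "space ?L = UNIV"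
    unfolding srw_law_def srw.PF.space_lim by (simp add: space_PiM)
  have comp: "(\<lambda>X. X i) \<in> measurable ?L (count_space UNIV)" for i
    unfolding srw_law_def measurable_cong_sets[OF srw.PF.sets_lim refl]
    by (intro measurable_component_singleton) auto
  have sets1: "{X \<in> space ?L. X i = v} \<in> sets ?L" for i
    using measurable_sets[OF comp[of i], of "{v}"] by (simp add: vimage_def Int_def conj_commute)
  let ?R = "{X \<in> space ?L. \<exists>n\<ge>1. X n = v}"
  have R: "?R \<in> sets ?L"
  proof -
    have "?R = (\<Union>n\<in>{1..}. {X \<in> space ?L. X n = v})" by auto
    also have "\<dots> \<in> sets ?L" using sets1 by (intro sets.countable_UN') auto
    finally show ?thesis .
  qed
  let ?A = "\<lambda>r. {X \<in> space ?L. \<forall>i\<in>{1..Suc r}. X i \<noteq> v}"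
  have A: "?A r \<in> sets ?L" for r
  proof -
    have "?A r = space ?L - (\<Union>i\<in>{1..Suc r}. {X \<in> space ?L. X i = v})" by auto
    also have "\<dots> \<in> sets ?L" using sets1 by (intro sets.Diff sets.finite_UN) auto
    finally show ?thesis .
  qed
  show "measure ?L ?R < 1"
  proof (rule ccontr)
    assume "\<not> measure ?L ?R < 1"
    then have R1: "measure ?L ?R = 1" using L.prob_le_1[of ?R] by linarith
    have PA: "measure ?L (?A r) = 1 - return_prob V E v r" for r
    proof -
      have "emeasure ?L (?A r) = (\<integral>\<^sup>+X. indicator (?A r) X \<partial>?L)" using A by simp
      also have "\<dots> = (\<integral>\<^sup>+X. (\<Prod>i=1..Suc r. indicator (-{v}) (X i)) \<partial>?L)"
      proof (rule nn_integral_cong)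
        fix X
        show "indicator (?A r) X = (\<Prod>i=1..Suc r. indicator (-{v}) (X i) :: ennreal)"
        proof (cases "\<forall>i\<in>{1..Suc r}. X i \<noteq> v")
          case True
          then have "(\<Prod>i=1..Suc r. indicator (-{v}) (X i) :: ennreal) = 1"
            by (intro prod.neutral) (auto simp: indicator_def)
          with True show ?thesis by (simp add: sp del: prod.cl_ivl_Suc)
        next
          case False
          then have "(\<Prod>i=1..Suc r. indicator (-{v}) (X i) :: ennreal) = 0"
            by (intro prod_zero) (auto simp: indicator_def)
          with False show ?thesis by (simp add: sp del: prod.cl_ivl_Suc)
        qed
      qed
      also have "\<dots> = ennreal (1 - return_prob V E v r)"
        by (rule no_return_prob) (use fin ne v in auto)
      finally have "emeasure ?L (?A r) = ennreal (1 - return_prob V E v r)" .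
      moreover have "return_prob V E v r \<le> 1" unfolding return_prob_def
        by (intro average_le_1) (rule hit_prob_le_1)
      ultimately show ?thesis by (simp add: measure_def)
    qed
    have "(\<lambda>r. measure ?L (?A r)) \<longlonglongrightarrow> measure ?L (\<Inter>r. ?A r)"
      using A by (intro L.finite_Lim_measure_decseq) (auto simp: decseq_def)
    also have "(\<Inter>r. ?A r) = space ?L - ?R"
    proof (intro equalityI subsetI)
      fix X assume X: "X \<in> (\<Inter>r. ?A r)"
      have "X n \<noteq> v" if "1 \<le> n" for n
        using X that by (auto dest!: spec[of _ n])
      with X show "X \<in> space ?L - ?R" by auto
    qed auto
    also have "measure ?L (space ?L - ?R) = 0"
      using L.prob_compl[OF R] R1 by simp
    finally have lim: "(\<lambda>r. 1 - return_prob V E v r) \<longlonglongrightarrow> 0" by (simp only: PA)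
    obtain n where n: "hit_prob V E v n x > 0"
      using hit_prob_pos[OF conn[OF v] fin] by blast
    have bound: "(hit_prob V E v n x)\<^sup>2 \<le> \<bar>M\<bar> * (2 * (card (nbrs V E v) * (1 - return_prob V E v m)))"
      if "n \<le> m" for m
    proof -
      let ?F = "{y \<in> V. hit_prob V E v m y \<noteq> 0}"
      let ?g = "\<lambda>y. if y \<in> V then hit_prob V E v m y else 0"
      have "(hit_prob V E v n x)\<^sup>2 \<le> (?g x)\<^sup>2"
        using hit_prob_incseq[OF that, of V E v x] n xV by (simp add: power_mono)
      also have "\<dots> \<le> M * dirichlet V E ?F ?g"
        by (rule capaciousD[OF x hit_prob_finite_support[OF fin]]) auto
      also have "\<dots> \<le> \<bar>M\<bar> * dirichlet V E ?F ?g"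
        by (intro mult_right_mono) (auto simp: dirichlet_def intro!: sum_nonneg)
      also have "\<dots> \<le> \<bar>M\<bar> * (2 * (card (nbrs V E v) * (1 - return_prob V E v m)))"
        by (intro mult_left_mono dirichlet_hit_prob_le[OF fin ne v]) auto
      finally show ?thesis .
    qed
    have "(\<lambda>m. \<bar>M\<bar> * (2 * (card (nbrs V E v) * (1 - return_prob V E v m)))) \<longlonglongrightarrow>
        \<bar>M\<bar> * (2 * (real (card (nbrs V E v)) * 0))"
      by (intro tendsto_intros lim)
    then have "(hit_prob V E v n x)\<^sup>2 \<le> \<bar>M\<bar> * (2 * (real (card (nbrs V E v)) * 0))"
      by (rule LIMSEQ_le_const) (use bound in blast)
    with n show False by simp
  qed
qed

section \<open>Neighbourhoods, components and graph isomorphisms\<close>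

text \<open>
  The closed \<open>n\<close>-neighbourhood of a set. Balls and components are special cases, so that one
  recursion settles the effect of isomorphisms, finiteness and measurability for all of them.
\<close>

primrec thicken :: "'a set \<Rightarrow> 'a set set \<Rightarrow> nat \<Rightarrow> 'a set \<Rightarrow> 'a set" where
  "thicken V E 0 A = A"
| "thicken V E (Suc n) A = thicken V E n A \<union> (\<Union>x\<in>thicken V E n A. nbrs V E x)"

lemma thicken_subset: "A \<subseteq> V \<Longrightarrow> thicken V E n A \<subseteq> V"
  by (induction n) (auto simp: nbrs_def)

lemma thicken_mono: "m \<le> n \<Longrightarrow> thicken V E m A \<subseteq> thicken V E n A"
  by (rule lift_Suc_mono_le[of "\<lambda>n. thicken V E n A"]) auto

lemma finite_thicken:
  assumes "\<And>x. x \<in> V \<Longrightarrow> finite (nbrs V E x)" "finite A" "A \<subseteq> V"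
  shows "finite (thicken V E n A)"
  using assms thicken_subset[OF assms(3)] by (induction n) (auto simp: subset_eq)

lemma thicken_relpow:
  assumes "A \<subseteq> V"
  shows "y \<in> thicken V E n A \<longleftrightarrow> (\<exists>x\<in>A. \<exists>k\<le>n. (x, y) \<in> adj V E ^^ k)"
proof (induction n arbitrary: y)
  case (Suc n)
  have "y \<in> thicken V E (Suc n) A \<longleftrightarrow> y \<in> thicken V E n A \<or> (\<exists>z. z \<in> thicken V E n A \<and> (z, y) \<in> adj V E)"
    using thicken_subset[OF assms, of E n] by (auto simp: adj_def)
  also have "\<dots> \<longleftrightarrow> (\<exists>x\<in>A. \<exists>k\<le>n. (x, y) \<in> adj V E ^^ k) \<or> (\<exists>x\<in>A. \<exists>k\<le>n. (x, y) \<in> adj V E ^^ Suc k)"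
    unfolding Suc.IH relpow.simps(2) relcomp_unfold by blast
  also have "\<dots> \<longleftrightarrow> (\<exists>x\<in>A. \<exists>k\<le>Suc n. (x, y) \<in> adj V E ^^ k)" (is "?l \<longleftrightarrow> ?r")
  proof
    assume ?l
    then show ?r by (meson Suc_le_mono le_SucI)
  next
    assume ?r
    then obtain x k where x: "x \<in> A" and k: "k \<le> Suc n" "(x, y) \<in> adj V E ^^ k" by blast
    show ?l
    proof (cases "k = Suc n")
      case True
      with x k show ?thesis by blast
    next
      case False
      with k(1) have "k \<le> n" by simp
      with x k show ?thesis by blast
    qed
  qed
  finally show ?case .
qed auto

lemma graph_ball_eq_thicken:
  assumes "x \<in> V"
  shows "graph_ball V E x n = thicken V E n {x}"
proof -
  have "graph_dist V E x y \<le> enat n \<longleftrightarrow> (\<exists>k\<le>n. (x, y) \<in> adj V E ^^ k)" for y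
  proof (cases "{k. (x, y) \<in> adj V E ^^ k} = {}")
    case True
    then show ?thesis unfolding graph_dist_def True using True by (auto simp: top_enat_def)
  next
    case False
    let ?K = "{k. (x, y) \<in> adj V E ^^ k}"
    have "graph_dist V E x y = enat (Least (\<lambda>k. k \<in> ?K))"
      unfolding graph_dist_def
    proof (rule antisym)
      show "(INF k\<in>?K. enat k) \<le> enat (LEAST k. k \<in> ?K)"
        using False by (intro INF_lower) (auto intro: LeastI)
      show "enat (LEAST k. k \<in> ?K) \<le> (INF k\<in>?K. enat k)"
        by (intro INF_greatest) (auto intro: Least_le)
    qed
    then show ?thesis
      using False by (auto intro: LeastI Least_le order_trans[OF Least_le])
  qed
  moreover have "y \<in> V" if "\<exists>k\<le>n. (x, y) \<in> adj V E ^^ k" for y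
  proof -
    from that have "y \<in> thicken V E n {x}" using assms by (simp add: thicken_relpow)
    then show ?thesis using thicken_subset[of "{x}" V E n] assms by auto
  qed
  ultimately show ?thesis
    unfolding graph_ball_def using assms by (auto simp: thicken_relpow)
qed

definition component_of :: "'a set \<Rightarrow> 'a set set \<Rightarrow> 'a \<Rightarrow> 'a set" where
  "component_of V E x = {y \<in> V. (x, y) \<in> (adj V E)\<^sup>*}"

lemma component_of_eq_thicken:
  assumes "x \<in> V"
  shows "component_of V E x = (\<Union>n. thicken V E n {x})"
proof -
  have "(x, y) \<in> (adj V E)\<^sup>* \<longleftrightarrow> (\<exists>n. y \<in> thicken V E n {x})" for y
    using assms by (auto simp: thicken_relpow rtrancl_power)
  then show ?thesis
    using thicken_subset[of "{x}" V E] assms unfolding component_of_def by blast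
qed

text \<open>
  The group acts on the Cayley graph by left multiplication, and it maps the open subgraph of a
  translated configuration onto the open subgraph of the original one. Both facts are isomorphisms
  of graphs in the sense of this locale.
\<close>

locale graph_iso =
  fixes f :: "'a \<Rightarrow> 'b" and V E V' E'
  assumes bij: "bij_betw f V V'"
    and edge_iff: "\<And>x y. x \<in> V \<Longrightarrow> y \<in> V \<Longrightarrow> {f x, f y} \<in> E' \<longleftrightarrow> {x, y} \<in> E"
begin

lemma map_nbrs: "x \<in> V \<Longrightarrow> nbrs V' E' (f x) = f ` nbrs V E x"
  using bij edge_iff by (auto simp: nbrs_def bij_betw_def)

lemma map_thicken: "A \<subseteq> V \<Longrightarrow> thicken V' E' n (f ` A) = f ` thicken V E n A"
proof (induction n)
  case (Suc n)
  have "(\<Union>x\<in>thicken V E n A. nbrs V' E' (f x)) = (\<Union>x\<in>thicken V E n A. f ` nbrs V E x)"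
    using thicken_subset[OF Suc.prems, of E n] map_nbrs by (intro SUP_cong) auto
  with Suc show ?case by (auto simp: image_Un image_UN)
qed simp

lemma map_component: "x \<in> V \<Longrightarrow> component_of V' E' (f x) = f ` component_of V E x"
  using map_thicken[of "{x}"] bij
  by (simp add: component_of_eq_thicken bij_betw_apply image_UN)

lemma map_energy_controls:
  assumes "F \<subseteq> V" "x \<in> V" and c: "energy_controls M V E x F"
  shows "energy_controls M V' E' (f x) (f ` F)"
  unfolding energy_controls_def
proof (intro allI impI)
  fix h :: "'b \<Rightarrow> real" assume h: "\<forall>y. y \<notin> f ` F \<longrightarrow> h y = 0"
  have inj: "inj_on f V" using bij by (simp add: bij_betw_def)
  define g where "g y = (if y \<in> V then h (f y) else 0)" for y
  have "g y = 0" if "y \<notin> F" for y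
    using that h inj assms(1) unfolding g_def by (auto dest: inj_onD)
  then have "(g x)\<^sup>2 \<le> M * dirichlet V E F g" using c by (auto simp: energy_controls_def)
  moreover have "dirichlet V' E' (f ` F) h = dirichlet V E F g"
  proof -
    have "dirichlet V' E' (f ` F) h = (\<Sum>y\<in>F. \<Sum>w\<in>nbrs V' E' (f y). (h (f y) - h w)\<^sup>2)"
      unfolding dirichlet_def using inj assms(1) by (subst sum.reindex) (auto intro: inj_on_subset)
    also have "\<dots> = (\<Sum>y\<in>F. \<Sum>w\<in>f ` nbrs V E y. (h (f y) - h w)\<^sup>2)"
      using assms(1) map_nbrs by (intro sum.cong) auto
    also have "\<dots> = (\<Sum>y\<in>F. \<Sum>w\<in>nbrs V E y. (h (f y) - h (f w))\<^sup>2)"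
    proof (intro sum.cong refl)
      fix y
      have "inj_on f (nbrs V E y)" using inj by (rule inj_on_subset) (auto simp: nbrs_def)
      then show "(\<Sum>w\<in>f ` nbrs V E y. (h (f y) - h w)\<^sup>2) = (\<Sum>w\<in>nbrs V E y. (h (f y) - h (f w))\<^sup>2)"
        by (simp add: sum.reindex)
    qed
    also have "\<dots> = dirichlet V E F g"
      unfolding dirichlet_def g_def using assms(1) by (intro sum.cong refl) (auto simp: nbrs_def)
    finally show ?thesis .
  qed
  ultimately show "(h (f x))\<^sup>2 \<le> M * dirichlet V' E' (f ` F) h" using assms(2) by (simp add: g_def)
qed

lemma inverse_iso: "graph_iso (inv_into V f) V' E' V E"
proof
  show "bij_betw (inv_into V f) V' V" by (rule bij_betw_inv_into[OF bij])
  fix x y assume "x \<in> V'" "y \<in> V'"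
  then show "{inv_into V f x, inv_into V f y} \<in> E \<longleftrightarrow> {x, y} \<in> E'"
    using edge_iff[of "inv_into V f x" "inv_into V f y"] bij
    by (auto simp: bij_betw_def f_inv_into_f inv_into_into)
qed

lemma map_capacious:
  assumes "x \<in> V" "capacious M V E x"
  shows "capacious M V' E' (f x)"
  unfolding capacious_def
proof (intro allI impI)
  fix F assume F: "finite F \<and> F \<subseteq> V'"
  define F0 where "F0 = inv_into V f ` F"
  have eq: "f ` F0 = F" using F bij by (simp add: F0_def bij_betw_def image_inv_into_cancel)
  have "F0 \<subseteq> V" using F bij by (auto simp: F0_def bij_betw_def inv_into_into)
  moreover have "finite F0" using F by (simp add: F0_def)
  ultimately have "energy_controls M V E x F0" using assms by (simp add: capacious_def)
  from map_energy_controls[OF \<open>F0 \<subseteq> V\<close> assms(1) this] show "energy_controls M V' E' (f x) F"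
    by (simp add: eq)
qed

end

lemma (in graph_iso) capacious_iff:
  assumes "x \<in> V"
  shows "capacious M V' E' (f x) \<longleftrightarrow> capacious M V E x"
proof
  interpret i: graph_iso "inv_into V f" V' E' V E by (rule inverse_iso)
  assume "capacious M V' E' (f x)"
  then have "capacious M V E (inv_into V f (f x))"
    using assms bij by (intro i.map_capacious) (auto simp: bij_betw_apply)
  then show "capacious M V E x" using assms bij by (simp add: bij_betw_def)
qed (rule map_capacious[OF assms])

lemma dirichlet_mono:
  assumes "\<And>y. y \<in> F \<Longrightarrow> finite (nbrs V E' y)" "E \<subseteq> E'"
  shows "dirichlet V E F g \<le> dirichlet V E' F g"
  unfolding dirichlet_def using assms by (intro sum_mono sum_mono2) (auto simp: nbrs_def)

lemma capacious_mono:
  assumes "capacious M V E x" "M \<ge> 0" "E \<subseteq> E'" "\<And>y. y \<in> V \<Longrightarrow> finite (nbrs V E' y)"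
  shows "capacious M V E' x"
proof (rule capaciousI)
  fix F and g :: "'a \<Rightarrow> real" assume F: "finite F" "F \<subseteq> V" and g: "\<And>y. y \<notin> F \<Longrightarrow> g y = 0"
  have "(g x)\<^sup>2 \<le> M * dirichlet V E F g"
    by (rule capaciousD[OF assms(1) F g])
  also have "\<dots> \<le> M * dirichlet V E' F g"
    using assms F by (intro mult_left_mono dirichlet_mono) auto
  finally show "(g x)\<^sup>2 \<le> M * dirichlet V E' F g" .
qed

lemma nbrs_component:
  assumes "y \<in> component_of V E x"
  shows "nbrs (component_of V E x) E y = nbrs V E y"
  using assms by (auto simp: component_of_def nbrs_def adj_def intro: rtrancl_into_rtrancl)

lemma component_of_sym: "y \<in> component_of V E x \<Longrightarrow> x \<in> V \<Longrightarrow> x \<in> component_of V E y"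
proof -
  assume "y \<in> component_of V E x" "x \<in> V"
  moreover have "sym (adj V E)" by (auto simp: sym_def adj_def nbrs_def insert_commute)
  ultimately show ?thesis unfolding component_of_def by (auto dest: sym_rtrancl symD)
qed

lemma component_of_eq:
  assumes "y \<in> component_of V E x" "x \<in> V"
  shows "component_of V E y = component_of V E x"
  using component_of_sym[OF assms] assms unfolding component_of_def by (auto intro: rtrancl_trans)

lemma adj_component:
  assumes "(y, z) \<in> (adj V E)\<^sup>*" "y \<in> component_of V E x"
  shows "(y, z) \<in> (adj (component_of V E x) E)\<^sup>*"
  using assms(1)
proof (induction rule: rtrancl_induct)
  case (step u z)
  have "(x, u) \<in> (adj V E)\<^sup>*" using step(1) assms(2) by (auto simp: component_of_def)
  then have u: "u \<in> component_of V E x" using step(2) by (auto simp: component_of_def adj_def)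
  then have "(u, z) \<in> adj (component_of V E x) E"
    using step(2) nbrs_component[OF u] by (auto simp: adj_def)
  with step(3) show ?case by simp
qed simp

lemma capacious_component:
  assumes "capacious M V E y" "y \<in> component_of V E x"
  shows "capacious M (component_of V E x) E y"
proof (rule capaciousI)
  fix F and g :: "'a \<Rightarrow> real"
  assume F: "finite F" "F \<subseteq> component_of V E x" and g: "\<And>y. y \<notin> F \<Longrightarrow> g y = 0"
  have "dirichlet (component_of V E x) E F g = dirichlet V E F g"
    unfolding dirichlet_def by (intro sum.cong[OF refl] sum.cong nbrs_component refl) (use F in auto)
  moreover have "(g y)\<^sup>2 \<le> M * dirichlet V E F g"
    using F by (intro capaciousD[OF assms(1) _ _ g]) (auto simp: component_of_def)
  ultimately show "(g y)\<^sup>2 \<le> M * dirichlet (component_of V E x) E F g" by simp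
qed

lemma transient_component:
  assumes fin: "\<And>y. y \<in> V \<Longrightarrow> finite (nbrs V E y)" and x: "x \<in> V"
    and inf: "infinite (component_of V E x)"
    and y: "y \<in> component_of V E x" and cap: "capacious M V E y"
  shows "transient_graph (component_of V E x) E"
proof (rule capacious_imp_transient[OF _ _ capacious_component[OF cap y] _ y])
  let ?C = "component_of V E x"
  have sub: "?C \<subseteq> V" by (auto simp: component_of_def)
  show "finite (nbrs ?C E z)" if "z \<in> ?C" for z
    using that sub fin nbrs_component[OF that] by auto
  show "nbrs ?C E z \<noteq> {}" if z: "z \<in> ?C" for z
  proof
    assume "nbrs ?C E z = {}"
    then have "nbrs V E z = {}" by (simp add: nbrs_component[OF z])
    then have "(z, w) \<notin> adj V E" for w by (simp add: adj_def)
    then have "component_of V E z \<subseteq> {z}"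
      unfolding component_of_def by (blast elim: converse_rtranclE)
    then have "finite (component_of V E z)" by (rule finite_subset) simp
    with inf show False by (simp add: component_of_eq[OF z x])
  qed
  show "(y, v) \<in> (adj ?C E)\<^sup>*" if "v \<in> ?C" for v
  proof (rule adj_component[OF _ y])
    have "v \<in> component_of V E y" using that component_of_eq[OF y x] by simp
    then show "(y, v) \<in> (adj V E)\<^sup>*" by (simp add: component_of_def)
  qed
qed

section \<open>Bernoulli percolation as a product measure\<close>

lemma distr_merge_PiM:
  assumes M: "\<And>i. i \<in> I \<union> J \<Longrightarrow> prob_space (M i)" and dis: "I \<inter> J = {}"
  shows "distr (PiM I M \<Otimes>\<^sub>M PiM J M) (PiM (I \<union> J) M) (merge I J) = PiM (I \<union> J) M" (is "?L = _")
proof (rule measure_eqI_PiM_infinite[symmetric, OF refl])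
  interpret I: prob_space "PiM I M" using M by (intro prob_space_PiM) auto
  interpret J: prob_space "PiM J M" using M by (intro prob_space_PiM) auto
  interpret IJ: prob_space "PiM (I \<union> J) M" using M by (intro prob_space_PiM) auto
  show "finite_measure (PiM (I \<union> J) M)" by unfold_locales
  fix A K assume K: "finite K" "K \<subseteq> I \<union> J" and A: "\<And>i. i \<in> K \<Longrightarrow> A i \<in> sets (M i)"
  let ?X = "prod_emb (I \<union> J) M K (Pi\<^sub>E K A)"
  have "PiM (I \<union> J) M ?X = (\<Prod>i\<in>K. M i (A i))"
    using M K A by (intro emeasure_PiM_emb) auto
  also have "\<dots> = (\<Prod>i\<in>(K \<inter> I) \<union> (K \<inter> J). M i (A i))"
    using K by (intro prod.cong) auto
  also have "\<dots> = (\<Prod>i\<in>K \<inter> I. M i (A i)) * (\<Prod>i\<in>K \<inter> J. M i (A i))"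
    using K dis by (intro prod.union_disjoint) auto
  also have "(\<Prod>i\<in>K \<inter> I. M i (A i)) = PiM I M (prod_emb I M (K \<inter> I) (Pi\<^sub>E (K \<inter> I) A))"
    using M K A by (intro emeasure_PiM_emb[symmetric]) auto
  also have "(\<Prod>i\<in>K \<inter> J. M i (A i)) = PiM J M (prod_emb J M (K \<inter> J) (Pi\<^sub>E (K \<inter> J) A))"
    using M K A by (intro emeasure_PiM_emb[symmetric]) auto
  also have "PiM I M (prod_emb I M (K \<inter> I) (Pi\<^sub>E (K \<inter> I) A)) * PiM J M (prod_emb J M (K \<inter> J) (Pi\<^sub>E (K \<inter> J) A)) =
    (PiM I M \<Otimes>\<^sub>M PiM J M) (prod_emb I M (K \<inter> I) (Pi\<^sub>E (K \<inter> I) A) \<times> prod_emb J M (K \<inter> J) (Pi\<^sub>E (K \<inter> J) A))"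
    using K A by (intro J.emeasure_pair_measure_Times[symmetric] sets_PiM_I) auto
  also have "prod_emb I M (K \<inter> I) (Pi\<^sub>E (K \<inter> I) A) \<times> prod_emb J M (K \<inter> J) (Pi\<^sub>E (K \<inter> J) A) =
    merge I J -` ?X \<inter> space (PiM I M \<Otimes>\<^sub>M PiM J M)"
  proof (intro equalityI subsetI)
    fix z assume z: "z \<in> prod_emb I M (K \<inter> I) (Pi\<^sub>E (K \<inter> I) A) \<times> prod_emb J M (K \<inter> J) (Pi\<^sub>E (K \<inter> J) A)"
    obtain x y where zxy: "z = (x, y)" by (cases z)
    have m: "merge I J (x, y) i = x i" if "i \<in> I" for i using that by (simp add: merge_def)
    have m': "merge I J (x, y) i = y i" if "i \<in> J" for i using that dis by (auto simp: merge_def)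
    have "\<forall>i\<in>K. merge I J (x, y) i \<in> A i" "\<forall>i\<in>I \<union> J. merge I J (x, y) i \<in> space (M i)"
      using z K by (auto simp: m m' zxy prod_emb_iff PiE_iff)
    with z show "z \<in> merge I J -` ?X \<inter> space (PiM I M \<Otimes>\<^sub>M PiM J M)"
      unfolding zxy
      by (simp add: prod_emb_iff PiE_iff space_pair_measure space_PiM extensional_merge_sub)
  next
    fix z assume z: "z \<in> merge I J -` ?X \<inter> space (PiM I M \<Otimes>\<^sub>M PiM J M)"
    obtain x y where zxy: "z = (x, y)" by (cases z)
    have m: "merge I J (x, y) i = x i" if "i \<in> I" for i using that by (simp add: merge_def)
    have m': "merge I J (x, y) i = y i" if "i \<in> J" for i using that dis by (auto simp: merge_def)
    have all: "\<forall>i\<in>K. merge I J (x, y) i \<in> A i" using z by (simp add: zxy prod_emb_iff PiE_iff)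
    have "\<forall>i\<in>K \<inter> I. x i \<in> A i" "\<forall>i\<in>K \<inter> J. y i \<in> A i"
      using all m m' by force+
    with z show "z \<in> prod_emb I M (K \<inter> I) (Pi\<^sub>E (K \<inter> I) A) \<times> prod_emb J M (K \<inter> J) (Pi\<^sub>E (K \<inter> J) A)"
      unfolding zxy by (auto simp: prod_emb_iff PiE_iff space_pair_measure space_PiM)
  qed
  finally show "PiM (I \<union> J) M ?X = ?L ?X"
    using K A by (simp add: emeasure_distr)
qed simp

abbreviation bernoulli_measure :: "real \<Rightarrow> bool measure" where
  "bernoulli_measure p \<equiv> measure_pmf (bernoulli_pmf p)"

lemma product_prob_space_bernoulli: "product_prob_space (\<lambda>_. bernoulli_measure p)"
  by (rule product_prob_spaceI) (rule prob_space_measure_pmf)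

lemma prob_space_bond: "prob_space (bond_percolation E p)"
  unfolding bond_percolation_def by (intro prob_space_PiM prob_space_measure_pmf)

lemma space_bond: "space (bond_percolation E p) = extensional E"
  unfolding bond_percolation_def by (simp add: space_PiM PiE_UNIV_domain PiE_def)

lemma edge_event_measurable:
  assumes "e \<in> E" shows "(\<lambda>\<omega>. \<omega> e) \<in> measurable (bond_percolation E p) (count_space UNIV)"
  unfolding bond_percolation_def using measurable_component_singleton[OF assms, of "\<lambda>_. bernoulli_measure p"]
  by (simp cong: measurable_cong_sets)

lemma edge_event_sets:
  assumes "e \<in> E"
  shows "{\<omega> \<in> space (bond_percolation E p). \<omega> e = c} \<in> sets (bond_percolation E p)"
  using measurable_sets[OF edge_event_measurable[OF assms, of p], of "{c}"]
  by (simp add: vimage_def Int_def conj_commute)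

lemma emeasure_bernoulli_set:
  assumes "0 \<le> p" "p \<le> 1"
  shows "emeasure (bernoulli_measure p) A = ennreal (p * of_bool (True \<in> A) + (1 - p) * of_bool (False \<in> A))"
proof -
  have "emeasure (bernoulli_measure p) A = (\<integral>\<^sup>+x. indicator A x \<partial>bernoulli_measure p)" by simp
  also have "\<dots> = ennreal (p * of_bool (True \<in> A) + (1 - p) * of_bool (False \<in> A))"
    using assms by (subst nn_integral_bernoulli_pmf) (auto simp: indicator_def simp flip: ennreal_plus)
  finally show ?thesis .
qed

lemma emeasure_bond_cylinder:
  assumes "finite K" "K \<subseteq> E"
  shows "emeasure (bond_percolation E p) {\<omega> \<in> space (bond_percolation E p). \<forall>e\<in>K. \<omega> e \<in> A e} =
    (\<Prod>e\<in>K. emeasure (bernoulli_measure p) (A e))"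
proof -
  interpret product_prob_space "\<lambda>_. bernoulli_measure p" E by (rule product_prob_space_bernoulli)
  show ?thesis unfolding bond_percolation_def using assms by (intro emeasure_PiM_Collect) auto
qed

lemma prob_all_open:
  assumes "finite K" "K \<subseteq> E" "0 \<le> p" "p \<le> 1"
  shows "measure (bond_percolation E p) {\<omega> \<in> space (bond_percolation E p). \<forall>e\<in>K. \<omega> e} = p ^ card K"
proof -
  have "emeasure (bond_percolation E p) {\<omega> \<in> space (bond_percolation E p). \<forall>e\<in>K. \<omega> e} = ennreal (p ^ card K)"
    using emeasure_bond_cylinder[OF assms(1,2), of p "\<lambda>_. {True}"] assms(3,4)
    by (simp add: emeasure_bernoulli_set ennreal_power)
  then show ?thesis using assms by (simp add: measure_def)
qed

lemma emeasure_infinitely_many_closed: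
  assumes "infinite H" "H \<subseteq> E" "0 < p" "p \<le> 1"
  shows "emeasure (bond_percolation E p) {\<omega> \<in> space (bond_percolation E p). \<forall>e\<in>H. \<not> \<omega> e} = 0"
proof -
  let ?M = "bond_percolation E p"
  have le: "emeasure ?M {\<omega> \<in> space ?M. \<forall>e\<in>H. \<not> \<omega> e} \<le> ennreal ((1 - p) ^ n)" for n
  proof -
    obtain K where K: "K \<subseteq> H" "finite K" "card K = n"
      using infinite_arbitrarily_large[OF assms(1)] by blast
    have KE: "K \<subseteq> E" using K assms by auto
    have "{\<omega> \<in> space ?M. \<forall>e\<in>K. \<not> \<omega> e} \<in> sets ?M"
      using edge_event_sets[of _ E p False] KE K
      by (intro sets.sets_Collect_finite_All) auto
    then have "emeasure ?M {\<omega> \<in> space ?M. \<forall>e\<in>H. \<not> \<omega> e} \<le> emeasure ?M {\<omega> \<in> space ?M. \<forall>e\<in>K. \<not> \<omega> e}"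
      using K by (intro emeasure_mono) auto
    also have "\<dots> = ennreal ((1 - p) ^ n)"
      using emeasure_bond_cylinder[OF K(2) KE, of p "\<lambda>_. {False}"] assms K(3)
      by (simp add: emeasure_bernoulli_set ennreal_power)
    finally show ?thesis .
  qed
  have "(\<lambda>n. ennreal ((1 - p) ^ n)) \<longlonglongrightarrow> ennreal 0"
    using assms by (intro tendsto_ennrealI LIMSEQ_power_zero) auto
  then have "emeasure ?M {\<omega> \<in> space ?M. \<forall>e\<in>H. \<not> \<omega> e} \<le> ennreal 0"
    by (rule LIMSEQ_le_const) (use le in blast)
  then show ?thesis by simp
qed

text \<open>
  Independence of events at disjoint sets of edges is stated with this notion instead of generated
  sigma-algebras: it applies to a predicate as it is written, and can be read off from its definition.
\<close>

definition determined_by :: "'e set \<Rightarrow> (('e \<Rightarrow> bool) \<Rightarrow> bool) \<Rightarrow> bool" where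
  "determined_by K P \<longleftrightarrow> (\<forall>\<omega> \<omega>'. (\<forall>e\<in>K. \<omega> e = \<omega>' e) \<longrightarrow> P \<omega> = P \<omega>')"

lemma determined_byD: "determined_by K P \<Longrightarrow> (\<And>e. e \<in> K \<Longrightarrow> \<omega> e = \<omega>' e) \<Longrightarrow> P \<omega> = P \<omega>'"
  unfolding determined_by_def by blast

lemma determined_by_mono: "determined_by K P \<Longrightarrow> K \<subseteq> L \<Longrightarrow> determined_by L P"
  unfolding determined_by_def by blast

lemma measurable_determined_by_finite:
  assumes K: "finite K" "K \<subseteq> E" and P: "determined_by K P"
  shows "{\<omega> \<in> space (bond_percolation E p). P \<omega>} \<in> sets (bond_percolation E p)"
proof -
  let ?M = "bond_percolation E p"
  have "{\<omega> \<in> space ?M. P \<omega>} = (\<Union>A\<in>{A. A \<subseteq> K \<and> P (\<lambda>e. e \<in> A)}. {\<omega> \<in> space ?M. \<forall>e\<in>K. \<omega> e = (e \<in> A)})"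
    (is "_ = ?R")
  proof (intro equalityI subsetI)
    fix \<omega> assume \<omega>: "\<omega> \<in> {\<omega> \<in> space ?M. P \<omega>}"
    define A where "A = {e \<in> K. \<omega> e}"
    have "P (\<lambda>e. e \<in> A) = P \<omega>" using P unfolding determined_by_def A_def by simp
    with \<omega> show "\<omega> \<in> ?R" by (intro UN_I[of A]) (auto simp: A_def)
  next
    fix \<omega> assume "\<omega> \<in> ?R"
    then obtain A where A: "P (\<lambda>e. e \<in> A)" "\<omega> \<in> space ?M" "\<forall>e\<in>K. \<omega> e = (e \<in> A)" by auto
    have "P \<omega> = P (\<lambda>e. e \<in> A)" by (rule determined_byD[OF P]) (use A in auto)
    with A show "\<omega> \<in> {\<omega> \<in> space ?M. P \<omega>}" by simp
  qed
  also have "\<dots> \<in> sets ?M"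
  proof (rule sets.finite_UN)
    show "finite {A. A \<subseteq> K \<and> P (\<lambda>e. e \<in> A)}" using K by simp
    fix A
    have one: "{\<omega> \<in> space ?M. \<omega> e = (e \<in> A)} \<in> sets ?M" if "e \<in> K" for e
      using that K by (intro edge_event_sets) auto
    show "{\<omega> \<in> space ?M. \<forall>e\<in>K. \<omega> e = (e \<in> A)} \<in> sets ?M"
      by (rule sets.sets_Collect_finite_All[OF one K(1)])
  qed
  finally show ?thesis .
qed

lemma bond_percolation_split:
  assumes "I \<union> J = E" "I \<inter> J = {}"
  shows "bond_percolation E p =
    distr (bond_percolation I p \<Otimes>\<^sub>M bond_percolation J p) (bond_percolation E p) (merge I J)"
  unfolding bond_percolation_def assms(1)[symmetric]
  by (rule distr_merge_PiM[symmetric, OF _ assms(2)]) (rule prob_space_measure_pmf)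

lemma measurable_merge_bond:
  assumes "I \<union> J = E"
  shows "merge I J \<in> measurable (bond_percolation I p \<Otimes>\<^sub>M bond_percolation J p) (bond_percolation E p)"
  unfolding bond_percolation_def assms[symmetric] by (rule measurable_merge)

lemma prob_indep_determined:
  assumes K: "K \<subseteq> E"
    and P: "determined_by K P" "{\<omega> \<in> space (bond_percolation E p). P \<omega>} \<in> sets (bond_percolation E p)"
    and Q: "determined_by (E - K) Q" "{\<omega> \<in> space (bond_percolation E p). Q \<omega>} \<in> sets (bond_percolation E p)"
  shows "measure (bond_percolation E p) {\<omega> \<in> space (bond_percolation E p). P \<omega> \<and> Q \<omega>} =
    measure (bond_percolation E p) {\<omega> \<in> space (bond_percolation E p). P \<omega>} *
    measure (bond_percolation E p) {\<omega> \<in> space (bond_percolation E p). Q \<omega>}"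
proof -
  let ?M = "bond_percolation E p" and ?I = "bond_percolation K p" and ?J = "bond_percolation (E - K) p"
  interpret I: prob_space ?I by (rule prob_space_bond)
  interpret J: prob_space ?J by (rule prob_space_bond)
  interpret E: prob_space ?M by (rule prob_space_bond)
  have un: "K \<union> (E - K) = E" "K \<inter> (E - K) = {}" using K by auto
  note mm = measurable_merge_bond[OF un(1), of p]
  obtain a0 where a0: "a0 \<in> space ?I" using I.not_empty by blast
  obtain b0 where b0: "b0 \<in> space ?J" using J.not_empty by blast
  let ?P = "{a \<in> space ?I. P (merge K (E - K) (a, b0))}" and ?Q = "{b \<in> space ?J. Q (merge K (E - K) (a0, b))}"
  have Peq: "P (merge K (E - K) (a, b)) = P (merge K (E - K) (a, b0))" for a b
    by (rule determined_byD[OF P(1)]) (simp add: merge_def)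
  have Qeq: "Q (merge K (E - K) (a, b)) = Q (merge K (E - K) (a0, b))" for a b
    by (rule determined_byD[OF Q(1)]) (simp add: merge_def)
  have "(\<lambda>a. merge K (E - K) (a, b0)) \<in> measurable ?I ?M"
    by (rule measurable_compose[OF measurable_Pair2'[OF b0] mm])
  from measurable_sets[OF this P(2)] have sP: "?P \<in> sets ?I"
    by (rule back_subst[of "\<lambda>A. A \<in> sets ?I"]) (use b0 measurable_space[OF mm] in \<open>auto simp: space_pair_measure\<close>)
  have "(\<lambda>b. merge K (E - K) (a0, b)) \<in> measurable ?J ?M"
    by (rule measurable_compose[OF measurable_Pair1'[OF a0] mm])
  from measurable_sets[OF this Q(2)] have sQ: "?Q \<in> sets ?J"
    by (rule back_subst[of "\<lambda>A. A \<in> sets ?J"]) (use a0 measurable_space[OF mm] in \<open>auto simp: space_pair_measure\<close>)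
  have meas: "emeasure ?M {\<omega> \<in> space ?M. R \<omega>} = emeasure (?I \<Otimes>\<^sub>M ?J) X"
    if "{\<omega> \<in> space ?M. R \<omega>} \<in> sets ?M"
      "X = {z \<in> space (?I \<Otimes>\<^sub>M ?J). R (merge K (E - K) z)}" for R X
  proof -
    have "emeasure ?M {\<omega> \<in> space ?M. R \<omega>} =
        emeasure (distr (?I \<Otimes>\<^sub>M ?J) ?M (merge K (E - K))) {\<omega> \<in> space ?M. R \<omega>}"
      by (rule arg_cong[where f="\<lambda>N. emeasure N _", OF bond_percolation_split[OF un]])
    also have "\<dots> = emeasure (?I \<Otimes>\<^sub>M ?J) (merge K (E - K) -` {\<omega> \<in> space ?M. R \<omega>} \<inter> space (?I \<Otimes>\<^sub>M ?J))"
      by (rule emeasure_distr[OF mm that(1)])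
    also have "merge K (E - K) -` {\<omega> \<in> space ?M. R \<omega>} \<inter> space (?I \<Otimes>\<^sub>M ?J) = X"
      using measurable_space[OF mm] unfolding that(2) by auto
    finally show ?thesis .
  qed
  have eP: "emeasure ?M {\<omega> \<in> space ?M. P \<omega>} = emeasure ?I ?P"
  proof -
    have "emeasure ?M {\<omega> \<in> space ?M. P \<omega>} = emeasure (?I \<Otimes>\<^sub>M ?J) (?P \<times> space ?J)"
    proof (rule meas[OF P(2)], intro Set.set_eqI)
      fix z show "z \<in> ?P \<times> space ?J \<longleftrightarrow> z \<in> {z \<in> space (?I \<Otimes>\<^sub>M ?J). P (merge K (E - K) z)}"
        using Peq[of "fst z" "snd z"] by (cases z) (simp add: space_pair_measure conj_ac)
    qed
    then show ?thesis using sP by (simp add: J.emeasure_pair_measure_Times J.emeasure_space_1)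
  qed
  have eQ: "emeasure ?M {\<omega> \<in> space ?M. Q \<omega>} = emeasure ?J ?Q"
  proof -
    have "emeasure ?M {\<omega> \<in> space ?M. Q \<omega>} = emeasure (?I \<Otimes>\<^sub>M ?J) (space ?I \<times> ?Q)"
    proof (rule meas[OF Q(2)], intro Set.set_eqI)
      fix z show "z \<in> space ?I \<times> ?Q \<longleftrightarrow> z \<in> {z \<in> space (?I \<Otimes>\<^sub>M ?J). Q (merge K (E - K) z)}"
        using Qeq[of "fst z" "snd z"] by (cases z) (simp add: space_pair_measure conj_ac)
    qed
    then show ?thesis using sQ by (simp add: J.emeasure_pair_measure_Times I.emeasure_space_1)
  qed
  have "emeasure ?M {\<omega> \<in> space ?M. P \<omega> \<and> Q \<omega>} = emeasure (?I \<Otimes>\<^sub>M ?J) (?P \<times> ?Q)"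
  proof (rule meas[of "\<lambda>\<omega>. P \<omega> \<and> Q \<omega>"], rule sets.sets_Collect_conj[OF Q(2) P(2)], intro Set.set_eqI)
    fix z show "z \<in> ?P \<times> ?Q \<longleftrightarrow> z \<in> {z \<in> space (?I \<Otimes>\<^sub>M ?J). P (merge K (E - K) z) \<and> Q (merge K (E - K) z)}"
      using Peq[of "fst z" "snd z"] Qeq[of "fst z" "snd z"] by (cases z) (simp add: space_pair_measure conj_ac)
  qed
  also have "\<dots> = emeasure ?I ?P * emeasure ?J ?Q"
    by (rule J.emeasure_pair_measure_Times[OF sP sQ])
  finally show ?thesis
    unfolding eP[symmetric] eQ[symmetric] E.emeasure_eq_measure
    by (simp flip: ennreal_mult)
qed

lemma bond_percolation_sprinkle:
  assumes p: "0 \<le> p1" "p1 \<le> 1" "0 \<le> \<epsilon>" "\<epsilon> \<le> 1" and eq: "1 - p = (1 - p1) * (1 - \<epsilon>)"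
  shows "distr (bond_percolation E p1 \<Otimes>\<^sub>M bond_percolation E \<epsilon>) (bond_percolation E p)
      (\<lambda>z. \<lambda>e\<in>E. fst z e \<or> snd z e) = bond_percolation E p"
    and "(\<lambda>z. \<lambda>e\<in>E. fst z e \<or> snd z e) \<in>
      measurable (bond_percolation E p1 \<Otimes>\<^sub>M bond_percolation E \<epsilon>) (bond_percolation E p)"
proof -
  let ?A = "bond_percolation E p1" and ?B = "bond_percolation E \<epsilon>" and ?C = "bond_percolation E p"
  let ?f = "\<lambda>z. \<lambda>e\<in>E. fst z e \<or> snd z e"
  interpret A: prob_space ?A by (rule prob_space_bond)
  interpret B: prob_space ?B by (rule prob_space_bond)
  interpret C: prob_space ?C by (rule prob_space_bond)
  interpret PA: product_prob_space "\<lambda>_. bernoulli_measure p1" E by (rule product_prob_space_bernoulli)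
  have p01: "0 \<le> p" "p \<le> 1"
  proof -
    have "0 \<le> (1 - p1) * (1 - \<epsilon>)" using p by simp
    moreover have "(1 - p1) * (1 - \<epsilon>) \<le> 1" using p by (intro mult_le_one) auto
    ultimately show "0 \<le> p" "p \<le> 1" using eq by auto
  qed
  show f: "?f \<in> measurable (?A \<Otimes>\<^sub>M ?B) ?C"
    unfolding bond_percolation_def[of E p]
  proof (rule measurable_restrict)
    fix e assume e: "e \<in> E"
    have [measurable]: "(\<lambda>z. fst z e) \<in> measurable (?A \<Otimes>\<^sub>M ?B) (count_space UNIV)"
        "(\<lambda>z. snd z e) \<in> measurable (?A \<Otimes>\<^sub>M ?B) (count_space UNIV)"
      by (rule measurable_compose[OF measurable_fst edge_event_measurable[OF e]]
          measurable_compose[OF measurable_snd edge_event_measurable[OF e]])+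
    have "(\<lambda>z. fst z e \<or> snd z e) \<in> measurable (?A \<Otimes>\<^sub>M ?B) (count_space UNIV)"
      by measurable
    then show "(\<lambda>z. fst z e \<or> snd z e) \<in> measurable (?A \<Otimes>\<^sub>M ?B) (bernoulli_measure p)"
      by (simp cong: measurable_cong_sets)
  qed
  show "distr (?A \<Otimes>\<^sub>M ?B) ?C ?f = ?C"
  proof (rule measure_eqI_PiM_infinite[where I=E and M="\<lambda>_. bernoulli_measure p", symmetric])
    show "sets ?C = sets (PiM E (\<lambda>_. bernoulli_measure p))" by (simp add: bond_percolation_def)
    then show "sets (distr (?A \<Otimes>\<^sub>M ?B) ?C ?f) = sets (PiM E (\<lambda>_. bernoulli_measure p))" by simp
    show "finite_measure ?C" by unfold_locales
    fix K and F :: "'a set \<Rightarrow> bool set" assume K: "finite K" "K \<subseteq> E"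
    have X: "prod_emb E (\<lambda>_. bernoulli_measure p) K (Pi\<^sub>E K F) = {\<omega> \<in> space ?C. \<forall>e\<in>K. \<omega> e \<in> F e}"
      unfolding space_bond using K by (auto simp: prod_emb_iff PiE_iff extensional_restrict)
    have XC: "{\<omega> \<in> space ?C. \<forall>e\<in>K. \<omega> e \<in> F e} \<in> sets ?C"
      using K by (intro measurable_determined_by_finite) (auto simp: determined_by_def)
    let ?h = "\<lambda>e a. emeasure (bernoulli_measure \<epsilon>) {b. (a \<or> b) \<in> F e}"
    have one: "(\<integral>\<^sup>+a. ?h e a \<partial>bernoulli_measure p1) = emeasure (bernoulli_measure p) (F e)" for e
    proof -
      have "(\<integral>\<^sup>+a. ?h e a \<partial>bernoulli_measure p1) =
        ennreal (p1 * (\<epsilon> * of_bool (True \<in> F e) + (1 - \<epsilon>) * of_bool (True \<in> F e)) +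
          (1 - p1) * (\<epsilon> * of_bool (True \<in> F e) + (1 - \<epsilon>) * of_bool (False \<in> F e)))"
        using p by (subst nn_integral_bernoulli_pmf)
          (auto simp: emeasure_bernoulli_set mult.commute simp flip: ennreal_mult ennreal_plus)
      also have "p1 * (\<epsilon> * of_bool (True \<in> F e) + (1 - \<epsilon>) * of_bool (True \<in> F e)) +
          (1 - p1) * (\<epsilon> * of_bool (True \<in> F e) + (1 - \<epsilon>) * of_bool (False \<in> F e)) =
          (1 - (1 - p1) * (1 - \<epsilon>)) * of_bool (True \<in> F e) + (1 - p1) * (1 - \<epsilon>) * of_bool (False \<in> F e)"
        by (simp add: algebra_simps)
      also have "\<dots> = p * of_bool (True \<in> F e) + (1 - p) * of_bool (False \<in> F e)"
        using eq by simp
      finally show ?thesis using p01 by (simp add: emeasure_bernoulli_set)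
    qed
    have "emeasure (distr (?A \<Otimes>\<^sub>M ?B) ?C ?f) {\<omega> \<in> space ?C. \<forall>e\<in>K. \<omega> e \<in> F e} =
      emeasure (?A \<Otimes>\<^sub>M ?B) (?f -` {\<omega> \<in> space ?C. \<forall>e\<in>K. \<omega> e \<in> F e} \<inter> space (?A \<Otimes>\<^sub>M ?B))"
      by (rule emeasure_distr[OF f XC])
    also have "\<dots> = (\<integral>\<^sup>+a. emeasure ?B (Pair a -` (?f -` {\<omega> \<in> space ?C. \<forall>e\<in>K. \<omega> e \<in> F e} \<inter> space (?A \<Otimes>\<^sub>M ?B))) \<partial>?A)"
      by (rule B.emeasure_pair_measure_alt[OF measurable_sets[OF f XC]])
    also have "\<dots> = (\<integral>\<^sup>+a. (\<Prod>e\<in>K. ?h e (a e)) \<partial>?A)"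
    proof (rule nn_integral_cong)
      fix a assume a: "a \<in> space ?A"
      have "Pair a -` (?f -` {\<omega> \<in> space ?C. \<forall>e\<in>K. \<omega> e \<in> F e} \<inter> space (?A \<Otimes>\<^sub>M ?B)) =
        {b \<in> space ?B. \<forall>e\<in>K. b e \<in> {b. (a e \<or> b) \<in> F e}}"
        using K a by (auto simp: space_pair_measure space_bond)
      then show "emeasure ?B (Pair a -` (?f -` {\<omega> \<in> space ?C. \<forall>e\<in>K. \<omega> e \<in> F e} \<inter> space (?A \<Otimes>\<^sub>M ?B))) =
          (\<Prod>e\<in>K. ?h e (a e))"
        using emeasure_bond_cylinder[OF K, of \<epsilon> "\<lambda>e. {b. (a e \<or> b) \<in> F e}"] by simp
    qed
    also have "\<dots> = (\<integral>\<^sup>+a. (\<Prod>e\<in>K. ?h e (restrict a K e)) \<partial>?A)"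
      by (intro nn_integral_cong prod.cong) auto
    also have "\<dots> = (\<integral>\<^sup>+a. (\<Prod>e\<in>K. ?h e (a e)) \<partial>distr ?A (PiM K (\<lambda>_. bernoulli_measure p1)) (\<lambda>x. restrict x K))"
    proof (rule nn_integral_distr[symmetric])
      show "(\<lambda>x. restrict x K) \<in> measurable ?A (PiM K (\<lambda>_. bernoulli_measure p1))"
        unfolding bond_percolation_def using K by (intro measurable_restrict_subset)
      have "(\<lambda>a. \<Prod>e\<in>K. ?h e (a e)) \<in> borel_measurable (PiM K (\<lambda>_. bernoulli_measure p1))"
        by (intro borel_measurable_prod_ennreal measurable_compose[OF measurable_component_singleton]) auto
      then show "(\<lambda>a. \<Prod>e\<in>K. ?h e (a e)) \<in>
          borel_measurable (distr ?A (PiM K (\<lambda>_. bernoulli_measure p1)) (\<lambda>x. restrict x K))"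
        by simp
    qed
    also have "\<dots> = (\<integral>\<^sup>+a. (\<Prod>e\<in>K. ?h e (a e)) \<partial>PiM K (\<lambda>_. bernoulli_measure p1))"
      unfolding bond_percolation_def using K by (subst PA.distr_PiM_restrict_finite) auto
    also have "\<dots> = (\<Prod>e\<in>K. \<integral>\<^sup>+a. ?h e a \<partial>bernoulli_measure p1)"
      by (rule PA.product_nn_integral_prod[OF K(1)]) auto
    also have "\<dots> = (\<Prod>e\<in>K. emeasure (bernoulli_measure p) (F e))" by (simp only: one)
    also have "\<dots> = emeasure ?C {\<omega> \<in> space ?C. \<forall>e\<in>K. \<omega> e \<in> F e}"
      by (rule emeasure_bond_cylinder[OF K, symmetric])
    finally show "emeasure ?C (prod_emb E (\<lambda>_. bernoulli_measure p) K (Pi\<^sub>E K F)) =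
      emeasure (distr (?A \<Otimes>\<^sub>M ?B) ?C ?f) (prod_emb E (\<lambda>_. bernoulli_measure p) K (Pi\<^sub>E K F))"
      unfolding X by simp
  qed
qed

section \<open>Cayley graphs and the action of the group\<close>

locale cayley_graph = group G for G (structure) +
  fixes S :: "'a set"
  assumes finite_S: "finite S" and S_sub: "S \<subseteq> carrier G" and S_gen: "generate G S = carrier G"
begin

abbreviation V :: "'a set" where "V \<equiv> carrier G"
abbreviation E :: "'a set set" where "E \<equiv> cayley_edges G S"
abbreviation left_mult :: "'a \<Rightarrow> 'a \<Rightarrow> 'a" where "left_mult g \<equiv> (\<lambda>x. g \<otimes> x)"

lemma edge_iff:
  "{x, y} \<in> E \<longleftrightarrow> x \<in> V \<and> y \<in> V \<and> x \<noteq> y \<and> (\<exists>s\<in>S. y = x \<otimes> s \<or> x = y \<otimes> s)"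
proof
  assume "{x, y} \<in> E"
  then obtain a s where a: "{x, y} = {a, a \<otimes> s}" "a \<in> V" "s \<in> S" "a \<otimes> s \<noteq> a"
    by (auto simp: cayley_edges_def)
  moreover have "a \<otimes> s \<in> V" using a S_sub by auto
  ultimately show "x \<in> V \<and> y \<in> V \<and> x \<noteq> y \<and> (\<exists>s\<in>S. y = x \<otimes> s \<or> x = y \<otimes> s)"
    by (auto simp: doubleton_eq_iff)
next
  assume R: "x \<in> V \<and> y \<in> V \<and> x \<noteq> y \<and> (\<exists>s\<in>S. y = x \<otimes> s \<or> x = y \<otimes> s)"
  then have "\<exists>s. s \<in> S \<and> (y = x \<otimes> s \<or> x = y \<otimes> s)" by (simp only: Bex_def)
  then obtain s where "s \<in> S \<and> (y = x \<otimes> s \<or> x = y \<otimes> s)" ..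
  with R have s: "x \<in> V" "y \<in> V" "x \<noteq> y" "s \<in> S" "y = x \<otimes> s \<or> x = y \<otimes> s" by simp_all
  from s(5) show "{x, y} \<in> E"
  proof
    assume "y = x \<otimes> s"
    then have "x \<otimes> s \<noteq> x" using s by simp
    with \<open>y = x \<otimes> s\<close> show ?thesis unfolding cayley_edges_def using s by auto
  next
    assume "x = y \<otimes> s"
    then have "{x, y} = {y, y \<otimes> s}" "y \<otimes> s \<noteq> y" using s by auto
    then show ?thesis unfolding cayley_edges_def using s by auto
  qed
qed

lemma edgeE:
  assumes "e \<in> E"
  obtains x y where "e = {x, y}" "x \<in> V" "y \<in> V" "x \<noteq> y"
proof -
  obtain x s where x: "e = {x, x \<otimes> s}" "x \<in> V" "s \<in> S" "x \<otimes> s \<noteq> x"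
    using assms by (auto simp: cayley_edges_def)
  with S_sub have "x \<otimes> s \<in> V" by auto
  with x that show thesis by metis
qed

lemma finite_nbrs: "finite (nbrs V E x)"
proof (rule finite_subset)
  show "nbrs V E x \<subseteq> (\<lambda>s. x \<otimes> s) ` S \<union> (\<lambda>s. x \<otimes> inv s) ` S"
  proof
    fix y assume "y \<in> nbrs V E x"
    then obtain s where s: "x \<in> V" "y \<in> V" "s \<in> S" "y = x \<otimes> s \<or> x = y \<otimes> s" by (auto simp: nbrs_def edge_iff)
    have sV: "s \<in> V" using s S_sub by auto
    from s(4) show "y \<in> (\<lambda>s. x \<otimes> s) ` S \<union> (\<lambda>s. x \<otimes> inv s) ` S"
    proof
      assume "x = y \<otimes> s"
      then have "x \<otimes> inv s = y" using s sV by (simp add: m_assoc)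
      then show ?thesis using s by blast
    qed (use s in blast)
  qed
qed (use finite_S in auto)

lemma finite_nbrs_open: "finite (nbrs V (open_edges E \<omega>) x)"
  by (rule finite_subset[OF _ finite_nbrs[of x]]) (auto simp: nbrs_def open_edges_def)

lemma bij_left_mult: "g \<in> V \<Longrightarrow> bij_betw (left_mult g) V V"
  by (simp add: bij_betw_def inj_on_cmult surj_const_mult)

lemma edge_translate:
  assumes "g \<in> V" "x \<in> V" "y \<in> V"
  shows "{g \<otimes> x, g \<otimes> y} \<in> E \<longleftrightarrow> {x, y} \<in> E"
proof -
  have "g \<otimes> y = g \<otimes> x \<otimes> s \<longleftrightarrow> y = x \<otimes> s" "g \<otimes> x = g \<otimes> y \<otimes> s \<longleftrightarrow> x = y \<otimes> s" if "s \<in> S" for s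
    using that assms S_sub by (auto simp: m_assoc subset_eq)
  then show ?thesis using assms by (auto simp: edge_iff)
qed

lemma image_edge: "g \<in> V \<Longrightarrow> e \<in> E \<Longrightarrow> left_mult g ` e \<in> E"
  by (frule edgeE) (auto simp: edge_translate)

lemma inj_image_edge: "g \<in> V \<Longrightarrow> inj_on ((`) (left_mult g)) E"
proof (rule inj_onI)
  fix e e' assume g: "g \<in> V" and e: "e \<in> E" "e' \<in> E" "left_mult g ` e = left_mult g ` e'"
  have "e \<subseteq> V" "e' \<subseteq> V" using e by (auto elim!: edgeE)
  then show "e = e'" using inj_on_image_eq_iff[OF inj_on_cmult[OF g]] e by blast
qed

text \<open>
  The configuration seen after moving \<open>g\<close> to the identity. Restricting to \<open>E\<close> keeps it in the space of
  the product measure.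
\<close>

definition shift_config :: "'a \<Rightarrow> ('a set \<Rightarrow> bool) \<Rightarrow> 'a set \<Rightarrow> bool" where
  "shift_config g \<omega> = (\<lambda>e\<in>E. \<omega> (left_mult g ` e))"

lemma graph_iso_cayley: "g \<in> V \<Longrightarrow> graph_iso (left_mult g) V E V E"
  by unfold_locales (auto simp: bij_left_mult edge_translate)

lemma graph_iso_shift:
  assumes "g \<in> V"
  shows "graph_iso (left_mult g) V (open_edges E (shift_config g \<omega>)) V (open_edges E \<omega>)"
  using assms
  by unfold_locales (auto simp: bij_left_mult edge_translate open_edges_def shift_config_def)

lemma distr_shift_config:
  assumes g: "g \<in> V"
  shows "distr (bond_percolation E p) (bond_percolation E p) (shift_config g) = bond_percolation E p"
    and "shift_config g \<in> measurable (bond_percolation E p) (bond_percolation E p)"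
proof -
  show "distr (bond_percolation E p) (bond_percolation E p) (shift_config g) = bond_percolation E p"
    using distr_PiM_reindex[of E "\<lambda>_. bernoulli_measure p" "(`) (left_mult g)" E]
      inj_image_edge[OF g] image_edge[OF g]
    unfolding bond_percolation_def shift_config_def by (auto simp: prob_space_measure_pmf)
  show "shift_config g \<in> measurable (bond_percolation E p) (bond_percolation E p)"
    unfolding bond_percolation_def shift_config_def
    by (intro measurable_restrict measurable_component_singleton image_edge[OF g])
qed

lemma sym_adj: "(x, y) \<in> adj V E' \<Longrightarrow> (y, x) \<in> adj V E'"
  by (auto simp: adj_def nbrs_def insert_commute)

lemma connected:
  assumes "x \<in> V" "y \<in> V"
  shows "(x, y) \<in> (adj V E)\<^sup>*"
proof -
  have sub: "generate G S \<subseteq> V" using S_gen by simp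
  have gen: "(x, x \<otimes> s) \<in> (adj V E)\<^sup>*" if "x \<in> V" "s \<in> S" for x s
  proof (cases "x \<otimes> s = x")
    case False
    then have "{x, x \<otimes> s} \<in> E" using that by (auto simp: cayley_edges_def)
    then have "(x, x \<otimes> s) \<in> adj V E" using that S_sub by (auto simp: adj_def nbrs_def)
    then show ?thesis by blast
  qed simp
  have "\<forall>x\<in>V. (x, x \<otimes> h) \<in> (adj V E)\<^sup>*" if "h \<in> generate G S" for h
    using that
  proof (induction rule: generate.induct)
    case one
    then show ?case by simp
  next
    case (incl h)
    then show ?case using gen by blast
  next
    case (inv h)
    show ?case
    proof
      fix x assume x: "x \<in> V"
      have h: "h \<in> V" using inv S_sub by blast
      have "(x \<otimes> inv h, x \<otimes> inv h \<otimes> h) \<in> (adj V E)\<^sup>*" using x h inv gen by blast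
      also have "x \<otimes> inv h \<otimes> h = x" using x h by (simp add: m_assoc)
      finally show "(x, x \<otimes> inv h) \<in> (adj V E)\<^sup>*"
        using sym_rtrancl[of "adj V E"] sym_adj by (meson symD symI)
    qed
  next
    case (eng h1 h2)
    show ?case
    proof
      fix x assume x: "x \<in> V"
      have h: "h1 \<in> V" "h2 \<in> V" using eng sub by auto
      have "(x, x \<otimes> h1) \<in> (adj V E)\<^sup>*" "(x \<otimes> h1, x \<otimes> h1 \<otimes> h2) \<in> (adj V E)\<^sup>*" using eng x h by auto
      then show "(x, x \<otimes> (h1 \<otimes> h2)) \<in> (adj V E)\<^sup>*" using x h by (simp add: m_assoc)
    qed
  qed
  then have "(x, x \<otimes> (inv x \<otimes> y)) \<in> (adj V E)\<^sup>*" using assms S_gen by auto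
  moreover have "x \<otimes> (inv x \<otimes> y) = y" using assms by (simp add: m_assoc[symmetric])
  ultimately show ?thesis by simp
qed

lemma UN_thicken: "x \<in> V \<Longrightarrow> (\<Union>n. thicken V E n {x}) = V"
  using connected[of x] by (simp add: component_of_eq_thicken[symmetric]) (auto simp: component_of_def)

lemma finite_ball: "x \<in> V \<Longrightarrow> finite (thicken V E n {x})"
  by (rule finite_thicken) (auto intro: finite_nbrs)

lemma countable_V: "countable V"
proof -
  have "countable (\<Union>n. thicken V E n {\<one>})"
    by (rule countable_UN) (auto intro: countable_finite finite_ball)
  then show ?thesis by (simp only: UN_thicken[OF one_closed])
qed

lemma E_sub_Pow: "E \<subseteq> {e. finite e \<and> e \<subseteq> V}"
proof
  fix e assume "e \<in> E"
  then obtain x y where "e = {x, y}" "x \<in> V" "y \<in> V" by (rule edgeE)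
  then show "e \<in> {e. finite e \<and> e \<subseteq> V}" by simp
qed

lemma countable_E: "countable E"
  using countable_subset[OF E_sub_Pow countable_Collect_finite_subset[OF countable_V]] .

definition touching :: "'a set \<Rightarrow> 'a set set" where
  "touching F = {e \<in> E. e \<inter> F \<noteq> {}}"

lemma finite_touching:
  assumes "finite F"
  shows "finite (touching F)"
proof (rule finite_subset)
  show "touching F \<subseteq> (\<Union>x\<in>F. (\<lambda>y. {x, y}) ` nbrs V E x)"
  proof
    fix e assume "e \<in> touching F"
    then obtain x where e: "e \<in> E" "x \<in> e" "x \<in> F" by (auto simp: touching_def)
    then obtain y where "e = {x, y}" "y \<in> V" by (auto elim!: edgeE)
    with e show "e \<in> (\<Union>x\<in>F. (\<lambda>y. {x, y}) ` nbrs V E x)" by (auto simp: nbrs_def)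
  qed
qed (use assms finite_nbrs in auto)

end

section \<open>Percolation on subperiodic trees\<close>

text \<open>
  If \<open>a n / \<rho> ^ n\<close> were bounded, the partial sums of \<open>a\<close> would grow at most like \<open>\<rho> ^ n\<close>. Hence this
  sequence is unbounded and attains new maxima infinitely often, and at such an index all earlier
  terms are dominated. For sphere sizes this replaces regularity of the growth: the lower bound on the
  balls says nothing about individual spheres, but infinitely many good radii suffice.
\<close>

lemma exists_growth_record:
  fixes a :: "nat \<Rightarrow> nat" and \<zeta> \<rho> :: real
  assumes growth: "\<And>n. \<zeta> ^ n \<le> (\<Sum>j\<le>n. real (a j))" and l: "1 < \<rho>" "\<rho> < \<zeta>"
  shows "\<exists>n\<ge>n0. 0 < a n \<and> (\<forall>k\<le>n. real (a (n - k)) \<le> real (a n) * (1 / \<rho>) ^ k)"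
proof -
  define c where "c n = real (a n) / \<rho> ^ n" for n
  \<comment> \<open>a maximiser over a range in which K is exceeded must lie beyond n0\<close>
  define K where "K = Max (c ` {..n0}) + 1"
  have ex: "\<exists>n. c n > K"
  proof (rule ccontr)
    assume "\<not> (\<exists>n. c n > K)"
    then have cK: "c n \<le> K" for n by (simp add: not_less)
    have a: "real (a j) \<le> K * \<rho> ^ j" for j using cK[of j] l by (simp add: c_def divide_le_eq)
    have "\<zeta> ^ n \<le> K * \<rho> / (\<rho> - 1) * \<rho> ^ n" for n
    proof -
      have K0: "0 \<le> K" using a[of 0] by simp
      have "\<zeta> ^ n \<le> (\<Sum>j\<le>n. K * \<rho> ^ j)" using growth[of n] a by (meson order_trans sum_mono)
      also have "\<dots> = K * ((\<rho> ^ Suc n - 1) / (\<rho> - 1))"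
      proof -
        have "(\<Sum>j\<le>n. \<rho> ^ j) = (\<rho> ^ Suc n - 1) / (\<rho> - 1)"
          using geometric_sum[of \<rho> "Suc n"] l unfolding lessThan_Suc_atMost by blast
        then show ?thesis by (simp only: sum_distrib_left[symmetric])
      qed
      also have "\<dots> \<le> K * (\<rho> ^ Suc n / (\<rho> - 1))"
        using K0 l by (intro mult_left_mono divide_right_mono) auto
      finally show ?thesis by (simp add: field_simps)
    qed
    then have le: "(\<zeta> / \<rho>) ^ n \<le> K * \<rho> / (\<rho> - 1)" for n
      using l by (simp add: power_divide divide_le_eq)
    have "1 < \<zeta> / \<rho>" using l by simp
    from real_arch_pow[OF this, of "K * \<rho> / (\<rho> - 1)"] obtain n where "K * \<rho> / (\<rho> - 1) < (\<zeta> / \<rho>) ^ n" by blast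
    with le[of n] show False by simp
  qed
  then obtain m where m: "c m > K" by blast
  have big: "\<And>j. j \<le> n0 \<Longrightarrow> c j < K"
  proof -
    fix j assume "j \<le> n0"
    then have "c j \<le> Max (c ` {..n0})" by (intro Max_ge) auto
    then show "c j < K" by (simp add: K_def)
  qed
  obtain n where n: "n \<le> m" "\<And>j. j \<le> m \<Longrightarrow> c j \<le> c n"
  proof -
    have "Max (c ` {..m}) \<in> c ` {..m}" by (intro Max_in) auto
    then obtain n where n: "Max (c ` {..m}) = c n" "n \<in> {..m}" by (elim imageE)
    have "c j \<le> c n" if "j \<le> m" for j
      using that unfolding n(1)[symmetric] by (intro Max_ge) auto
    with n(2) show thesis using that[of n] by simp
  qed
  have cn: "K < c n" using n(2)[of m] m by simp
  have "c n0 \<ge> 0" using l by (simp add: c_def)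
  then have "c n > 0" using cn big[of n0] by simp
  then have "a n > 0" using l by (simp add: c_def zero_less_divide_iff)
  moreover have "n \<ge> n0" using big[of n] cn by (meson less_imp_le nat_le_linear not_less)
  moreover have "real (a (n - k)) \<le> real (a n) * (1 / \<rho>) ^ k" if "k \<le> n" for k
  proof -
    have "c (n - k) \<le> c n" using n by simp
    then have "real (a (n - k)) \<le> real (a n) / \<rho> ^ n * \<rho> ^ (n - k)"
      using l by (simp add: c_def divide_le_eq)
    also have "\<rho> ^ n = \<rho> ^ (n - k) * \<rho> ^ k" using that by (simp flip: power_add)
    finally show ?thesis using l by (simp add: power_divide)
  qed
  ultimately show ?thesis by blast
qed

text \<open>
  A Paley-Zygmund inequality that controls \<open>Q\<close> at the same time. It follows by integrating a bound
  on \<open>Z\<close> in which each of the three cases, \<open>Z\<close> small, \<open>Q\<close> large, or the event \<open>Y\<close>, is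
  covered by a summand of its own.
\<close>

lemma (in prob_space) second_moment_lower_bound:
  fixes Z Q :: "'a \<Rightarrow> real"
  assumes int: "integrable M Z" "integrable M (\<lambda>\<omega>. (Z \<omega>)\<^sup>2)" "integrable M Q"
    and EZ: "expectation Z = 1" "expectation (\<lambda>\<omega>. (Z \<omega>)\<^sup>2) \<le> A" and EQ: "expectation Q \<le> B"
    and Q: "\<And>\<omega>. 0 \<le> Q \<omega>" and AB: "0 < A" "0 < B"
    and Y: "Y \<in> events" "\<And>\<omega>. \<omega> \<in> space M \<Longrightarrow> 1 / 2 < Z \<omega> \<Longrightarrow> Q \<omega> \<le> 16 * A * B \<Longrightarrow> \<omega> \<in> Y"
  shows "1 / (8 * A) \<le> prob Y"
proof -
  let ?f = "\<lambda>\<omega>. 1 / 2 + 2 * A * indicator Y \<omega> + (Z \<omega>)\<^sup>2 / (8 * A) + Q \<omega> / (8 * B)"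
  have iY: "integrable M (indicat_real Y)"
    using Y(1) by (simp add: emeasure_eq_measure)
  have "expectation Z \<le> expectation ?f"
  proof (rule integral_mono)
    show "integrable M Z" by (rule int)
    show "integrable M ?f" using int iY by (intro Bochner_Integration.integrable_add) auto
    fix \<omega> assume \<omega>: "\<omega> \<in> space M"
    \<comment> \<open>the arithmetic-geometric mean inequality, with the weight that leaves a total of 3/4 below\<close>
    have am: "Z \<omega> \<le> 2 * A + (Z \<omega>)\<^sup>2 / (8 * A)"
    proof -
      have "0 \<le> (Z \<omega> - 4 * A)\<^sup>2" by simp
      then have "8 * A * Z \<omega> \<le> 16 * A\<^sup>2 + (Z \<omega>)\<^sup>2" by (simp add: power2_eq_square algebra_simps)
      then show ?thesis using AB by (simp add: field_simps power2_eq_square)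
    qed
    have nn: "0 \<le> Q \<omega> / (8 * B)" "0 \<le> (Z \<omega>)\<^sup>2 / (8 * A)" "0 \<le> 2 * A * indicator Y \<omega>" using Q AB by auto
    consider "Z \<omega> \<le> 1 / 2" | "\<omega> \<in> Y" | "16 * A * B < Q \<omega>"
      using Y(2)[OF \<omega>] by force
    then show "Z \<omega> \<le> ?f \<omega>"
    proof cases
      case 1
      with nn show ?thesis by linarith
    next
      case 2
      then have "indicator Y \<omega> = (1::real)" by simp
      with nn am show ?thesis by simp
    next
      case 3
      then have "2 * A \<le> Q \<omega> / (8 * B)" using AB by (simp add: field_simps)
      with nn am show ?thesis by linarith
    qed
  qed
  also have "expectation ?f = 1 / 2 + 2 * A * prob Y + expectation (\<lambda>\<omega>. (Z \<omega>)\<^sup>2) / (8 * A) + expectation Q / (8 * B)"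
    using int iY Y(1) by (simp add: prob_space)
  also have "\<dots> \<le> 1 / 2 + 2 * A * prob Y + A / (8 * A) + B / (8 * B)"
    using EZ EQ AB by (intro add_mono divide_right_mono) auto
  also have "\<dots> = 3 / 4 + 2 * A * prob Y" using AB by simp
  finally show ?thesis using EZ AB by (simp add: field_simps)
qed

text \<open>
  A rooted spanning tree whose levels grow subperiodically: a vertex of level \<open>k\<close> has at most as many
  descendants in level \<open>n\<close> as there are vertices in level \<open>n - k\<close>.
\<close>

locale levelled_tree =
  fixes V :: "'a set" and E :: "'a set set" and root :: 'a and lev :: "'a \<Rightarrow> nat" and par :: "'a \<Rightarrow> 'a"
  assumes lev_0: "\<And>y. y \<in> V \<Longrightarrow> lev y = 0 \<Longrightarrow> y = root"
    and root: "root \<in> V" "lev root = 0"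
    and par: "\<And>y. y \<in> V \<Longrightarrow> 0 < lev y \<Longrightarrow> par y \<in> V" "\<And>y. y \<in> V \<Longrightarrow> 0 < lev y \<Longrightarrow> lev (par y) = lev y - 1"
    and par_edge: "\<And>y. y \<in> V \<Longrightarrow> 0 < lev y \<Longrightarrow> {y, par y} \<in> E"
    and finite_level: "\<And>n. finite {y \<in> V. lev y = n}"
    and finite_deg: "\<And>y. finite (nbrs V E y)"
    and descendants: "\<And>n k x. x \<in> V \<Longrightarrow> lev x = k \<Longrightarrow> k \<le> n \<Longrightarrow>
      card {y \<in> V. lev y = n \<and> (par ^^ (n - k)) y = x} \<le> card {y \<in> V. lev y = n - k}"
begin

definition L :: "nat \<Rightarrow> 'a set" where "L n = {y \<in> V. lev y = n}"
definition anc :: "'a \<Rightarrow> 'a set" where "anc y = (\<lambda>i. (par ^^ i) y) ` {..<lev y}"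
definition up_edge :: "'a \<Rightarrow> 'a set" where "up_edge x = {x, par x}"

lemma iter_par: "y \<in> V \<Longrightarrow> i \<le> lev y \<Longrightarrow> (par ^^ i) y \<in> V \<and> lev ((par ^^ i) y) = lev y - i"
  by (induction i) (auto simp: par)

lemma anc_in: "y \<in> V \<Longrightarrow> x \<in> anc y \<Longrightarrow> x \<in> V \<and> 0 < lev x \<and> lev x \<le> lev y \<and> x = (par ^^ (lev y - lev x)) y"
  using iter_par[of y] unfolding anc_def by fastforce

lemma finite_anc [simp]: "finite (anc y)" by (simp add: anc_def)

lemma inj_iter_par: "y \<in> V \<Longrightarrow> inj_on (\<lambda>i. (par ^^ i) y) {..<lev y}"
proof (rule inj_onI)
  fix i j assume "y \<in> V" "i \<in> {..<lev y}" "j \<in> {..<lev y}" "(par ^^ i) y = (par ^^ j) y"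
  then show "i = j" using iter_par[of y i] iter_par[of y j] by auto
qed

lemma card_anc: "y \<in> V \<Longrightarrow> card (anc y) = lev y"
  unfolding anc_def by (simp add: card_image inj_iter_par)

lemma inj_up_edge: "inj_on up_edge {x \<in> V. 0 < lev x}"
proof (rule inj_onI)
  fix x y assume x: "x \<in> {x \<in> V. 0 < lev x}" and y: "y \<in> {x \<in> V. 0 < lev x}" and eq: "up_edge x = up_edge y"
  then have "(x = y \<and> par x = par y) \<or> (x = par y \<and> par x = y)"
    by (simp only: up_edge_def doubleton_eq_iff)
  then show "x = y"
  proof
    assume xy: "x = par y \<and> par x = y"
    have l: "lev (par x) = lev x - 1" "lev (par y) = lev y - 1" using par(2) x y by auto
    from l(1) have "lev y = lev x - 1" unfolding conjunct2[OF xy] .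
    moreover from l(2) have "lev x = lev y - 1" unfolding conjunct1[OF xy, symmetric] .
    ultimately show ?thesis using x y by simp
  qed (rule conjunct1)
qed

text \<open>
  Tree edges are named by their lower endpoints, so \<open>anc y\<close> lists the edges of the path from \<open>y\<close>
  to the root. Two such paths merge at some level and then stay together, so the number of common
  edges determines the level of the last common vertex.
\<close>

lemma common_ancestor:
  assumes y: "y \<in> L n" "y' \<in> L n" and k: "card (anc y \<inter> anc y') = k"
  shows "k \<le> n \<and> (par ^^ (n - k)) y' = (par ^^ (n - k)) y"
proof -
  have V: "y \<in> V" "y' \<in> V" "lev y = n" "lev y' = n" using y by (auto simp: L_def)
  have kn: "k \<le> n" using card_mono[of "anc y" "anc y \<inter> anc y'"] card_anc[OF V(1)] V k by simp
  show ?thesis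
  proof (cases "k = 0")
    case True
    have "(par ^^ n) y = root" "(par ^^ n) y' = root"
      using iter_par[OF V(1), of n] iter_par[OF V(2), of n] V by (auto intro: lev_0)
    with True show ?thesis by simp
  next
    case False
    have "\<exists>z\<in>anc y \<inter> anc y'. k \<le> lev z"
    proof (rule ccontr)
      assume "\<not> (\<exists>z\<in>anc y \<inter> anc y'. k \<le> lev z)"
      then have small: "\<not> k \<le> lev z" if "z \<in> anc y \<inter> anc y'" for z using that by blast
      have "lev z \<in> {1..<k}" if z: "z \<in> anc y \<inter> anc y'" for z
      proof -
        have "0 < lev z" using anc_in[OF V(1), of z] z by blast
        with small[OF z] show ?thesis by simp
      qed
      then have "lev ` (anc y \<inter> anc y') \<subseteq> {1..<k}" by blast
      moreover have "inj_on lev (anc y \<inter> anc y')"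
        by (rule inj_onI) (metis IntE anc_in[OF V(1)])
      ultimately have "card (anc y \<inter> anc y') \<le> card {1..<k}"
        using card_inj_on_le[of lev _ "{1..<k}"] by blast
      with k False show False by simp
    qed
    then obtain z where z: "z \<in> anc y" "z \<in> anc y'" "k \<le> lev z" by blast
    have e: "z = (par ^^ (n - lev z)) y" "z = (par ^^ (n - lev z)) y'" "lev z \<le> n"
      using anc_in[OF V(1) z(1)] anc_in[OF V(2) z(2)] V by auto
    have nk: "n - k = (lev z - k) + (n - lev z)" using z(3) e(3) by simp
    have "(par ^^ (n - k)) y' = (par ^^ (lev z - k)) z" "(par ^^ (n - k)) y = (par ^^ (lev z - k)) z"
      unfolding nk funpow_add o_def using e by metis+
    with kn show ?thesis by simp
  qed
qed

text \<open>
  Grouping the vertices of level \<open>n\<close> by the number of edges they share with \<open>y\<close>: at most as many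
  vertices share \<open>k\<close> edges as the vertex of level \<open>k\<close> above \<open>y\<close> has descendants.
\<close>

lemma sum_common_le:
  fixes f :: "nat \<Rightarrow> real"
  assumes y: "y \<in> L n" and f: "\<And>k. 0 \<le> f k"
    and rec: "\<And>k. k \<le> n \<Longrightarrow> real (card (L (n - k))) \<le> real (card (L n)) * q ^ k"
  shows "(\<Sum>y'\<in>L n. f (card (anc y \<inter> anc y'))) \<le> real (card (L n)) * (\<Sum>k\<le>n. q ^ k * f k)"
proof -
  have fin: "finite (L n)" using finite_level by (simp add: L_def)
  have "(\<Sum>y'\<in>L n. f (card (anc y \<inter> anc y'))) =
      (\<Sum>y'\<in>L n. \<Sum>k\<le>n. if card (anc y \<inter> anc y') = k then f k else 0)"
    using common_ancestor[OF y] by (intro sum.cong refl) (simp add: sum.delta)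
  also have "\<dots> = (\<Sum>k\<le>n. \<Sum>y'\<in>L n. if card (anc y \<inter> anc y') = k then f k else 0)"
    by (rule sum.swap)
  also have "\<dots> = (\<Sum>k\<le>n. real (card {y' \<in> L n. card (anc y \<inter> anc y') = k}) * f k)"
    using fin by (intro sum.cong refl) (simp add: sum.If_cases Int_def)
  also have "\<dots> \<le> (\<Sum>k\<le>n. real (card (L n)) * q ^ k * f k)"
  proof (intro sum_mono mult_right_mono f)
    fix k assume "k \<in> {..n}"
    then have k: "k \<le> n" by simp
    let ?x = "(par ^^ (n - k)) y"
    have yV: "y \<in> V" "lev y = n" using y by (auto simp: L_def)
    have x: "?x \<in> V" "lev ?x = k" using iter_par[OF yV(1), of "n - k"] yV k by auto
    have "{y' \<in> L n. card (anc y \<inter> anc y') = k} \<subseteq> {y' \<in> V. lev y' = n \<and> (par ^^ (n - k)) y' = ?x}"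
      using common_ancestor[OF y] by (auto simp: L_def)
    then have "card {y' \<in> L n. card (anc y \<inter> anc y') = k} \<le>
        card {y' \<in> V. lev y' = n \<and> (par ^^ (n - k)) y' = ?x}"
      by (intro card_mono finite_subset[OF _ finite_level[of n]]) auto
    also have "\<dots> \<le> card (L (n - k))" using descendants[OF x k] by (simp add: L_def)
    finally show "real (card {y' \<in> L n. card (anc y \<inter> anc y') = k}) \<le> real (card (L n)) * q ^ k"
      using rec[OF k] by linarith
  qed
  finally show ?thesis by (simp add: sum_distrib_left mult.assoc)
qed

lemma telescope_anc:
  fixes g :: "'a \<Rightarrow> real"
  assumes "y \<in> V"
  shows "(\<Sum>x\<in>anc y. g (par x) - g x) = g root - g y"
proof -
  have "(\<Sum>x\<in>anc y. g (par x) - g x) = (\<Sum>i<lev y. g ((par ^^ Suc i) y) - g ((par ^^ i) y))"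
    unfolding anc_def by (subst sum.reindex[OF inj_iter_par[OF assms]]) simp
  also have "\<dots> = g ((par ^^ lev y) y) - g y"
    by (subst sum_lessThan_telescope) simp
  also have "(par ^^ lev y) y = root" using iter_par[OF assms, of "lev y"] lev_0 by simp
  finally show ?thesis .
qed

text \<open>
  Each tree edge with a nonzero increment has an endpoint in \<open>F\<close>; listing that endpoint first embeds
  these edges injectively into the ordered pairs over which the energy is a sum.
\<close>

lemma tree_edges_energy:
  fixes g :: "'a \<Rightarrow> real"
  assumes F: "finite F" "F \<subseteq> V" and g: "\<And>y. y \<notin> F \<Longrightarrow> g y = 0"
    and T: "finite T" "T \<subseteq> {x \<in> V. 0 < lev x}" and op: "\<And>x. x \<in> T \<Longrightarrow> \<omega> (up_edge x)"
  shows "(\<Sum>x\<in>T. (g (par x) - g x)\<^sup>2) \<le> dirichlet V (open_edges E \<omega>) F g"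
proof -
  let ?N = "nbrs V (open_edges E \<omega>)"
  have finN: "finite (?N y)" for y
    by (rule finite_subset[OF _ finite_deg[of y]]) (auto simp: nbrs_def open_edges_def)
  \<comment> \<open>edges with both endpoints off F have zero increment\<close>
  define T' where "T' = {x \<in> T. x \<in> F \<or> par x \<in> F}"
  define h where "h x = (if x \<in> F then (x, par x) else (par x, x))" for x
  have inj: "inj_on h T'"
  proof (rule inj_onI)
    fix x y assume "x \<in> T'" "y \<in> T'" "h x = h y"
    then have "up_edge x = up_edge y" "x \<in> {x \<in> V. 0 < lev x}" "y \<in> {x \<in> V. 0 < lev x}"
      using T unfolding T'_def h_def up_edge_def by (auto split: if_splits)
    then show "x = y" using inj_up_edge by (auto dest: inj_onD)
  qed
  have "(\<Sum>x\<in>T. (g (par x) - g x)\<^sup>2) = (\<Sum>x\<in>T'. (g (par x) - g x)\<^sup>2)"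
    unfolding T'_def using T g by (intro sum.mono_neutral_right) auto
  also have "\<dots> = (\<Sum>x\<in>T'. (\<lambda>(y, w). (g y - g w)\<^sup>2) (h x))"
    by (intro sum.cong refl) (auto simp: h_def power2_commute)
  also have "\<dots> = (\<Sum>z\<in>h ` T'. (\<lambda>(y, w). (g y - g w)\<^sup>2) z)"
    by (simp add: sum.reindex[OF inj])
  also have "\<dots> \<le> (\<Sum>z\<in>Sigma F ?N. (\<lambda>(y, w). (g y - g w)\<^sup>2) z)"
  proof (rule sum_mono2)
    show "finite (Sigma F ?N)" using F finN by auto
    show "h ` T' \<subseteq> Sigma F ?N"
    proof
      fix z assume "z \<in> h ` T'"
      then obtain x where x: "z = h x" "x \<in> T" "x \<in> F \<or> par x \<in> F" by (auto simp: T'_def)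
      have xV: "x \<in> V" "par x \<in> V" "{x, par x} \<in> open_edges E \<omega>"
        using x(2) T op[of x] par(1) par_edge by (auto simp: open_edges_def up_edge_def)
      then show "z \<in> Sigma F ?N" using x by (auto simp: h_def nbrs_def insert_commute)
    qed
  qed auto
  also have "\<dots> = dirichlet V (open_edges E \<omega>) F g"
    unfolding dirichlet_def using F finN by (subst sum.Sigma) auto
  finally show ?thesis .
qed

definition path_open :: "('a set \<Rightarrow> bool) \<Rightarrow> 'a \<Rightarrow> real" where
  "path_open \<omega> y = of_bool (\<forall>x\<in>anc y. \<omega> (up_edge x))"

text \<open>
  The weight of the edge above \<open>x\<close> in the flow that sends mass \<open>1 / (N * p ^ n)\<close> from the root along
  every fully open path to one of the \<open>N\<close> vertices of level \<open>n\<close>. The expected strength is one.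
\<close>

definition flow :: "nat \<Rightarrow> real \<Rightarrow> ('a set \<Rightarrow> bool) \<Rightarrow> 'a \<Rightarrow> real" where
  "flow n p \<omega> x = (\<Sum>y\<in>L n. of_bool (x \<in> anc y) * path_open \<omega> y) / (real (card (L n)) * p ^ n)"

definition flow_strength :: "nat \<Rightarrow> real \<Rightarrow> ('a set \<Rightarrow> bool) \<Rightarrow> real" where
  "flow_strength n p \<omega> = (\<Sum>y\<in>L n. path_open \<omega> y) / (real (card (L n)) * p ^ n)"

definition flow_energy :: "nat \<Rightarrow> real \<Rightarrow> ('a set \<Rightarrow> bool) \<Rightarrow> real" where
  "flow_energy n p \<omega> = (\<Sum>x\<in>(\<Union>y\<in>L n. anc y). (flow n p \<omega> x)\<^sup>2)"

lemma finite_L: "finite (L n)" using finite_level by (simp add: L_def)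

text \<open>
  Thomson's principle in one direction. Pairing the flow with the increments of \<open>g\<close> telescopes along
  each path to \<open>g root\<close>, since \<open>g\<close> vanishes in level \<open>n\<close>; the Cauchy-Schwarz inequality does the rest.
  The flow lives on open edges, so only those contribute.
\<close>

lemma flow_bound:
  fixes g :: "'a \<Rightarrow> real"
  assumes F: "finite F" "F \<subseteq> V" "\<And>y. y \<in> F \<Longrightarrow> lev y < n" and g: "\<And>y. y \<notin> F \<Longrightarrow> g y = 0"
  shows "(flow_strength n p \<omega> * g root)\<^sup>2 \<le> flow_energy n p \<omega> * dirichlet V (open_edges E \<omega>) F g"
proof -
  let ?T = "\<Union>y\<in>L n. anc y" and ?c = "real (card (L n)) * p ^ n"
  have finT: "finite ?T" using finite_L by auto
  define b where "b x = (if \<omega> (up_edge x) then g (par x) - g x else 0)" for x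
  have fl0: "flow n p \<omega> x = 0" if "\<not> \<omega> (up_edge x)" for x
    unfolding flow_def path_open_def using that by (auto intro!: sum.neutral)
  have anc_sub: "anc y \<subseteq> ?T" if "y \<in> L n" for y using that by auto
  have fx: "flow n p \<omega> x * d = (\<Sum>y\<in>L n. path_open \<omega> y * (of_bool (x \<in> anc y) * d)) / ?c" for x d
    unfolding flow_def by (simp add: sum_distrib_left mult_ac)
  have "(\<Sum>x\<in>?T. flow n p \<omega> x * b x) = (\<Sum>x\<in>?T. flow n p \<omega> x * (g (par x) - g x))"
    by (intro sum.cong refl) (auto simp: b_def fl0)
  also have "\<dots> = (\<Sum>x\<in>?T. \<Sum>y\<in>L n. path_open \<omega> y * (of_bool (x \<in> anc y) * (g (par x) - g x))) / ?c"
    by (simp only: fx sum_divide_distrib)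
  also have "(\<Sum>x\<in>?T. \<Sum>y\<in>L n. path_open \<omega> y * (of_bool (x \<in> anc y) * (g (par x) - g x))) =
      (\<Sum>y\<in>L n. path_open \<omega> y * (\<Sum>x\<in>?T. of_bool (x \<in> anc y) * (g (par x) - g x)))"
    by (subst sum.swap) (simp add: sum_distrib_left)
  also have "\<dots> = (\<Sum>y\<in>L n. path_open \<omega> y * g root)"
  proof (intro sum.cong refl)
    fix y assume y: "y \<in> L n"
    have "(\<Sum>x\<in>?T. of_bool (x \<in> anc y) * (g (par x) - g x)) = (\<Sum>x\<in>anc y. g (par x) - g x)"
      using finT anc_sub[OF y] by (intro sum.mono_neutral_cong_right) auto
    also have "\<dots> = g root" using telescope_anc[of y g] y F(3)[of y] g[of y] by (auto simp: L_def)
    finally show "path_open \<omega> y * (\<Sum>x\<in>?T. of_bool (x \<in> anc y) * (g (par x) - g x)) = path_open \<omega> y * g root"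
      by simp
  qed
  finally have eq: "(\<Sum>x\<in>?T. flow n p \<omega> x * b x) = flow_strength n p \<omega> * g root"
    by (simp add: flow_strength_def sum_distrib_right)
  have "(flow_strength n p \<omega> * g root)\<^sup>2 \<le> flow_energy n p \<omega> * (\<Sum>x\<in>?T. (b x)\<^sup>2)"
    unfolding eq[symmetric] flow_energy_def by (rule Cauchy_Schwarz_ineq_sum)
  also have "(\<Sum>x\<in>?T. (b x)\<^sup>2) = (\<Sum>x\<in>{x \<in> ?T. \<omega> (up_edge x)}. (g (par x) - g x)\<^sup>2)"
    using finT by (intro sum.mono_neutral_cong_right) (auto simp: b_def)
  also have "flow_energy n p \<omega> * \<dots> \<le> flow_energy n p \<omega> * dirichlet V (open_edges E \<omega>) F g"
  proof (intro mult_left_mono tree_edges_energy F g)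
    show "{x \<in> ?T. \<omega> (up_edge x)} \<subseteq> {x \<in> V. 0 < lev x}"
      using anc_in by (auto simp: L_def)
    show "finite {x \<in> ?T. \<omega> (up_edge x)}" by (rule finite_subset[OF _ finT]) auto
    show "0 \<le> flow_energy n p \<omega>" unfolding flow_energy_def by (intro sum_nonneg) simp
  qed auto
  finally show ?thesis .
qed

lemma flow_energy_eq:
  "flow_energy n p \<omega> = (\<Sum>y\<in>L n. \<Sum>y'\<in>L n. real (card (anc y \<inter> anc y')) * (path_open \<omega> y * path_open \<omega> y'))
      / (real (card (L n)) * p ^ n)\<^sup>2"
proof -
  let ?T = "\<Union>y\<in>L n. anc y" and ?c = "real (card (L n)) * p ^ n"
  have finT: "finite ?T" using finite_L by auto
  have fx: "(flow n p \<omega> x)\<^sup>2 = (\<Sum>y\<in>L n. \<Sum>y'\<in>L n.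
      of_bool (x \<in> anc y \<inter> anc y') * (path_open \<omega> y * path_open \<omega> y')) / ?c\<^sup>2" for x
  proof -
    have "(flow n p \<omega> x)\<^sup>2 = (\<Sum>y\<in>L n. of_bool (x \<in> anc y) * path_open \<omega> y)\<^sup>2 / ?c\<^sup>2"
      by (simp only: flow_def power_divide)
    also have "(\<Sum>y\<in>L n. of_bool (x \<in> anc y) * path_open \<omega> y)\<^sup>2 =
        (\<Sum>y\<in>L n. \<Sum>y'\<in>L n. of_bool (x \<in> anc y \<inter> anc y') * (path_open \<omega> y * path_open \<omega> y'))"
      unfolding power2_eq_square sum_product by (intro sum.cong refl) simp
    finally show ?thesis .
  qed
  have "flow_energy n p \<omega> = (\<Sum>x\<in>?T. \<Sum>y\<in>L n. \<Sum>y'\<in>L n.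
      of_bool (x \<in> anc y \<inter> anc y') * (path_open \<omega> y * path_open \<omega> y')) / ?c\<^sup>2"
    unfolding flow_energy_def by (simp only: fx sum_divide_distrib)
  also have "(\<Sum>x\<in>?T. \<Sum>y\<in>L n. \<Sum>y'\<in>L n. of_bool (x \<in> anc y \<inter> anc y') * (path_open \<omega> y * path_open \<omega> y')) =
      (\<Sum>y\<in>L n. \<Sum>y'\<in>L n. \<Sum>x\<in>?T. of_bool (x \<in> anc y \<inter> anc y') * (path_open \<omega> y * path_open \<omega> y'))"
    by (subst sum.swap, rule sum.cong[OF refl], rule sum.swap)
  also have "\<dots> = (\<Sum>y\<in>L n. \<Sum>y'\<in>L n. real (card (anc y \<inter> anc y')) * (path_open \<omega> y * path_open \<omega> y'))"
  proof (intro sum.cong refl)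
    fix y y' assume y: "y \<in> L n" "y' \<in> L n"
    have "(\<Sum>x\<in>?T. of_bool (x \<in> anc y \<inter> anc y') * (path_open \<omega> y * path_open \<omega> y')) =
        (\<Sum>x\<in>anc y \<inter> anc y'. path_open \<omega> y * path_open \<omega> y')"
      using finT y by (intro sum.mono_neutral_cong_right) auto
    then show "(\<Sum>x\<in>?T. of_bool (x \<in> anc y \<inter> anc y') * (path_open \<omega> y * path_open \<omega> y')) =
        real (card (anc y \<inter> anc y')) * (path_open \<omega> y * path_open \<omega> y')" by simp
  qed
  finally show ?thesis .
qed

text \<open>
  Two paths of length \<open>n\<close> with \<open>m\<close> common edges use \<open>2 * n - m\<close> edges, each open with probability \<open>p\<close>.
\<close>

lemma expectation_path_pair:
  assumes p: "0 < p" "p \<le> 1" and y: "y \<in> L n" "y' \<in> L n"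
  shows "has_bochner_integral (bond_percolation E p) (\<lambda>\<omega>. path_open \<omega> y * path_open \<omega> y')
    ((p ^ n)\<^sup>2 * (1 / p) ^ card (anc y \<inter> anc y'))"
proof -
  let ?M = "bond_percolation E p" and ?A = "anc y \<union> anc y'"
  interpret prob_space ?M by (rule prob_space_bond)
  let ?X = "{\<omega> \<in> space ?M. \<forall>e\<in>up_edge ` ?A. \<omega> e}"
  have V: "y \<in> V" "y' \<in> V" "lev y = n" "lev y' = n" using y by (auto simp: L_def)
  have A: "?A \<subseteq> {x \<in> V. 0 < lev x}" using anc_in V by blast
  have K: "up_edge ` ?A \<subseteq> E" using A par_edge by (auto simp: up_edge_def)
  have "card (up_edge ` ?A) = card ?A"
    by (rule card_image[OF inj_on_subset[OF inj_up_edge A]])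
  moreover have "card ?A + card (anc y \<inter> anc y') = n + n"
    using card_Un_Int[of "anc y" "anc y'"] card_anc V by simp
  ultimately have card: "card (up_edge ` ?A) + card (anc y \<inter> anc y') = n + n" by simp
  have X: "?X \<in> sets ?M"
    by (rule measurable_determined_by_finite[OF _ K]) (auto simp: determined_by_def)
  have "measure ?M ?X = p ^ card (up_edge ` ?A)"
    using p by (intro prob_all_open K) auto
  also have "\<dots> = p ^ (card (up_edge ` ?A) + card (anc y \<inter> anc y')) * (1 / p) ^ card (anc y \<inter> anc y')"
    using p by (simp add: power_add power_divide)
  also have "\<dots> = (p ^ n)\<^sup>2 * (1 / p) ^ card (anc y \<inter> anc y')"
    by (simp add: card power_add power2_eq_square)
  finally have m: "measure ?M ?X = (p ^ n)\<^sup>2 * (1 / p) ^ card (anc y \<inter> anc y')" .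
  have "has_bochner_integral ?M (indicat_real ?X) (measure ?M ?X)"
    using X by (intro has_bochner_integral_real_indicator) (auto simp: emeasure_eq_measure)
  then show ?thesis unfolding m
    by (rule has_bochner_integral_cong[THEN iffD1, rotated 3])
      (auto simp: path_open_def indicator_def)
qed

text \<open>
  Both moments needed below are averages of \<open>f m * (1 / p) ^ m\<close> over pairs of vertices of level \<open>n\<close>, where
  \<open>m\<close> is the number of common edges: \<open>f = 1\<close> for the square of the strength and \<open>f m = m\<close> for the energy.
  A pair has \<open>m\<close> common edges with frequency at most \<open>q ^ m\<close>, so \<open>q < p\<close> makes the sums converge,
  uniformly in \<open>n\<close>.
\<close>

lemma sum_pairs_le:
  fixes f :: "nat \<Rightarrow> real"
  assumes p: "0 < p" and r: "0 \<le> q / p" "q / p < 1"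
    and rec: "\<And>k. k \<le> n \<Longrightarrow> real (card (L (n - k))) \<le> real (card (L n)) * q ^ k"
    and N: "0 < card (L n)" and f: "\<And>k. 0 \<le> f k" "\<And>k. f k \<le> real (Suc k)"
  shows "(\<Sum>y\<in>L n. \<Sum>y'\<in>L n. f (card (anc y \<inter> anc y')) * ((p ^ n)\<^sup>2 * (1 / p) ^ card (anc y \<inter> anc y')))
      / (real (card (L n)) * p ^ n)\<^sup>2 \<le> 1 / (1 - q / p)\<^sup>2"
proof -
  let ?N = "real (card (L n))" and ?r = "q / p"
  have gs: "(\<Sum>k\<le>n. q ^ k * (f k * (1 / p) ^ k)) \<le> 1 / (1 - ?r)\<^sup>2"
  proof -
    have "(\<Sum>k\<le>n. q ^ k * (f k * (1 / p) ^ k)) = (\<Sum>k\<le>n. f k * ?r ^ k)"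
      by (intro sum.cong refl) (simp add: power_divide)
    also have "\<dots> \<le> (\<Sum>k\<le>n. real (Suc k) * ?r ^ k)"
      using r f by (intro sum_mono mult_right_mono) auto
    also have "\<dots> \<le> 1 / (1 - ?r)\<^sup>2"
    proof -
      have sums: "(\<lambda>k. real (Suc k) * ?r ^ k) sums (1 / (1 - ?r)\<^sup>2)"
        using r geometric_deriv_sums[of ?r] by simp
      have "(\<Sum>k<Suc n. real (Suc k) * ?r ^ k) \<le> suminf (\<lambda>k. real (Suc k) * ?r ^ k)"
        using r sums by (intro sum_le_suminf) (auto simp: sums_iff)
      then show ?thesis using sums by (simp add: sums_iff lessThan_Suc_atMost del: sum.lessThan_Suc)
    qed
    finally show ?thesis .
  qed
  have "(\<Sum>y\<in>L n. \<Sum>y'\<in>L n. f (card (anc y \<inter> anc y')) * (1 / p) ^ card (anc y \<inter> anc y'))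
      \<le> (\<Sum>y\<in>L n. ?N * (\<Sum>k\<le>n. q ^ k * (f k * (1 / p) ^ k)))"
    using p f(1) rec by (intro sum_mono sum_common_le) auto
  also have "\<dots> = ?N * (?N * (\<Sum>k\<le>n. q ^ k * (f k * (1 / p) ^ k)))" by simp
  also have "\<dots> \<le> ?N * (?N * (1 / (1 - ?r)\<^sup>2))"
    using gs by (intro mult_left_mono) auto
  finally have le: "(\<Sum>y\<in>L n. \<Sum>y'\<in>L n. f (card (anc y \<inter> anc y')) * (1 / p) ^ card (anc y \<inter> anc y')) / ?N\<^sup>2
      \<le> 1 / (1 - ?r)\<^sup>2"
    using N by (simp add: divide_le_eq power2_eq_square mult_ac)
  have "(\<Sum>y\<in>L n. \<Sum>y'\<in>L n. f (card (anc y \<inter> anc y')) * ((p ^ n)\<^sup>2 * (1 / p) ^ card (anc y \<inter> anc y'))) =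
      (p ^ n)\<^sup>2 * (\<Sum>y\<in>L n. \<Sum>y'\<in>L n. f (card (anc y \<inter> anc y')) * (1 / p) ^ card (anc y \<inter> anc y'))"
    by (simp add: sum_distrib_left mult_ac)
  then show ?thesis using le p by (simp add: power_mult_distrib)
qed

text \<open>
  With probability bounded below, uniformly over the good levels \<open>n\<close>, the flow has strength more than
  one half and bounded energy. Then the root is controlled by the energy of test functions supported
  below level \<open>n\<close>.
\<close>

lemma prob_energy_controls_ge:
  assumes p: "0 < p" "p \<le> 1" and r: "0 \<le> q / p" "q / p < 1"
    and rec: "\<And>k. k \<le> n \<Longrightarrow> real (card (L (n - k))) \<le> real (card (L n)) * q ^ k"
    and N: "0 < card (L n)"
  defines "B \<equiv> 1 / (1 - q / p)\<^sup>2"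
  assumes Y: "Y \<in> sets (bond_percolation E p)"
    "\<And>\<omega>. \<lbrakk>\<omega> \<in> space (bond_percolation E p);
       \<And>F. \<lbrakk>finite F; F \<subseteq> V; \<forall>y\<in>F. lev y < n\<rbrakk> \<Longrightarrow> energy_controls (64 * B\<^sup>2) V (open_edges E \<omega>) root F\<rbrakk>
      \<Longrightarrow> \<omega> \<in> Y"
  shows "1 / (8 * B) \<le> measure (bond_percolation E p) Y"
proof -
  let ?M = "bond_percolation E p" and ?c = "real (card (L n)) * p ^ n"
  interpret prob_space ?M by (rule prob_space_bond)
  have B: "0 < B" unfolding B_def using r by (intro divide_pos_pos zero_less_power) auto
  have hb: "has_bochner_integral ?M (\<lambda>\<omega>. c * (path_open \<omega> y * path_open \<omega> y'))
      (c * ((p ^ n)\<^sup>2 * (1 / p) ^ card (anc y \<inter> anc y')))" if "y \<in> L n" "y' \<in> L n" for c y y'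
    using expectation_path_pair[OF p that] by (intro has_bochner_integral_mult_right) auto
  have hb2: "has_bochner_integral ?M (\<lambda>\<omega>. (\<Sum>y\<in>L n. \<Sum>y'\<in>L n. f (card (anc y \<inter> anc y')) * (path_open \<omega> y * path_open \<omega> y')) / ?c\<^sup>2)
     ((\<Sum>y\<in>L n. \<Sum>y'\<in>L n. f (card (anc y \<inter> anc y')) * ((p ^ n)\<^sup>2 * (1 / p) ^ card (anc y \<inter> anc y'))) / ?c\<^sup>2)"
    for f :: "nat \<Rightarrow> real"
    using hb by (intro has_bochner_integral_divide_zero has_bochner_integral_sum) auto
  have single: "has_bochner_integral ?M (\<lambda>\<omega>. path_open \<omega> y) (p ^ n)" if y: "y \<in> L n" for y
  proof -
    have "path_open \<omega> y * path_open \<omega> y = path_open \<omega> y" for \<omega>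
      by (simp only: path_open_def of_bool_conj[symmetric] conj_absorb)
    moreover have "(p ^ n)\<^sup>2 * (1 / p) ^ card (anc y \<inter> anc y) = p ^ n"
      using card_anc[of y] y p by (simp add: L_def power_divide power2_eq_square)
    ultimately show ?thesis using expectation_path_pair[OF p y y] by (simp only:)
  qed
  have Z: "has_bochner_integral ?M (flow_strength n p) 1"
  proof -
    have "has_bochner_integral ?M (\<lambda>\<omega>. (\<Sum>y\<in>L n. path_open \<omega> y) / ?c) ((\<Sum>y\<in>L n. p ^ n) / ?c)"
      using single by (intro has_bochner_integral_divide_zero has_bochner_integral_sum) auto
    then show ?thesis using N p by (simp add: flow_strength_def[abs_def])
  qed
  have Z2: "(\<lambda>\<omega>. (flow_strength n p \<omega>)\<^sup>2) =
      (\<lambda>\<omega>. (\<Sum>y\<in>L n. \<Sum>y'\<in>L n. 1 * (path_open \<omega> y * path_open \<omega> y')) / ?c\<^sup>2)"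
    unfolding flow_strength_def power_divide by (simp add: power2_eq_square sum_product)
  have "1 / (8 * B) \<le> prob Y"
  proof (rule second_moment_lower_bound[where Z="flow_strength n p" and Q="flow_energy n p" and B=B])
    show "integrable ?M (flow_strength n p)" "expectation (flow_strength n p) = 1"
      using Z by (auto simp: has_bochner_integral_iff)
    show "integrable ?M (\<lambda>\<omega>. (flow_strength n p \<omega>)\<^sup>2)"
      unfolding Z2 using hb2[of "\<lambda>_. 1"] by (auto simp: has_bochner_integral_iff)
    show "expectation (\<lambda>\<omega>. (flow_strength n p \<omega>)\<^sup>2) \<le> B"
      unfolding Z2 B_def has_bochner_integral_integral_eq[OF hb2[of "\<lambda>_. 1"]]
      by (rule sum_pairs_le[OF p(1) r rec N, where f="\<lambda>_. 1"]) auto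
    show "integrable ?M (flow_energy n p)"
      unfolding flow_energy_eq[abs_def] using hb2[of real] by (auto simp: has_bochner_integral_iff)
    show "expectation (flow_energy n p) \<le> B"
      unfolding flow_energy_eq[abs_def] B_def has_bochner_integral_integral_eq[OF hb2[of real]]
      by (rule sum_pairs_le[OF p(1) r rec N, where f=real]) auto
    show "0 \<le> flow_energy n p \<omega>" for \<omega> unfolding flow_energy_def by (intro sum_nonneg) simp
    fix \<omega> assume \<omega>: "\<omega> \<in> space ?M" "1 / 2 < flow_strength n p \<omega>" "flow_energy n p \<omega> \<le> 16 * B * B"
    show "\<omega> \<in> Y"
    proof (rule Y(2)[OF \<omega>(1)])
      fix F assume F: "finite F" "F \<subseteq> V" "\<forall>y\<in>F. lev y < n"
      show "energy_controls (64 * B\<^sup>2) V (open_edges E \<omega>) root F"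
        unfolding energy_controls_def
      proof (intro allI impI)
        fix g :: "'a \<Rightarrow> real" assume g: "\<forall>y. y \<notin> F \<longrightarrow> g y = 0"
        let ?D = "dirichlet V (open_edges E \<omega>) F g"
        have D: "0 \<le> ?D" by (auto simp: dirichlet_def intro!: sum_nonneg)
        have "1 / 4 \<le> (flow_strength n p \<omega>)\<^sup>2"
          using power_mono[of "1 / 2" "flow_strength n p \<omega>" 2] \<omega>(2) by (simp add: power2_eq_square)
        then have "1 / 4 * (g root)\<^sup>2 \<le> (flow_strength n p \<omega>)\<^sup>2 * (g root)\<^sup>2"
          by (rule mult_right_mono) simp
        also have "\<dots> \<le> flow_energy n p \<omega> * ?D"
          using flow_bound[of F n g p \<omega>] F g by (simp add: power_mult_distrib)
        also have "\<dots> \<le> 16 * B * B * ?D" using \<omega>(3) D by (rule mult_right_mono)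
        finally show "(g root)\<^sup>2 \<le> 64 * B\<^sup>2 * ?D" by (simp add: power2_eq_square)
      qed
    qed
  qed (use B Y in auto)
  then show ?thesis .
qed

end

section \<open>Capacious vertices in Cayley graphs\<close>

lemma thicken_add: "thicken V E (m + n) A = thicken V E m (thicken V E n A)"
  by (induction m) auto

lemma thicken_mono_set: "A \<subseteq> B \<Longrightarrow> thicken V E n A \<subseteq> thicken V E n B"
  by (induction n) auto

lemma thicken_sym:
  assumes "x \<in> V" "y \<in> V" "y \<in> thicken V E n {x}"
  shows "x \<in> thicken V E n {y}"
proof -
  have "(y, x) \<in> adj V E ^^ k" if "(x, y) \<in> adj V E ^^ k" for k x y
    using that
  proof (induction k arbitrary: y)
    case (Suc k)
    then obtain z where "(x, z) \<in> adj V E ^^ k" "(z, y) \<in> adj V E" by auto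
    then have "(z, x) \<in> adj V E ^^ k" "(y, z) \<in> adj V E"
      using Suc.IH by (auto simp: adj_def nbrs_def insert_commute)
    then show ?case by (rule relpow_Suc_I2[rotated])
  qed simp
  with assms show ?thesis by (auto simp: thicken_relpow)
qed

context cayley_graph
begin

definition gdist :: "'a \<Rightarrow> 'a \<Rightarrow> nat" where
  "gdist x y = (LEAST n. y \<in> thicken V E n {x})"

lemma gdist_le_iff:
  assumes "x \<in> V" "y \<in> V"
  shows "gdist x y \<le> n \<longleftrightarrow> y \<in> thicken V E n {x}"
proof
  obtain m where "y \<in> thicken V E m {x}" using UN_thicken[OF assms(1)] assms(2) by blast
  then have "y \<in> thicken V E (gdist x y) {x}" unfolding gdist_def by (rule LeastI)
  then show "y \<in> thicken V E n {x}" if "gdist x y \<le> n"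
    by (rule subsetD[OF thicken_mono[OF that]])
qed (auto simp: gdist_def intro: Least_le)

lemma gdist_triangle:
  assumes "x \<in> V" "y \<in> V" "z \<in> V"
  shows "gdist x z \<le> gdist x y + gdist y z"
proof -
  have "y \<in> thicken V E (gdist x y) {x}" using gdist_le_iff[OF assms(1,2)] by blast
  then have "thicken V E (gdist y z) {y} \<subseteq> thicken V E (gdist y z + gdist x y) {x}"
    unfolding thicken_add by (intro thicken_mono_set) auto
  moreover have "z \<in> thicken V E (gdist y z) {y}" using gdist_le_iff[OF assms(2,3)] by blast
  ultimately show ?thesis using assms by (auto simp: gdist_le_iff add.commute)
qed

lemma gdist_edge: "x \<in> V \<Longrightarrow> y \<in> V \<Longrightarrow> {x, y} \<in> E \<Longrightarrow> gdist x y \<le> 1"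
  by (simp add: gdist_le_iff nbrs_def)

lemma gdist_translate:
  assumes "g \<in> V" "x \<in> V" "y \<in> V"
  shows "gdist (g \<otimes> x) (g \<otimes> y) = gdist x y"
proof -
  interpret graph_iso "left_mult g" V E V E by (rule graph_iso_cayley[OF assms(1)])
  have "g \<otimes> y \<in> thicken V E n {g \<otimes> x} \<longleftrightarrow> y \<in> thicken V E n {x}" for n
  proof -
    have "thicken V E n {g \<otimes> x} = left_mult g ` thicken V E n {x}"
      using map_thicken[of "{x}" n] assms by simp
    moreover have "thicken V E n {x} \<subseteq> V" using assms by (intro thicken_subset) auto
    ultimately show ?thesis
      using inj_on_image_mem_iff[OF inj_on_cmult[OF assms(1)] assms(3)] by simp
  qed
  then show ?thesis unfolding gdist_def by simp
qed

definition sphere :: "'a \<Rightarrow> nat \<Rightarrow> 'a set" where "sphere x n = {y \<in> V. gdist x y = n}"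

lemma ball_eq: "x \<in> V \<Longrightarrow> thicken V E n {x} = {y \<in> V. gdist x y \<le> n}"
  using thicken_subset[of "{x}" V E n] by (auto simp: gdist_le_iff)

lemma finite_sphere: "x \<in> V \<Longrightarrow> finite (sphere x n)"
  by (rule finite_subset[OF _ finite_ball[of x n]]) (auto simp: ball_eq sphere_def)

lemma card_ball_eq: "x \<in> V \<Longrightarrow> card (thicken V E n {x}) = (\<Sum>j\<le>n. card (sphere x j))"
proof -
  assume x: "x \<in> V"
  have "thicken V E n {x} = (\<Union>j\<in>{..n}. sphere x j)" using x by (auto simp: ball_eq sphere_def)
  also have "card \<dots> = (\<Sum>j\<le>n. card (sphere x j))"
    using finite_sphere[OF x] by (intro card_UN_disjoint) (auto simp: sphere_def)
  finally show ?thesis .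
qed

lemma card_sphere_translate:
  assumes "x \<in> V" "y \<in> V"
  shows "card (sphere x n) = card (sphere y n)"
proof -
  let ?g = "y \<otimes> inv x"
  have g: "?g \<in> V" "?g \<otimes> x = y" using assms by (auto simp: m_assoc)
  have "left_mult ?g ` sphere x n = sphere y n"
  proof (intro equalityI subsetI)
    fix z assume "z \<in> left_mult ?g ` sphere x n"
    then obtain w where w: "z = ?g \<otimes> w" "w \<in> V" "gdist x w = n" by (auto simp: sphere_def)
    then show "z \<in> sphere y n" using gdist_translate[OF g(1) assms(1) w(2)] g w by (simp add: sphere_def)
  next
    fix z assume z: "z \<in> sphere y n"
    then have "z \<in> left_mult ?g ` V" using surj_const_mult[OF g(1)] by (simp add: sphere_def)
    then obtain w where w: "z = ?g \<otimes> w" "w \<in> V" by blast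
    then have "w \<in> sphere x n" using gdist_translate[OF g(1) assms(1) w(2)] g z by (simp add: sphere_def)
    with w show "z \<in> left_mult ?g ` sphere x n" by blast
  qed
  moreover have "inj_on (left_mult ?g) (sphere x n)"
    by (rule inj_on_subset[OF inj_on_cmult[OF g(1)]]) (auto simp: sphere_def)
  ultimately show ?thesis by (metis card_image)
qed

definition parent :: "'a \<Rightarrow> 'a \<Rightarrow> 'a" where
  "parent x y = (SOME z. z \<in> V \<and> gdist x z = gdist x y - 1 \<and> {y, z} \<in> E)"

lemma parent_step:
  assumes x: "x \<in> V" and y: "y \<in> V" "0 < gdist x y"
  shows "parent x y \<in> V \<and> gdist x (parent x y) = gdist x y - 1 \<and> {y, parent x y} \<in> E"
  unfolding parent_def
proof (rule someI_ex)
  obtain m where m: "gdist x y = Suc m" using y(2) by (cases "gdist x y") auto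
  have "y \<in> thicken V E (Suc m) {x}" "y \<notin> thicken V E m {x}"
    using gdist_le_iff[OF x y(1)] m by (metis order_refl, metis Suc_n_not_le_n)
  then obtain z where z: "z \<in> thicken V E m {x}" "y \<in> nbrs V E z" by auto
  have zV: "z \<in> V" using z(1) thicken_subset[of "{x}" V E m] x by auto
  have e: "{z, y} \<in> E" using z by (simp add: nbrs_def)
  have "gdist x z \<le> m" using gdist_le_iff[OF x zV] z by simp
  moreover have "Suc m \<le> gdist x z + 1"
    using gdist_triangle[OF x zV y(1)] gdist_edge[OF zV y(1) e] m by simp
  ultimately show "\<exists>z. z \<in> V \<and> gdist x z = gdist x y - 1 \<and> {y, z} \<in> E"
    using zV e m by (intro exI[of _ z]) (auto simp: insert_commute)
qed

lemma gdist_self: "x \<in> V \<Longrightarrow> gdist x x = 0"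
  using gdist_le_iff[of x x 0] by simp

text \<open>
  Any choice of geodesic parents gives a subperiodic tree, because a descendant in level \<open>n\<close> of a
  vertex in level \<open>k\<close> is at distance exactly \<open>n - k\<close> from it, and all spheres of the same radius have
  the same size.
\<close>

lemma geodesic_spanning_tree:
  assumes x: "x \<in> V"
  shows "levelled_tree V E x (gdist x) (parent x)"
proof
  show "y = x" if "y \<in> V" "gdist x y = 0" for y
    using gdist_le_iff[OF x that(1), of 0] that(2) by simp
  show "x \<in> V" by (rule x)
  show "gdist x x = 0" by (rule gdist_self[OF x])
  show "finite {y \<in> V. gdist x y = n}" for n using finite_sphere[OF x] by (simp add: sphere_def)
  show "finite (nbrs V E y)" for y by (rule finite_nbrs)
  show "parent x y \<in> V" "gdist x (parent x y) = gdist x y - 1" "{y, parent x y} \<in> E"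
    if "y \<in> V" "0 < gdist x y" for y using parent_step[OF x that] by auto
  fix n k z assume z: "z \<in> V" "gdist x z = k" "k \<le> n"
  have up: "(parent x ^^ i) y \<in> V \<and> gdist ((parent x ^^ i) y) y \<le> i"
    if "y \<in> V" "i \<le> gdist x y" for y i
    using that(2)
  proof (induction i)
    case 0
    then show ?case using that gdist_self by simp
  next
    case (Suc i)
    let ?w = "(parent x ^^ i) y"
    have w: "?w \<in> V" "gdist ?w y \<le> i" using Suc by auto
    have "0 < gdist x ?w" using gdist_triangle[OF x w(1) that(1)] w Suc.prems by simp
    from parent_step[OF x w(1) this] have p: "parent x ?w \<in> V" "{parent x ?w, ?w} \<in> E"
      by (auto simp: insert_commute)
    show ?case using gdist_triangle[OF p(1) w(1) that(1)] gdist_edge[OF p(1) w(1) p(2)] w p by simp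
  qed
  have "{y \<in> V. gdist x y = n \<and> (parent x ^^ (n - k)) y = z} \<subseteq> sphere z (n - k)"
  proof
    fix y assume y: "y \<in> {y \<in> V. gdist x y = n \<and> (parent x ^^ (n - k)) y = z}"
    then have "gdist z y \<le> n - k" using up[of y "n - k"] by auto
    moreover have "n \<le> k + gdist z y" using gdist_triangle[OF x z(1), of y] y z by auto
    ultimately show "y \<in> sphere z (n - k)" using y by (auto simp: sphere_def)
  qed
  then have "card {y \<in> V. gdist x y = n \<and> (parent x ^^ (n - k)) y = z} \<le> card (sphere z (n - k))"
    by (rule card_mono[OF finite_sphere[OF z(1)]])
  also have "\<dots> = card (sphere x (n - k))" by (rule card_sphere_translate[OF z(1) x])
  finally show "card {y \<in> V. gdist x y = n \<and> (parent x ^^ (n - k)) y = z} \<le> card {y \<in> V. gdist x y = n - k}"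
    by (simp add: sphere_def)
qed

text \<open>
  The part of the capacity condition that concerns test functions supported in a ball. It depends on
  finitely many edges and decreases to the full condition as the radius grows.
\<close>

definition near_capacious :: "real \<Rightarrow> nat \<Rightarrow> 'a \<Rightarrow> ('a set \<Rightarrow> bool) \<Rightarrow> bool" where
  "near_capacious M n x \<omega> \<longleftrightarrow>
    (\<forall>F. F \<subseteq> thicken V E n {x} \<longrightarrow> energy_controls M V (open_edges E \<omega>) x F)"

abbreviation capacious_at :: "real \<Rightarrow> 'a \<Rightarrow> ('a set \<Rightarrow> bool) \<Rightarrow> bool" where
  "capacious_at M x \<omega> \<equiv> capacious M V (open_edges E \<omega>) x"

lemma near_capacious_determined:
  "determined_by (touching (thicken V E n {x})) (near_capacious M n x)"
  unfolding determined_by_def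
proof (intro allI impI)
  fix \<omega> \<omega>' :: "'a set \<Rightarrow> bool" assume eq: "\<forall>e\<in>touching (thicken V E n {x}). \<omega> e = \<omega>' e"
  have nb: "nbrs V (open_edges E \<omega>) y = nbrs V (open_edges E \<omega>') y" if "y \<in> thicken V E n {x}" for y
    using eq that unfolding nbrs_def open_edges_def touching_def by auto
  have "dirichlet V (open_edges E \<omega>) F g = dirichlet V (open_edges E \<omega>') F g"
    if "F \<subseteq> thicken V E n {x}" for F g
    unfolding dirichlet_def using nb that by (intro sum.cong) auto
  then show "near_capacious M n x \<omega> = near_capacious M n x \<omega>'"
    unfolding near_capacious_def energy_controls_def by auto
qed

lemma finite_touching_ball: "x \<in> V \<Longrightarrow> finite (touching (thicken V E n {x}))"
  by (intro finite_touching finite_ball)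

lemma touching_sub: "touching F \<subseteq> E" by (auto simp: touching_def)

lemma near_capacious_sets:
  "x \<in> V \<Longrightarrow> {\<omega> \<in> space (bond_percolation E p). near_capacious M n x \<omega>} \<in> sets (bond_percolation E p)"
  by (rule measurable_determined_by_finite[OF finite_touching_ball touching_sub near_capacious_determined])

lemma near_capacious_antimono: "m \<le> n \<Longrightarrow> near_capacious M n x \<omega> \<Longrightarrow> near_capacious M m x \<omega>"
  unfolding near_capacious_def using thicken_mono[of m n V E "{x}"] by blast

lemma finite_subset_ball:
  assumes x: "x \<in> V" and F: "finite F" "F \<subseteq> V"
  shows "\<exists>n. F \<subseteq> thicken V E n {x}"
proof -
  have "F \<subseteq> thicken V E (\<Sum>y\<in>F. gdist x y) {x}"
    using F member_le_sum[of _ F "gdist x"] by (auto simp: ball_eq[OF x])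
  then show ?thesis by blast
qed

lemma capacious_iff_near:
  assumes x: "x \<in> V"
  shows "capacious_at M x \<omega> \<longleftrightarrow> (\<forall>n. near_capacious M n x \<omega>)"
proof (intro iffI allI)
  fix n assume "capacious_at M x \<omega>"
  moreover have "thicken V E n {x} \<subseteq> V" using thicken_subset[of "{x}" V E n] x by auto
  ultimately show "near_capacious M n x \<omega>"
    unfolding near_capacious_def capacious_def using finite_ball[OF x, of n] by (meson finite_subset order_trans)
next
  assume n: "\<forall>n. near_capacious M n x \<omega>"
  show "capacious_at M x \<omega>"
    unfolding capacious_def
  proof (intro allI impI)
    fix F assume "finite F \<and> F \<subseteq> V"
    then obtain n where "F \<subseteq> thicken V E n {x}" using finite_subset_ball[OF x, of F] by blast
    with n show "energy_controls M V (open_edges E \<omega>) x F" unfolding near_capacious_def by blast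
  qed
qed

lemma capacious_eq_INT:
  "x \<in> V \<Longrightarrow> {\<omega> \<in> space (bond_percolation E p). capacious_at M x \<omega>} =
    (\<Inter>n. {\<omega> \<in> space (bond_percolation E p). near_capacious M n x \<omega>})"
  by (auto simp: capacious_iff_near)

lemma capacious_sets:
  "x \<in> V \<Longrightarrow> {\<omega> \<in> space (bond_percolation E p). capacious_at M x \<omega>} \<in> sets (bond_percolation E p)"
  unfolding capacious_eq_INT using near_capacious_sets by (intro sets.countable_INT) auto

lemma capacious_prob_lim:
  assumes x: "x \<in> V"
  shows "(\<lambda>n. measure (bond_percolation E p) {\<omega> \<in> space (bond_percolation E p). near_capacious M n x \<omega>})
    \<longlonglongrightarrow> measure (bond_percolation E p) {\<omega> \<in> space (bond_percolation E p). capacious_at M x \<omega>}"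
proof -
  interpret prob_space "bond_percolation E p" by (rule prob_space_bond)
  show ?thesis
    unfolding capacious_eq_INT[OF x] using near_capacious_sets[OF x] near_capacious_antimono
    by (intro finite_Lim_measure_decseq) (auto simp: decseq_def)
qed

lemma capacious_shift:
  assumes "g \<in> V" "x \<in> V"
  shows "capacious_at M x (shift_config g \<omega>) \<longleftrightarrow> capacious_at M (g \<otimes> x) \<omega>"
  using graph_iso.capacious_iff[OF graph_iso_shift[OF assms(1)] assms(2)] by blast

lemma near_capacious_shift:
  assumes "g \<in> V" "x \<in> V"
  shows "near_capacious M n x (shift_config g \<omega>) \<Longrightarrow> near_capacious M n (g \<otimes> x) \<omega>"
proof -
  assume nc: "near_capacious M n x (shift_config g \<omega>)"
  interpret i: graph_iso "left_mult g" V E V E by (rule graph_iso_cayley[OF assms(1)])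
  interpret s: graph_iso "left_mult g" V "open_edges E (shift_config g \<omega>)" V "open_edges E \<omega>"
    by (rule graph_iso_shift[OF assms(1)])
  have im: "thicken V E n {g \<otimes> x} = left_mult g ` thicken V E n {x}"
    using i.map_thicken[of "{x}" n] assms by simp
  have sub: "thicken V E n {x} \<subseteq> V" using assms by (intro thicken_subset) auto
  show "near_capacious M n (g \<otimes> x) \<omega>"
    unfolding near_capacious_def
  proof (intro allI impI)
    fix F assume "F \<subseteq> thicken V E n {g \<otimes> x}"
    then obtain F' where F': "F' \<subseteq> thicken V E n {x}" "F = left_mult g ` F'"
      unfolding im by (auto simp: subset_image_iff)
    then have "energy_controls M V (open_edges E (shift_config g \<omega>)) x F'"
      using nc by (simp add: near_capacious_def)
    then show "energy_controls M V (open_edges E \<omega>) (g \<otimes> x) F"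
      unfolding F'(2) using F' sub assms by (intro s.map_energy_controls) auto
  qed
qed

lemma prob_shift:
  assumes g: "g \<in> V" and A: "{\<omega> \<in> space (bond_percolation E p). A \<omega>} \<in> sets (bond_percolation E p)"
  shows "measure (bond_percolation E p) {\<omega> \<in> space (bond_percolation E p). A (shift_config g \<omega>)} =
    measure (bond_percolation E p) {\<omega> \<in> space (bond_percolation E p). A \<omega>}"
proof -
  let ?M = "bond_percolation E p"
  note sh = distr_shift_config[OF g, of p]
  have "measure ?M {\<omega> \<in> space ?M. A \<omega>} = measure (distr ?M ?M (shift_config g)) {\<omega> \<in> space ?M. A \<omega>}"
    by (simp add: sh(1))
  also have "\<dots> = measure ?M (shift_config g -` {\<omega> \<in> space ?M. A \<omega>} \<inter> space ?M)"
    by (rule measure_distr[OF sh(2) A])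
  also have "shift_config g -` {\<omega> \<in> space ?M. A \<omega>} \<inter> space ?M = {\<omega> \<in> space ?M. A (shift_config g \<omega>)}"
    using measurable_space[OF sh(2)] by auto
  finally show ?thesis ..
qed

lemma prob_capacious_const:
  assumes "x \<in> V" "y \<in> V"
  shows "measure (bond_percolation E p) {\<omega> \<in> space (bond_percolation E p). capacious_at M x \<omega>} =
    measure (bond_percolation E p) {\<omega> \<in> space (bond_percolation E p). capacious_at M y \<omega>}"
proof -
  have g: "x \<otimes> inv y \<in> V" "(x \<otimes> inv y) \<otimes> y = x" using assms by (auto simp: m_assoc)
  show ?thesis
    using prob_shift[OF g(1) capacious_sets[OF assms(2)], of p M] capacious_shift[OF g(1) assms(2), of M]
    by (simp add: g(2))
qed

lemma prob_near_capacious_le: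
  assumes "x \<in> V" "y \<in> V"
  shows "measure (bond_percolation E p) {\<omega> \<in> space (bond_percolation E p). near_capacious M n y \<omega>} \<le>
    measure (bond_percolation E p) {\<omega> \<in> space (bond_percolation E p). near_capacious M n x \<omega>}"
proof -
  interpret prob_space "bond_percolation E p" by (rule prob_space_bond)
  have g: "x \<otimes> inv y \<in> V" "(x \<otimes> inv y) \<otimes> y = x" using assms by (auto simp: m_assoc)
  show ?thesis
    unfolding prob_shift[OF g(1) near_capacious_sets[OF assms(2)], of p M n, symmetric]
    using near_capacious_shift[OF g(1) assms(2), of M n] near_capacious_sets[OF assms(1), of p M n]
    by (intro finite_measure_mono) (auto simp: g(2))
qed

text \<open>
  The exponent \<open>\<rho>\<close> is chosen strictly between \<open>1 / p\<close> and \<open>\<zeta>\<close>: below \<open>\<zeta>\<close> so that there are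
  infinitely many good radii, above \<open>1 / p\<close> so that the moment bounds converge. Since the conditions
  decrease with the radius, infinitely many radii are enough.
\<close>

lemma capacious_pos_prob:
  assumes x: "x \<in> V" and growth: "\<And>n. \<zeta> ^ n \<le> real (card (thicken V E n {x}))"
    and z: "1 < \<zeta>" and p: "1 / \<zeta> < p" "p \<le> 1"
  shows "\<exists>M\<ge>0. \<exists>c>0. c \<le> measure (bond_percolation E p)
    {\<omega> \<in> space (bond_percolation E p). capacious_at M x \<omega>}"
proof -
  let ?P = "bond_percolation E p"
  interpret prob_space ?P by (rule prob_space_bond)
  interpret T: levelled_tree V E x "gdist x" "parent x" by (rule geodesic_spanning_tree[OF x])
  have L: "T.L n = sphere x n" for n by (simp add: T.L_def sphere_def)
  have p0: "0 < p" using p z by (meson divide_pos_pos less_trans zero_less_one)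
  have "max 1 (1 / p) < \<zeta>" using p z p0 by (simp add: divide_less_eq mult.commute)
  then obtain \<rho> where \<rho>: "max 1 (1 / p) < \<rho>" "\<rho> < \<zeta>" using dense by blast
  then have \<rho>1: "1 < \<rho>" "1 < \<rho> * p" using p0 by (auto simp: divide_less_eq)
  let ?q = "1 / \<rho>" define B where "B = 1 / (1 - ?q / p)\<^sup>2"
  have r: "0 \<le> ?q / p" "?q / p < 1" using \<rho>1 p0 by (auto simp: divide_less_eq)
  have B: "0 < B" unfolding B_def using r by (intro divide_pos_pos zero_less_power) auto
  let ?Y = "\<lambda>n. {\<omega> \<in> space ?P. near_capacious (64 * B\<^sup>2) n x \<omega>}"
  have near: "1 / (8 * B) \<le> prob (?Y n)" for n
  proof -
    have "\<zeta> ^ n \<le> (\<Sum>j\<le>n. real (card (sphere x j)))" for n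
      using growth[of n] card_ball_eq[OF x, of n] by simp
    \<comment> \<open>a record beyond radius n: the tree flow to that level handles all test functions in the ball\<close>
    from exists_growth_record[OF this \<rho>1(1) \<rho>(2), of "Suc n"]
    obtain m where m: "Suc n \<le> m" "0 < card (sphere x m)"
        "\<And>k. k \<le> m \<Longrightarrow> real (card (sphere x (m - k))) \<le> real (card (sphere x m)) * ?q ^ k"
      by blast
    show "1 / (8 * B) \<le> prob (?Y n)"
      unfolding B_def
    proof (rule T.prob_energy_controls_ge[where q="?q" and n=m])
      show "{\<omega> \<in> space ?P. near_capacious (64 * (1 / (1 - ?q / p)\<^sup>2)\<^sup>2) n x \<omega>} \<in> events"
        by (rule near_capacious_sets[OF x])
      fix \<omega> assume \<omega>: "\<omega> \<in> space ?P"
        "\<And>F. finite F \<Longrightarrow> F \<subseteq> V \<Longrightarrow> \<forall>y\<in>F. gdist x y < m \<Longrightarrow>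
          energy_controls (64 * (1 / (1 - ?q / p)\<^sup>2)\<^sup>2) V (open_edges E \<omega>) x F"
      have "near_capacious (64 * (1 / (1 - ?q / p)\<^sup>2)\<^sup>2) n x \<omega>"
        unfolding near_capacious_def
      proof (intro allI impI)
        fix F assume F: "F \<subseteq> thicken V E n {x}"
        then have "finite F" by (rule finite_subset[OF _ finite_ball[OF x]])
        then show "energy_controls (64 * (1 / (1 - ?q / p)\<^sup>2)\<^sup>2) V (open_edges E \<omega>) x F"
          using F m(1) by (intro \<omega>(2)) (auto simp: ball_eq[OF x])
      qed
      with \<omega>(1) show "\<omega> \<in> {\<omega> \<in> space ?P. near_capacious (64 * (1 / (1 - ?q / p)\<^sup>2)\<^sup>2) n x \<omega>}" by simp
    qed (use p0 p r m L in auto)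
  qed
  have "1 / (8 * B) \<le> prob {\<omega> \<in> space ?P. capacious_at (64 * B\<^sup>2) x \<omega>}"
    by (rule LIMSEQ_le_const[OF capacious_prob_lim[OF x]]) (use near in blast)
  moreover have "0 < 1 / (8 * B)" using B by simp
  moreover have "0 \<le> 64 * B\<^sup>2" by simp
  ultimately show ?thesis by blast
qed

lemma exists_separated_points:
  assumes "infinite V"
  shows "\<exists>X. X \<subseteq> V \<and> finite X \<and> card X = N \<and>
    (\<forall>x\<in>X. \<forall>y\<in>X. x \<noteq> y \<longrightarrow> touching (thicken V E n {x}) \<inter> touching (thicken V E n {y}) = {})"
proof (induction N)
  case 0
  show ?case by (rule exI[of _ "{}"]) simp
next
  case (Suc N)
  then obtain X where X: "X \<subseteq> V" "finite X" "card X = N"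
    "\<forall>x\<in>X. \<forall>y\<in>X. x \<noteq> y \<longrightarrow> touching (thicken V E n {x}) \<inter> touching (thicken V E n {y}) = {}" by blast
  \<comment> \<open>an edge touching two balls of radius n would put their centres at distance at most 2 n + 1\<close>
  let ?W = "\<Union>x\<in>X. thicken V E (2 * n + 1) {x}"
  have "finite ?W" using X by (intro finite_UN_I finite_ball) auto
  then obtain z where z: "z \<in> V" "z \<notin> ?W" using assms by (meson finite_subset subsetI)
  have far: "2 * n + 1 < gdist x z" if "x \<in> X" for x
    using z that X(1) gdist_le_iff[of x z "2 * n + 1"] by force
  have disj: "touching (thicken V E n {x}) \<inter> touching (thicken V E n {z}) = {}" if x: "x \<in> X" for x
  proof (rule ccontr)
    assume "touching (thicken V E n {x}) \<inter> touching (thicken V E n {z}) \<noteq> {}"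
    then obtain e u v where e: "e \<in> E" "u \<in> e" "u \<in> thicken V E n {x}" "v \<in> e" "v \<in> thicken V E n {z}"
      by (auto simp: touching_def)
    obtain a b where ab: "e = {a, b}" "a \<in> V" "b \<in> V" "a \<noteq> b" using e(1) by (rule edgeE)
    have xV: "x \<in> V" using x X by auto
    have uv: "u \<in> V" "v \<in> V" using ab e by auto
    have "gdist u v \<le> 1"
    proof (cases "u = v")
      case True then show ?thesis using gdist_self uv by simp
    next
      case False
      then have "{u, v} = e" using ab e by auto
      then show ?thesis using gdist_edge uv e by simp
    qed
    moreover have "gdist x u \<le> n" using gdist_le_iff[OF xV uv(1)] e by simp
    moreover have "gdist v z \<le> n"
      using gdist_le_iff[OF uv(2) z(1)] thicken_sym[OF z(1) uv(2) e(5)] by simp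
    moreover have "gdist x z \<le> gdist x u + (gdist u v + gdist v z)"
      using gdist_triangle[OF xV uv(1) z(1)] gdist_triangle[OF uv z(1)] by simp
    ultimately show False using far[OF x] by simp
  qed
  have "z \<notin> X"
  proof
    assume "z \<in> X"
    then show False using far[of z] gdist_self[OF z(1)] by simp
  qed
  then show ?case
    using X z disj by (intro exI[of _ "insert z X"]) (auto simp: Int_commute)
qed

text \<open>
  Ergodicity by a second moment. The capacity conditions at far away vertices are approximated by
  independent events of nearly the same probability, so the number of capacious vertices among
  \<open>N\<close> separated ones has variance \<open>o(N^2)\<close> and mean of order \<open>N\<close>; it is zero with vanishing probability.
\<close>

lemma AE_exists_capacious:
  assumes inf: "infinite V" and pos: "0 < c" "x0 \<in> V"
    "c \<le> measure (bond_percolation E p) {\<omega> \<in> space (bond_percolation E p). capacious_at M x0 \<omega>}"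
  shows "AE \<omega> in bond_percolation E p. \<exists>x\<in>V. capacious_at M x \<omega>"
proof -
  let ?P = "bond_percolation E p"
  interpret prob_space ?P by (rule prob_space_bond)
  let ?C = "\<lambda>x. {\<omega> \<in> space ?P. capacious_at M x \<omega>}" and ?F = "\<lambda>n x. {\<omega> \<in> space ?P. near_capacious M n x \<omega>}"
  define t where "t = prob (?C x0)"
  have t: "prob (?C x) = t" if "x \<in> V" for x unfolding t_def by (rule prob_capacious_const[OF that pos(2)])
  have t0: "0 < t" using pos by (simp add: t_def)
  define \<eta> where "\<eta> n = prob (?F n x0)" for n
  have \<eta>lim: "\<eta> \<longlonglongrightarrow> t" unfolding \<eta>_def t_def by (rule capacious_prob_lim[OF pos(2)])
  let ?A = "{\<omega> \<in> space ?P. \<forall>x\<in>V. \<not> capacious_at M x \<omega>}"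
  have A: "?A \<in> events"
  proof -
    have "?A = space ?P - (\<Union>x\<in>V. ?C x)" by auto
    also have "\<dots> \<in> events" using capacious_sets countable_V by (intro sets.Diff sets.countable_UN') auto
    finally show ?thesis .
  qed
  have bound: "prob ?A \<le> (1 / real (Suc n) + (\<eta> n)\<^sup>2 - t\<^sup>2) / t\<^sup>2" for n
  proof -
    obtain X where X: "X \<subseteq> V" "finite X" "card X = Suc n"
      "\<forall>x\<in>X. \<forall>y\<in>X. x \<noteq> y \<longrightarrow> touching (thicken V E n {x}) \<inter> touching (thicken V E n {y}) = {}"
      using exists_separated_points[OF inf, of "Suc n" n] by blast
    let ?N = "real (Suc n)"
    have CE: "?C x \<in> events" if "x \<in> X" for x using capacious_sets X that by blast
    have both: "prob (?C x \<inter> ?C y) \<le> (if x = y then 1 else 0) + (\<eta> n)\<^sup>2" if xy: "x \<in> X" "y \<in> X" for x y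
    proof (cases "x = y")
      case True
      have "prob (?C x \<inter> ?C y) \<le> 1" by (rule prob_le_1)
      with True show ?thesis by (smt (verit) zero_le_power2)
    next
      case False
      have V: "x \<in> V" "y \<in> V" using xy X by auto
      have "prob (?C x \<inter> ?C y) \<le> prob {\<omega> \<in> space ?P. near_capacious M n x \<omega> \<and> near_capacious M n y \<omega>}"
        using V by (intro finite_measure_mono sets.sets_Collect_conj near_capacious_sets) (auto simp: capacious_iff_near)
      also have "\<dots> = prob (?F n x) * prob (?F n y)"
      proof (rule prob_indep_determined[where K="touching (thicken V E n {x})"])
        have "touching (thicken V E n {y}) \<subseteq> E - touching (thicken V E n {x})"
          using X(4) xy False touching_sub by blast
        then show "determined_by (E - touching (thicken V E n {x})) (near_capacious M n y)"
          by (rule determined_by_mono[OF near_capacious_determined])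
      qed (use V near_capacious_sets near_capacious_determined touching_sub in auto)
      also have "\<dots> \<le> \<eta> n * \<eta> n"
        unfolding \<eta>_def using prob_near_capacious_le pos(2) V by (intro mult_mono) auto
      finally show ?thesis using False by (simp add: power2_eq_square)
    qed
    let ?S = "\<lambda>\<omega>. \<Sum>x\<in>X. indicat_real (?C x) \<omega>"
    have ind: "has_bochner_integral ?P (indicat_real Y) (prob Y)" if "Y \<in> events" for Y
      using that by (intro has_bochner_integral_real_indicator) (auto simp: emeasure_eq_measure)
    have S1: "has_bochner_integral ?P ?S (\<Sum>x\<in>X. prob (?C x))"
      by (intro has_bochner_integral_sum ind CE)
    have S2: "has_bochner_integral ?P (\<lambda>\<omega>. \<Sum>x\<in>X. \<Sum>y\<in>X. indicat_real (?C x \<inter> ?C y) \<omega>) (\<Sum>x\<in>X. \<Sum>y\<in>X. prob (?C x \<inter> ?C y))"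
      by (intro has_bochner_integral_sum ind sets.Int CE)
    have ES: "(\<Sum>x\<in>X. prob (?C x)) = ?N * t" using t X by (simp add: subset_eq)
    have sq: "(\<Sum>x\<in>X. \<Sum>y\<in>X. indicat_real (?C x \<inter> ?C y) \<omega>) = (?S \<omega>)\<^sup>2" for \<omega>
      unfolding power2_eq_square sum_product by (intro sum.cong refl) (simp add: indicator_inter_arith)
    have "has_bochner_integral ?P (\<lambda>\<omega>. (?S \<omega>)\<^sup>2 - 2 * (?N * t) * ?S \<omega> + (?N * t)\<^sup>2)
        ((\<Sum>x\<in>X. \<Sum>y\<in>X. prob (?C x \<inter> ?C y)) - 2 * (?N * t) * (?N * t) + (?N * t)\<^sup>2)"
      using S2 S1 unfolding sq ES
      by (intro has_bochner_integral_add has_bochner_integral_diff has_bochner_integral_mult_right)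
        (auto simp: has_bochner_integral_iff prob_space)
    then have var: "has_bochner_integral ?P (\<lambda>\<omega>. (?S \<omega> - ?N * t)\<^sup>2) ((\<Sum>x\<in>X. \<Sum>y\<in>X. prob (?C x \<inter> ?C y)) - (?N * t)\<^sup>2)"
      by (simp add: power2_diff power2_eq_square algebra_simps)
    have "(?N * t)\<^sup>2 * prob ?A = (\<integral>\<omega>. (?N * t)\<^sup>2 * indicat_real ?A \<omega> \<partial>?P)" using A by simp
    also have "\<dots> \<le> (\<integral>\<omega>. (?S \<omega> - ?N * t)\<^sup>2 \<partial>?P)"
    proof (rule integral_mono)
      show "integrable ?P (\<lambda>\<omega>. (?N * t)\<^sup>2 * indicat_real ?A \<omega>)"
        using ind[OF A] by (auto simp: has_bochner_integral_iff)
      show "integrable ?P (\<lambda>\<omega>. (?S \<omega> - ?N * t)\<^sup>2)" using var by (simp add: has_bochner_integral_iff)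
      fix \<omega> show "(?N * t)\<^sup>2 * indicat_real ?A \<omega> \<le> (?S \<omega> - ?N * t)\<^sup>2"
      proof (cases "\<omega> \<in> ?A")
        case True
        \<comment> \<open>without capacious vertices the deviation from the mean is the mean itself\<close>
        then have "?S \<omega> = 0" using X(1) by (intro sum.neutral) (auto simp: indicator_def)
        with True show ?thesis by simp
      qed simp
    qed
    also have "\<dots> = (\<Sum>x\<in>X. \<Sum>y\<in>X. prob (?C x \<inter> ?C y)) - (?N * t)\<^sup>2"
      using var by (simp add: has_bochner_integral_iff)
    also have "\<dots> \<le> (\<Sum>x\<in>X. \<Sum>y\<in>X. (if x = y then 1 else 0) + (\<eta> n)\<^sup>2) - (?N * t)\<^sup>2"
      by (intro diff_right_mono sum_mono both)
    also have "(\<Sum>x\<in>X. \<Sum>y\<in>X. (if x = y then 1 else 0) + (\<eta> n)\<^sup>2) = ?N + ?N\<^sup>2 * (\<eta> n)\<^sup>2"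
      using X by (simp add: sum.distrib power2_eq_square distrib_left mult.assoc del: of_nat_Suc)
    finally have fin: "(?N * t)\<^sup>2 * prob ?A \<le> ?N + ?N\<^sup>2 * (\<eta> n)\<^sup>2 - (?N * t)\<^sup>2" .
    have N0: "0 < ?N" by simp
    have "prob ?A * t\<^sup>2 = (?N * t)\<^sup>2 * prob ?A / ?N\<^sup>2" using N0 by (simp add: power_mult_distrib del: of_nat_Suc)
    also have "\<dots> \<le> (?N + ?N\<^sup>2 * (\<eta> n)\<^sup>2 - (?N * t)\<^sup>2) / ?N\<^sup>2" using fin by (rule divide_right_mono) simp
    also have "\<dots> = 1 / ?N + (\<eta> n)\<^sup>2 - t\<^sup>2"
      using N0 by (simp add: field_simps power2_eq_square del: of_nat_Suc)
    finally show ?thesis using t0 by (simp add: pos_le_divide_eq del: of_nat_Suc)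
  qed
  have "(\<lambda>n. (1 / real (Suc n) + (\<eta> n)\<^sup>2 - t\<^sup>2) / t\<^sup>2) \<longlonglongrightarrow> (0 + t\<^sup>2 - t\<^sup>2) / t\<^sup>2"
    using t0 by (intro tendsto_intros \<eta>lim LIMSEQ_inverse_real_of_nat[unfolded inverse_eq_divide]) auto
  then have "prob ?A \<le> (0 + t\<^sup>2 - t\<^sup>2) / t\<^sup>2"
    by (rule LIMSEQ_le_const) (use bound in blast)
  then have "prob ?A = 0" using measure_nonneg[of ?P ?A] by simp
  then have "emeasure ?P ?A = 0" by (simp add: emeasure_eq_measure)
  then show ?thesis using A by (intro AE_I[of ?P _ ?A]) auto
qed

end

section \<open>Mass transport and sprinkling\<close>

lemma pred_Bex_countable:
  assumes "countable I" "\<And>i. i \<in> I \<Longrightarrow> Measurable.pred M (P i)"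
  shows "Measurable.pred M (\<lambda>\<omega>. \<exists>i\<in>I. P i \<omega>)"
proof -
  have "{\<omega> \<in> space M. \<exists>i\<in>I. P i \<omega>} = (\<Union>i\<in>I. {\<omega> \<in> space M. P i \<omega>})" by auto
  also have "\<dots> \<in> sets M" using assms by (intro sets.countable_UN') (auto simp: pred_def)
  finally show ?thesis by (simp add: pred_def)
qed

lemma pred_Ball_countable:
  assumes "countable I" "\<And>i. i \<in> I \<Longrightarrow> Measurable.pred M (P i)"
  shows "Measurable.pred M (\<lambda>\<omega>. \<forall>i\<in>I. P i \<omega>)"
proof -
  have "Measurable.pred M (\<lambda>\<omega>. \<not> (\<exists>i\<in>I. \<not> P i \<omega>))"
    using assms by (intro pred_intros_logic pred_Bex_countable)
  then show ?thesis by simp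
qed

context cayley_graph
begin

abbreviation cluster :: "('a set \<Rightarrow> bool) \<Rightarrow> 'a \<Rightarrow> 'a set" where
  "cluster \<omega> x \<equiv> component_of V (open_edges E \<omega>) x"

definition sprinkle :: "('a set \<Rightarrow> bool) \<Rightarrow> ('a set \<Rightarrow> bool) \<Rightarrow> 'a set \<Rightarrow> bool" where
  "sprinkle a b = (\<lambda>e\<in>E. a e \<or> b e)"

text \<open>
  Distances are taken in the whole Cayley graph, whether or not edges are open: the set measures how
  far a cluster is from capacious vertices that it need not contain.
\<close>

definition vicinity :: "real \<Rightarrow> nat \<Rightarrow> ('a set \<Rightarrow> bool) \<Rightarrow> 'a set" where
  "vicinity M d \<omega> = thicken V E d {x \<in> V. capacious_at M x \<omega>}"

lemma vicinity_sub: "vicinity M d \<omega> \<subseteq> V"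
  unfolding vicinity_def by (rule thicken_subset) auto

text \<open>
  The mass transport principle. Let \<open>x\<close> send unit mass to every \<open>y\<close> with \<open>Q x y\<close>. The expected mass
  sent by the identity is the sum of \<open>P(Q 1 y)\<close>, at most \<open>m\<close>. By invariance it equals the sum of
  \<open>P(Q x 1)\<close>, the expected mass received, which is infinite if the identity receives anything with
  positive probability.
\<close>

lemma mass_transport:
  fixes N :: "'c measure" and Q :: "'a \<Rightarrow> 'a \<Rightarrow> 'c \<Rightarrow> bool"
  assumes N: "prob_space N"
    and meas: "\<And>x y. x \<in> V \<Longrightarrow> y \<in> V \<Longrightarrow> {\<omega> \<in> space N. Q x y \<omega>} \<in> sets N"
    and inv: "\<And>g x y. g \<in> V \<Longrightarrow> x \<in> V \<Longrightarrow> y \<in> V \<Longrightarrow>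
      emeasure N {\<omega> \<in> space N. Q (g \<otimes> x) (g \<otimes> y) \<omega>} = emeasure N {\<omega> \<in> space N. Q x y \<omega>}"
    and out: "\<And>x \<omega>. x \<in> V \<Longrightarrow> finite {y \<in> V. Q x y \<omega>} \<and> card {y \<in> V. Q x y \<omega>} \<le> m"
    and into: "\<And>x y \<omega>. x \<in> V \<Longrightarrow> y \<in> V \<Longrightarrow> Q x y \<omega> \<Longrightarrow> infinite {x' \<in> V. Q x' y \<omega>}"
    and xy: "x \<in> V" "y \<in> V"
  shows "AE \<omega> in N. \<not> Q x y \<omega>"
proof -
  interpret prob_space N by (rule N)
  let ?f = "\<lambda>x y. emeasure N {\<omega> \<in> space N. Q x y \<omega>}"
  let ?i = "\<lambda>x y \<omega>. indicator {\<omega> \<in> space N. Q x y \<omega>} \<omega> :: ennreal"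
  have ind: "(\<lambda>\<omega>. ?i x y \<omega>) \<in> borel_measurable N" if "x \<in> V" "y \<in> V" for x y
    using meas[OF that] by simp
  have cnt: "(\<integral>\<^sup>+x. indicator A x \<partial>count_space V) = emeasure (count_space V) A" if "A \<subseteq> V" for A
    using that by simp
  have "(\<integral>\<^sup>+y. ?f \<one> y \<partial>count_space V) = (\<integral>\<^sup>+y. (\<integral>\<^sup>+\<omega>. ?i \<one> y \<omega> \<partial>N) \<partial>count_space V)"
    using meas by (intro nn_integral_cong) auto
  also have "\<dots> = (\<integral>\<^sup>+\<omega>. (\<integral>\<^sup>+y. ?i \<one> y \<omega> \<partial>count_space V) \<partial>N)"
    using ind by (intro nn_integral_count_space_nn_integral[symmetric] countable_V) auto
  also have "\<dots> \<le> (\<integral>\<^sup>+\<omega>. of_nat m \<partial>N)"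
  proof (rule nn_integral_mono)
    fix \<omega> assume "\<omega> \<in> space N"
    then have "(\<integral>\<^sup>+y. ?i \<one> y \<omega> \<partial>count_space V) = (\<integral>\<^sup>+y. indicator {y \<in> V. Q \<one> y \<omega>} y \<partial>count_space V)"
      by (intro nn_integral_cong) (auto simp: indicator_def)
    also have "\<dots> = of_nat (card {y \<in> V. Q \<one> y \<omega>})"
      using out[of \<one> \<omega>] by (subst cnt) (auto simp: emeasure_count_space)
    also have "\<dots> \<le> of_nat m" using out[of \<one> \<omega>] by simp
    finally show "(\<integral>\<^sup>+y. ?i \<one> y \<omega> \<partial>count_space V) \<le> of_nat m" .
  qed
  also have "\<dots> = of_nat m" by (simp add: emeasure_space_1)
  finally have le: "(\<integral>\<^sup>+y. ?f \<one> y \<partial>count_space V) \<le> of_nat m" .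
  have bij: "bij_betw (\<lambda>x. inv x) V V"
    by (rule bij_betwI[where g="\<lambda>x. inv x"]) auto
  have f_inv: "?f x \<one> = ?f \<one> (inv x)" if "x \<in> V" for x
    using inv[of x \<one> "inv x"] that by simp
  have "(\<integral>\<^sup>+x. ?f x \<one> \<partial>count_space V) = (\<integral>\<^sup>+x. ?f \<one> (inv x) \<partial>count_space V)"
    by (intro nn_integral_cong) (simp add: f_inv)
  also have "\<dots> = (\<integral>\<^sup>+y. ?f \<one> y \<partial>count_space V)" by (rule nn_integral_bij_count_space[OF bij])
  finally have le': "(\<integral>\<^sup>+x. ?f x \<one> \<partial>count_space V) \<le> of_nat m" using le by simp
  have "(\<integral>\<^sup>+x. ?f x \<one> \<partial>count_space V) = (\<integral>\<^sup>+x. (\<integral>\<^sup>+\<omega>. ?i x \<one> \<omega> \<partial>N) \<partial>count_space V)"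
    using meas by (intro nn_integral_cong) auto
  also have "\<dots> = (\<integral>\<^sup>+\<omega>. (\<integral>\<^sup>+x. ?i x \<one> \<omega> \<partial>count_space V) \<partial>N)"
    using ind by (intro nn_integral_count_space_nn_integral[symmetric] countable_V) auto
  finally have fin: "(\<integral>\<^sup>+\<omega>. (\<integral>\<^sup>+x. ?i x \<one> \<omega> \<partial>count_space V) \<partial>N) \<le> of_nat m" using le' by simp
  have zero: "?f z \<one> = 0" if z: "z \<in> V" for z
  proof (rule ccontr)
    assume nz: "?f z \<one> \<noteq> 0"
    have "(\<integral>\<^sup>+\<omega>. \<infinity> * ?i z \<one> \<omega> \<partial>N) \<le> (\<integral>\<^sup>+\<omega>. (\<integral>\<^sup>+x. ?i x \<one> \<omega> \<partial>count_space V) \<partial>N)"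
    proof (rule nn_integral_mono)
      fix \<omega> assume \<omega>: "\<omega> \<in> space N"
      show "\<infinity> * ?i z \<one> \<omega> \<le> (\<integral>\<^sup>+x. ?i x \<one> \<omega> \<partial>count_space V)"
      proof (cases "Q z \<one> \<omega>")
        case True
        have "(\<integral>\<^sup>+x. ?i x \<one> \<omega> \<partial>count_space V) = (\<integral>\<^sup>+x. indicator {x \<in> V. Q x \<one> \<omega>} x \<partial>count_space V)"
          using \<omega> by (intro nn_integral_cong) (auto simp: indicator_def)
        also have "\<dots> = \<infinity>"
          using into[OF z one_closed True] by (subst cnt) (auto simp: emeasure_count_space_infinite)
        finally show ?thesis by simp
      qed simp
    qed
    also have "\<dots> \<le> of_nat m" by (rule fin)
    finally have "\<infinity> * ?f z \<one> \<le> of_nat m"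
      using meas[OF z one_closed] by (simp add: nn_integral_cmult)
    then show False using nz by (simp add: ennreal_mult_eq_top_iff top_unique ennreal_top_mult)
  qed
  have "?f x y = 0"
  proof -
    have "?f x y = ?f (y \<otimes> (inv y \<otimes> x)) (y \<otimes> \<one>)" using xy by (simp add: m_assoc[symmetric])
    also have "\<dots> = ?f (inv y \<otimes> x) \<one>" using xy by (intro inv) auto
    also have "\<dots> = 0" using xy by (intro zero) auto
    finally show ?thesis .
  qed
  then show ?thesis using meas[OF xy] by (intro AE_I[where N="{\<omega> \<in> space N. Q x y \<omega>}"]) auto
qed

lemma pred_edge_open: "Measurable.pred (bond_percolation E p) (\<lambda>\<omega>. e \<in> open_edges E \<omega>)"
proof (cases "e \<in> E")
  case True
  then show ?thesis using edge_event_measurable[OF True, of p] by (simp add: open_edges_def)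
qed (simp add: open_edges_def)

lemma pred_thicken_open:
  assumes x: "x \<in> V"
  shows "Measurable.pred (bond_percolation E p) (\<lambda>\<omega>. y \<in> thicken V (open_edges E \<omega>) n {x})"
proof (induction n arbitrary: y)
  case (Suc n)
  have "(\<lambda>\<omega>. y \<in> thicken V (open_edges E \<omega>) (Suc n) {x}) =
    (\<lambda>\<omega>. y \<in> thicken V (open_edges E \<omega>) n {x} \<or>
      (\<exists>z\<in>V. z \<in> thicken V (open_edges E \<omega>) n {x} \<and> y \<in> V \<and> {z, y} \<in> open_edges E \<omega>))"
    using thicken_subset[of "{x}" V] x by (fastforce simp: nbrs_def)
  also have "Measurable.pred (bond_percolation E p) \<dots>"
    by (intro pred_intros_logic pred_Bex_countable countable_V Suc pred_edge_open) simp_all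
  finally show ?case .
qed simp

lemma pred_cluster:
  assumes x: "x \<in> V"
  shows "Measurable.pred (bond_percolation E p) (\<lambda>\<omega>. y \<in> cluster \<omega> x)"
proof -
  have "(\<lambda>\<omega>. y \<in> cluster \<omega> x) = (\<lambda>\<omega>. \<exists>n. y \<in> thicken V (open_edges E \<omega>) n {x})"
    using x by (simp add: component_of_eq_thicken)
  also have "Measurable.pred (bond_percolation E p) \<dots>"
    by (intro pred_intros_countable pred_thicken_open x)
  finally show ?thesis .
qed

lemma pred_infinite_subset:
  assumes "\<And>y. y \<in> V \<Longrightarrow> Measurable.pred M (\<lambda>\<omega>. y \<in> C \<omega>)" and sub: "\<And>\<omega>. C \<omega> \<subseteq> V"
  shows "Measurable.pred M (\<lambda>\<omega>. infinite (C \<omega>))"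
proof -
  have "infinite (C \<omega>) \<longleftrightarrow> (\<forall>Y\<in>{Y. finite Y \<and> Y \<subseteq> V}. \<exists>y\<in>V. y \<in> C \<omega> \<and> y \<notin> Y)" for \<omega>
  proof
    assume inf: "infinite (C \<omega>)"
    show "\<forall>Y\<in>{Y. finite Y \<and> Y \<subseteq> V}. \<exists>y\<in>V. y \<in> C \<omega> \<and> y \<notin> Y"
    proof
      fix Y assume "Y \<in> {Y. finite Y \<and> Y \<subseteq> V}"
      then have "\<not> C \<omega> \<subseteq> Y" using inf finite_subset by auto
      then show "\<exists>y\<in>V. y \<in> C \<omega> \<and> y \<notin> Y" using sub by blast
    qed
  next
    assume "\<forall>Y\<in>{Y. finite Y \<and> Y \<subseteq> V}. \<exists>y\<in>V. y \<in> C \<omega> \<and> y \<notin> Y"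
    then show "infinite (C \<omega>)" using sub[of \<omega>] by blast
  qed
  then have "(\<lambda>\<omega>. infinite (C \<omega>)) = (\<lambda>\<omega>. \<forall>Y\<in>{Y. finite Y \<and> Y \<subseteq> V}. \<exists>y\<in>V. y \<in> C \<omega> \<and> y \<notin> Y)"
    by (rule ext)
  also have "Measurable.pred M \<dots>"
    by (intro pred_Ball_countable pred_Bex_countable countable_V countable_Collect_finite_subset
        pred_intros_logic assms(1)) simp_all
  finally show ?thesis .
qed

lemma pred_card_subset:
  assumes C: "\<And>y. y \<in> V \<Longrightarrow> Measurable.pred M (\<lambda>\<omega>. y \<in> C \<omega>)" and sub: "\<And>\<omega>. C \<omega> \<subseteq> V"
  shows "Measurable.pred M (\<lambda>\<omega>. finite (C \<omega>) \<and> card (C \<omega>) = m)"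
proof -
  have "(\<lambda>\<omega>. finite (C \<omega>) \<and> card (C \<omega>) = m) =
    (\<lambda>\<omega>. \<exists>Y\<in>{Y. finite Y \<and> Y \<subseteq> V}. card Y = m \<and> (\<forall>y\<in>V. y \<in> C \<omega> \<longleftrightarrow> y \<in> Y))"
  proof
    fix \<omega>
    show "(finite (C \<omega>) \<and> card (C \<omega>) = m) =
      (\<exists>Y\<in>{Y. finite Y \<and> Y \<subseteq> V}. card Y = m \<and> (\<forall>y\<in>V. y \<in> C \<omega> \<longleftrightarrow> y \<in> Y))" (is "?l = ?r")
    proof
      assume ?l then show ?r using sub by (intro bexI[of _ "C \<omega>"]) auto
    next
      assume ?r
      then obtain Y where Y: "finite Y" "Y \<subseteq> V" "card Y = m" "\<forall>y\<in>V. y \<in> C \<omega> \<longleftrightarrow> y \<in> Y" by auto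
      then have "C \<omega> = Y" using sub by blast
      with Y show ?l by simp
    qed
  qed
  also have "Measurable.pred M \<dots>"
    by (intro pred_Ball_countable pred_Bex_countable countable_V countable_Collect_finite_subset
        pred_intros_logic C) simp_all
  finally show ?thesis .
qed

lemma pred_vicinity:
  "Measurable.pred (bond_percolation E p) (\<lambda>\<omega>. y \<in> vicinity M d \<omega>)"
proof (induction d arbitrary: y)
  case 0
  show ?case
  proof (cases "y \<in> V")
    case True
    then show ?thesis using capacious_sets[OF True, of p M] by (simp add: vicinity_def pred_def)
  qed (simp add: vicinity_def)
next
  case (Suc d)
  have "(\<lambda>\<omega>. y \<in> vicinity M (Suc d) \<omega>) =
    (\<lambda>\<omega>. y \<in> vicinity M d \<omega> \<or> (\<exists>z\<in>V. z \<in> vicinity M d \<omega> \<and> y \<in> nbrs V E z))"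
    using vicinity_sub[of M d] by (fastforce simp: vicinity_def)
  also have "Measurable.pred (bond_percolation E p) \<dots>"
    by (intro pred_intros_logic pred_Bex_countable countable_V Suc) simp_all
  finally show ?case .
qed

lemma vicinity_shift:
  assumes g: "g \<in> V"
  shows "vicinity M d \<omega> = left_mult g ` vicinity M d (shift_config g \<omega>)"
proof -
  interpret graph_iso "left_mult g" V E V E by (rule graph_iso_cayley[OF g])
  have "{x \<in> V. capacious_at M x \<omega>} = left_mult g ` {x \<in> V. capacious_at M x (shift_config g \<omega>)}"
  proof (intro equalityI subsetI)
    fix y assume y: "y \<in> {x \<in> V. capacious_at M x \<omega>}"
    then obtain x where x: "x \<in> V" "y = g \<otimes> x" using surj_const_mult[OF g] by blast
    with y show "y \<in> left_mult g ` {x \<in> V. capacious_at M x (shift_config g \<omega>)}"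
      by (auto simp: capacious_shift[OF g])
  qed (auto simp: capacious_shift[OF g] g)
  then show ?thesis unfolding vicinity_def by (simp add: map_thicken)
qed

lemma cluster_shift:
  assumes "g \<in> V" "x \<in> V"
  shows "cluster \<omega> (g \<otimes> x) = left_mult g ` cluster (shift_config g \<omega>) x"
  using graph_iso.map_component[OF graph_iso_shift[OF assms(1)] assms(2)] .

lemma sprinkle_shift:
  "g \<in> V \<Longrightarrow> shift_config g (sprinkle a b) = sprinkle (shift_config g a) (shift_config g b)"
  by (auto simp: shift_config_def sprinkle_def image_edge fun_eq_iff restrict_def)

lemma cluster_sub: "cluster \<omega> x \<subseteq> V"
  by (auto simp: component_of_def)

text \<open>
  If an infinite cluster met the invariant random set in exactly \<open>m > 0\<close> vertices, all vertices of the
  cluster could send unit mass to each of these; nobody would send more than \<open>m\<close>, but some vertices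
  would receive infinite mass.
\<close>

lemma AE_cluster_meets_never_finitely:
  assumes A: "A = bond_percolation E p1" and B: "B = bond_percolation E \<epsilon>"
    and sp: "(\<lambda>z. sprinkle (fst z) (snd z)) \<in> measurable (A \<Otimes>\<^sub>M B) (bond_percolation E p)"
  shows "AE z in A \<Otimes>\<^sub>M B. \<forall>x\<in>V. infinite (cluster (sprinkle (fst z) (snd z)) x) \<longrightarrow>
    (\<forall>d. cluster (sprinkle (fst z) (snd z)) x \<inter> vicinity M d (fst z) = {} \<or>
      infinite (cluster (sprinkle (fst z) (snd z)) x \<inter> vicinity M d (fst z)))"
proof -
  interpret A: prob_space A unfolding A by (rule prob_space_bond)
  interpret B: prob_space B unfolding B by (rule prob_space_bond)
  interpret AB: pair_prob_space A B ..
  let ?N = "A \<Otimes>\<^sub>M B"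
  let ?C = "\<lambda>x z. cluster (sprinkle (fst z) (snd z)) x" and ?W = "\<lambda>d z. vicinity M d (fst z)"
  define Q where "Q d m x y z \<longleftrightarrow> y \<in> ?C x z \<inter> ?W d z \<and> infinite (?C x z) \<and>
      (finite (?C x z \<inter> ?W d z) \<and> card (?C x z \<inter> ?W d z) = m)" for d m x y z
  have C: "Measurable.pred ?N (\<lambda>z. y \<in> ?C x z)" if "x \<in> V" for x y
    by (rule measurable_compose[OF sp pred_cluster[OF that]])
  have W: "Measurable.pred ?N (\<lambda>z. y \<in> ?W d z)" for d y
    by (rule measurable_compose[OF measurable_fst]) (unfold A, rule pred_vicinity)
  have CW: "Measurable.pred ?N (\<lambda>z. y \<in> ?C x z \<inter> ?W d z)" if "x \<in> V" for x y d
    using C[OF that] W by (simp add: pred_intros_logic)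
  have Qm: "Measurable.pred ?N (Q d m x y)" if "x \<in> V" for d m x y
    unfolding Q_def[abs_def]
    by (intro pred_intros_logic(2-3) CW pred_infinite_subset pred_card_subset C that cluster_sub le_infI1)
  have shift: "distr ?N ?N (\<lambda>(a, b). (shift_config g a, shift_config g b)) = ?N"
      "(\<lambda>(a, b). (shift_config g a, shift_config g b)) \<in> measurable ?N ?N" if g: "g \<in> V" for g
  proof -
    note sA = distr_shift_config[OF g, of p1, folded A] and sB = distr_shift_config[OF g, of \<epsilon>, folded B]
    have "sigma_finite_measure (distr B B (shift_config g))" unfolding sB(1) by unfold_locales
    from pair_measure_distr[OF sA(2) sB(2) this]
    show "distr ?N ?N (\<lambda>(a, b). (shift_config g a, shift_config g b)) = ?N" unfolding sA(1) sB(1) by simp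
    show "(\<lambda>(a, b). (shift_config g a, shift_config g b)) \<in> measurable ?N ?N"
      using sA(2) sB(2) by measurable
  qed
  have Qshift: "Q d m (g \<otimes> x) (g \<otimes> y) (a, b) = Q d m x y (shift_config g a, shift_config g b)"
    if g: "g \<in> V" and x: "x \<in> V" and y: "y \<in> V" for d m g x y a b
  proof -
    let ?C' = "?C x (shift_config g a, shift_config g b)" and ?W' = "?W d (shift_config g a, shift_config g b)"
    have c: "?C (g \<otimes> x) (a, b) = left_mult g ` ?C'"
      using cluster_shift[OF g x, of "sprinkle a b"] by (simp add: sprinkle_shift[OF g])
    have w: "?W d (a, b) = left_mult g ` ?W'" using vicinity_shift[OF g, of M d a] by simp
    have inj: "inj_on (left_mult g) V" by (rule inj_on_cmult[OF g])
    have subs: "?C' \<subseteq> V" "?W' \<subseteq> V" by (simp_all add: cluster_sub vicinity_sub)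
    have i: "?C (g \<otimes> x) (a, b) \<inter> ?W d (a, b) = left_mult g ` (?C' \<inter> ?W')"
      unfolding c w by (rule inj_on_image_Int[OF inj subs, symmetric])
    have inj': "inj_on (left_mult g) ?C'" "inj_on (left_mult g) (?C' \<inter> ?W')"
      by (rule inj_on_subset[OF inj subs(1)]) (rule inj_on_subset[OF inj le_infI1[OF subs(1)]])
    have "g \<otimes> y \<in> left_mult g ` (?C' \<inter> ?W') \<longleftrightarrow> y \<in> ?C' \<inter> ?W'"
      using subs by (intro inj_on_image_mem_iff[OF inj y]) auto
    then show ?thesis
      unfolding Q_def i unfolding c using inj' by (simp add: finite_image_iff card_image)
  qed
  have Q0: "AE z in ?N. \<not> Q d m x y z" if xy: "x \<in> V" "y \<in> V" for d m x y
  proof (rule mass_transport[where m=m, OF _ _ _ _ _ xy])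
    show "prob_space ?N" by unfold_locales
    show "{z \<in> space ?N. Q d m x y z} \<in> sets ?N" if "x \<in> V" for x y
      using Qm[OF that, of d m y] by (simp add: pred_def)
    show "emeasure ?N {z \<in> space ?N. Q d m (g \<otimes> x) (g \<otimes> y) z} = emeasure ?N {z \<in> space ?N. Q d m x y z}"
      if gxy: "g \<in> V" "x \<in> V" "y \<in> V" for g x y
    proof -
      let ?s = "\<lambda>(a, b). (shift_config g a, shift_config g b)"
      have "emeasure ?N {z \<in> space ?N. Q d m x y z} = emeasure (distr ?N ?N ?s) {z \<in> space ?N. Q d m x y z}"
        by (simp only: shift(1)[OF gxy(1)])
      also have "\<dots> = emeasure ?N (?s -` {z \<in> space ?N. Q d m x y z} \<inter> space ?N)"
        using Qm[OF gxy(2), of d m y] by (intro emeasure_distr shift(2)[OF gxy(1)]) (simp add: pred_def)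
      also have "?s -` {z \<in> space ?N. Q d m x y z} \<inter> space ?N = {z \<in> space ?N. Q d m (g \<otimes> x) (g \<otimes> y) z}"
      proof (intro equalityI subsetI)
        fix z assume "z \<in> {z \<in> space ?N. Q d m (g \<otimes> x) (g \<otimes> y) z}"
        then show "z \<in> ?s -` {z \<in> space ?N. Q d m x y z} \<inter> space ?N"
          using Qshift[OF gxy, of d m "fst z" "snd z"] measurable_space[OF shift(2)[OF gxy(1)], of z]
          by (cases z) simp
      next
        fix z assume "z \<in> ?s -` {z \<in> space ?N. Q d m x y z} \<inter> space ?N"
        then show "z \<in> {z \<in> space ?N. Q d m (g \<otimes> x) (g \<otimes> y) z}"
          using Qshift[OF gxy, of d m "fst z" "snd z"] by (cases z) simp
      qed
      finally show ?thesis ..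
    qed
    show "finite {y \<in> V. Q d m x y z} \<and> card {y \<in> V. Q d m x y z} \<le> m" for x z
    proof (cases "\<exists>y. Q d m x y z")
      case True
      then have f: "finite (?C x z \<inter> ?W d z)" "card (?C x z \<inter> ?W d z) = m" by (auto simp: Q_def)
      have "{y \<in> V. Q d m x y z} \<subseteq> ?C x z \<inter> ?W d z" by (auto simp: Q_def)
      with f show ?thesis by (metis card_mono finite_subset)
    qed simp
    show "infinite {x' \<in> V. Q d m x' y z}" if q: "x \<in> V" "y \<in> V" "Q d m x y z" for x y z
    proof -
      have "?C x z \<subseteq> {x' \<in> V. Q d m x' y z}"
      proof
        fix x' assume x': "x' \<in> ?C x z"
        have "?C x' z = ?C x z" by (rule component_of_eq[OF x' q(1)])
        then have "Q d m x' y z" using q(3) unfolding Q_def by simp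
        then show "x' \<in> {x' \<in> V. Q d m x' y z}" using x' cluster_sub by auto
      qed
      moreover have "infinite (?C x z)" using q(3) by (simp add: Q_def)
      ultimately show ?thesis using finite_subset by blast
    qed
  qed
  have "AE z in ?N. \<forall>x\<in>V. \<forall>y\<in>V. \<forall>d m. \<not> Q d m x y z"
    by (intro AE_ball_countable[THEN iffD2, OF countable_V] ballI AE_all_countable[THEN iffD2] allI Q0)
  then show ?thesis
  proof (rule eventually_mono)
    fix z assume z: "\<forall>x\<in>V. \<forall>y\<in>V. \<forall>d m. \<not> Q d m x y z"
    show "\<forall>x\<in>V. infinite (?C x z) \<longrightarrow> (\<forall>d. ?C x z \<inter> ?W d z = {} \<or> infinite (?C x z \<inter> ?W d z))"
    proof (intro ballI impI allI)
      fix x d assume x: "x \<in> V" "infinite (?C x z)"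
      show "?C x z \<inter> ?W d z = {} \<or> infinite (?C x z \<inter> ?W d z)"
      proof (rule ccontr)
        assume "\<not> (?C x z \<inter> ?W d z = {} \<or> infinite (?C x z \<inter> ?W d z))"
        then obtain y where y: "y \<in> ?C x z \<inter> ?W d z" and f: "finite (?C x z \<inter> ?W d z)" by blast
        then have "y \<in> V" using cluster_sub by auto
        moreover have "Q d (card (?C x z \<inter> ?W d z)) x y z" unfolding Q_def using y f x by simp
        ultimately show False using z x by blast
      qed
    qed
  qed
qed

text \<open>
  Fix the first layer \<open>a\<close> and a set \<open>A\<close>. Edges that touch \<open>A\<close> are not examined when the cluster of \<open>x\<close>
  is explored off \<open>A\<close>, and as long as the cluster avoids \<open>A\<close> this exploration reveals all of it. If it
  has infinitely many vertices next to \<open>A\<close>, infinitely many unexamined edges would have to be closed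
  in the second layer, which has probability zero.
\<close>

lemma AE_no_untaken_bridges:
  assumes eps: "0 < \<epsilon>" "\<epsilon> \<le> 1" and A: "A \<subseteq> V" and x: "x \<in> V"
    and meas: "(\<lambda>b. sprinkle a b) \<in> measurable (bond_percolation E \<epsilon>) (bond_percolation E p)"
  shows "AE b in bond_percolation E \<epsilon>. \<not> (cluster (sprinkle a b) x \<inter> A = {} \<and>
    infinite {y \<in> cluster (sprinkle a b) x. \<exists>z\<in>A. {y, z} \<in> E})"
proof -
  let ?B = "bond_percolation E \<epsilon>" and ?J = "touching A" and ?I = "E - touching A"
  let ?BI = "bond_percolation ?I \<epsilon>" and ?BJ = "bond_percolation ?J \<epsilon>"
  interpret BI: prob_space ?BI by (rule prob_space_bond)
  interpret BJ: prob_space ?BJ by (rule prob_space_bond)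
  interpret P: pair_prob_space ?BI ?BJ ..
  have un: "?I \<union> ?J = E" "?I \<inter> ?J = {}" using touching_sub by auto
  define bad where "bad b \<longleftrightarrow> cluster (sprinkle a b) x \<inter> A = {} \<and>
    infinite {y \<in> cluster (sprinkle a b) x. \<exists>z\<in>A. {y, z} \<in> E}" for b
  have C: "Measurable.pred ?B (\<lambda>b. y \<in> cluster (sprinkle a b) x)" for y
    by (rule measurable_compose[OF meas pred_cluster[OF x]])
  have "Measurable.pred ?B (\<lambda>b. (\<forall>y\<in>V. \<not> (y \<in> cluster (sprinkle a b) x \<and> y \<in> A)) \<and>
      infinite {y \<in> cluster (sprinkle a b) x. \<exists>z\<in>A. {y, z} \<in> E})"
  proof (intro pred_intros_logic(3) pred_Ball_countable countable_V pred_infinite_subset)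
    show "Measurable.pred ?B (\<lambda>b. \<not> (y \<in> cluster (sprinkle a b) x \<and> y \<in> A))" for y
      using C[of y] by measurable
    show "Measurable.pred ?B (\<lambda>b. y \<in> {y \<in> cluster (sprinkle a b) x. \<exists>z\<in>A. {y, z} \<in> E})" for y
      using C[of y] by measurable
    show "{y \<in> cluster (sprinkle a b) x. \<exists>z\<in>A. {y, z} \<in> E} \<subseteq> V" for b using cluster_sub by auto
  qed
  also have "(\<lambda>b. (\<forall>y\<in>V. \<not> (y \<in> cluster (sprinkle a b) x \<and> y \<in> A)) \<and>
      infinite {y \<in> cluster (sprinkle a b) x. \<exists>z\<in>A. {y, z} \<in> E}) = bad"
    unfolding bad_def using A by (intro ext) blast
  finally have bad: "Measurable.pred ?B bad" .
  note mm = measurable_merge_bond[OF un(1), of \<epsilon>]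
  have mbad: "Measurable.pred (?BI \<Otimes>\<^sub>M ?BJ) (\<lambda>z. bad (merge ?I ?J z))"
    by (rule measurable_compose[OF mm bad])
  have key: "AE v in ?BJ. \<not> bad (merge ?I ?J (u, v))" for u
  proof -
    \<comment> \<open>the cluster explored off A, and the edges through which it could reach A\<close>
    define E' where "E' = {e \<in> ?I. a e \<or> u e}"
    define C' where "C' = component_of V E' x"
    define H where "H = {e \<in> ?J. e \<inter> C' \<noteq> {}}"
    have badH: "infinite H \<and> (\<forall>e\<in>H. \<not> v e)" if b: "bad (merge ?I ?J (u, v))" for v
    proof -
      let ?w = "sprinkle a (merge ?I ?J (u, v))"
      have disj: "cluster ?w x \<inter> A = {}" and inf: "infinite {y \<in> cluster ?w x. \<exists>z\<in>A. {y, z} \<in> E}"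
        using b by (auto simp: bad_def)
      have wI: "?w e \<longleftrightarrow> a e \<or> u e" if "e \<in> ?I" for e using that by (simp add: sprinkle_def merge_def)
      have wJ: "?w e \<longleftrightarrow> a e \<or> v e" if "e \<in> ?J" for e
        using that un by (auto simp: sprinkle_def merge_def)
      have sub: "E' \<subseteq> open_edges E ?w" using wI by (auto simp: E'_def open_edges_def)
      have "adj V E' \<subseteq> adj V (open_edges E ?w)" using sub by (auto simp: adj_def nbrs_def)
      then have C1: "C' \<subseteq> cluster ?w x"
        unfolding C'_def component_of_def using rtrancl_mono by blast
      have C2: "cluster ?w x \<subseteq> C'"
      proof
        fix y assume "y \<in> cluster ?w x"
        then have "(x, y) \<in> (adj V (open_edges E ?w))\<^sup>*" by (simp add: component_of_def)
        then have "(x, y) \<in> (adj V E')\<^sup>*"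
        proof (induction rule: rtrancl_induct)
          case (step y z)
          have "y \<in> V" "z \<in> V" "{y, z} \<in> open_edges E ?w" using step(2) by (auto simp: adj_def nbrs_def)
          moreover have "y \<in> cluster ?w x" "z \<in> cluster ?w x"
            using step(1,2) \<open>y \<in> V\<close> \<open>z \<in> V\<close> by (auto simp: component_of_def)
          then have "y \<notin> A" "z \<notin> A" using disj by auto
          ultimately have "{y, z} \<in> ?I" "?w {y, z}" by (auto simp: open_edges_def touching_def)
          then have "{y, z} \<in> E'" using wI by (simp add: E'_def)
          then have "(y, z) \<in> adj V E'" using \<open>y \<in> V\<close> \<open>z \<in> V\<close> by (simp add: adj_def nbrs_def)
          with step(3) show ?case by simp
        qed simp
        moreover have "y \<in> V" using \<open>y \<in> cluster ?w x\<close> cluster_sub by auto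
        ultimately show "y \<in> C'" by (simp add: C'_def component_of_def)
      qed
      have CC: "cluster ?w x = C'" using C1 C2 by auto
      have closed: "\<not> v e" if e: "e \<in> H" for e
      proof
        assume v: "v e"
        have eJ: "e \<in> ?J" "e \<inter> C' \<noteq> {}" using e by (auto simp: H_def)
        then have eE: "e \<in> E" "e \<inter> A \<noteq> {}" by (auto simp: touching_def)
        obtain s t where st: "e = {s, t}" "s \<in> V" "t \<in> V" "s \<noteq> t" using eE(1) by (rule edgeE)
        have op: "e \<in> open_edges E ?w" using wJ[OF eJ(1)] v eE by (simp add: open_edges_def)
        have "{s, t} \<subseteq> cluster ?w x"
        proof -
          have ad: "(s, t) \<in> adj V (open_edges E ?w)" "(t, s) \<in> adj V (open_edges E ?w)"
            using op st by (auto simp: adj_def nbrs_def insert_commute)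
          from eJ(2) have "s \<in> cluster ?w x \<or> t \<in> cluster ?w x" using st CC by auto
          then show ?thesis using ad st by (auto simp: component_of_def intro: rtrancl_into_rtrancl)
        qed
        then show False using st eE disj by auto
      qed
      have "infinite H"
      proof
        assume fH: "finite H"
        have "{y \<in> cluster ?w x. \<exists>z\<in>A. {y, z} \<in> E} \<subseteq> \<Union>H"
          unfolding CC by (auto simp: H_def touching_def)
        moreover have "finite (\<Union>H)"
          using fH by (auto simp: H_def touching_def elim!: edgeE)
        ultimately show False using inf finite_subset by blast
      qed
      with closed show ?thesis by blast
    qed
    show ?thesis
    proof (cases "infinite H")
      case True
      have "emeasure ?BJ {v \<in> space ?BJ. \<forall>e\<in>H. \<not> v e} = 0"
        by (rule emeasure_infinitely_many_closed[OF True _ eps]) (auto simp: H_def)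
      moreover have "{v \<in> space ?BJ. \<forall>e\<in>H. \<not> v e} \<in> sets ?BJ"
      proof -
        have "Measurable.pred ?BJ (\<lambda>v. \<forall>e\<in>H. \<not> v e)"
        proof (intro pred_Ball_countable pred_intros_logic(2))
          show "countable H" using countable_subset[OF _ countable_E] by (auto simp: H_def touching_def)
          show "Measurable.pred ?BJ (\<lambda>v. v e)" if "e \<in> H" for e
            using that by (intro edge_event_measurable) (auto simp: H_def)
        qed
        then show ?thesis by (simp add: pred_def)
      qed
      ultimately show ?thesis
        by (intro AE_I[where N="{v \<in> space ?BJ. \<forall>e\<in>H. \<not> v e}"]) (use badH in auto)
    next
      case False
      then show ?thesis using badH by (intro AE_I2) blast
    qed
  qed
  have "AE z in ?BI \<Otimes>\<^sub>M ?BJ. \<not> bad (merge ?I ?J z)"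
    by (rule P.AE_pair_measure) (use mbad key in \<open>auto simp: pred_def\<close>)
  then have "AE b in distr (?BI \<Otimes>\<^sub>M ?BJ) ?B (merge ?I ?J). \<not> bad b"
    by (subst AE_distr_iff[OF mm]) (use bad in \<open>auto simp: pred_def\<close>)
  then have "AE b in ?B. \<not> bad b" by (simp only: bond_percolation_split[OF un, symmetric])
  then show ?thesis by (simp add: bad_def)
qed

lemma infinite_V:
  assumes "x \<in> V" "1 < \<zeta>" "\<And>n. \<zeta> ^ n \<le> real (card (thicken V E n {x}))"
  shows "infinite V"
proof
  assume fin: "finite V"
  obtain n where "real (card V) < \<zeta> ^ n" using real_arch_pow[OF assms(2)] by blast
  moreover have "card (thicken V E n {x}) \<le> card V"
    using fin thicken_subset[of "{x}" V E n] assms(1) by (intro card_mono) auto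
  ultimately show False using assms(3)[of n] by simp
qed

text \<open>
  Write \<open>p\<close>-percolation as a \<open>p1\<close>-percolation with \<open>1 / \<zeta> < p1 < p\<close> plus an independent sprinkling, and
  consider an infinite cluster of the union. Let \<open>d\<close> be its distance to the set of capacious vertices
  of the first layer, which is finite since that set is not empty. By mass transport infinitely many
  vertices of the cluster are at distance \<open>d\<close> from that set. If \<open>d > 0\<close>, each of them has a neighbour at
  distance \<open>d - 1\<close>, outside the cluster, and sprinkling would have joined one of these to the cluster.
  Hence \<open>d = 0\<close>.

  The conclusion is about the union alone, and is a measurable condition on it; this allows the passage
  from the pair of layers back to \<open>p\<close>-percolation.
\<close>

lemma AE_infinite_cluster_capacious:
  assumes x0: "x0 \<in> V" and growth: "\<And>n. \<zeta> ^ n \<le> real (card (thicken V E n {x0}))"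
    and z: "1 < \<zeta>" and p: "1 / \<zeta> < p" "p \<le> 1"
  shows "\<exists>M. AE \<omega> in bond_percolation E p. \<forall>x\<in>V. infinite (cluster \<omega> x) \<longrightarrow>
    (\<exists>y\<in>V. y \<in> cluster \<omega> x \<and> capacious_at M y \<omega>)"
proof -
  have z1: "1 / \<zeta> < 1" "0 < 1 / \<zeta>" using z by auto
  \<comment> \<open>p1 is below 1 also when p = 1, so that the sprinkling parameter is well defined\<close>
  obtain p1 where p1: "1 / \<zeta> < p1" "p1 < p" using dense[OF p(1)] by blast
  have p1': "0 < p1" "p1 < 1" using p1 p z1 by linarith+
  define \<epsilon> where "\<epsilon> = (p - p1) / (1 - p1)"
  have eps: "0 < \<epsilon>" "\<epsilon> \<le> 1" using p1 p p1' by (auto simp: \<epsilon>_def)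
  have eq: "1 - p = (1 - p1) * (1 - \<epsilon>)" using p1' by (simp add: \<epsilon>_def field_simps)
  define A where "A = bond_percolation E p1"
  define B where "B = bond_percolation E \<epsilon>"
  let ?P = "bond_percolation E p" and ?N = "A \<Otimes>\<^sub>M B"
  interpret A: prob_space A unfolding A_def by (rule prob_space_bond)
  interpret B: prob_space B unfolding B_def by (rule prob_space_bond)
  interpret AB: pair_prob_space A B ..
  have sp: "distr ?N ?P (\<lambda>z. sprinkle (fst z) (snd z)) = ?P"
      "(\<lambda>z. sprinkle (fst z) (snd z)) \<in> measurable ?N ?P"
    unfolding A_def B_def sprinkle_def using p1' eps eq
    by (intro bond_percolation_sprinkle; simp)+
  have p1le: "p1 \<le> 1" using p1' by simp
  obtain M c where M: "0 \<le> M" "0 < c"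
      "c \<le> measure A {\<omega> \<in> space A. capacious_at M x0 \<omega>}"
    using capacious_pos_prob[OF x0 growth z p1(1) p1le] unfolding A_def by blast
  let ?C = "\<lambda>x z. cluster (sprinkle (fst z) (snd z)) x" and ?W = "\<lambda>d z. vicinity M d (fst z)"
  have C: "Measurable.pred ?N (\<lambda>z. y \<in> ?C x z)" if "x \<in> V" for x y
    by (rule measurable_compose[OF sp(2) pred_cluster[OF that]])
  have W: "Measurable.pred ?N (\<lambda>z. y \<in> ?W d z)" for d y
    by (rule measurable_compose[OF measurable_fst]) (unfold A_def, rule pred_vicinity)
  have cap: "Measurable.pred (bond_percolation E q) (\<lambda>\<omega>. capacious_at M y \<omega>)" if "y \<in> V" for y q
    using capacious_sets[OF that, of q M] by (simp add: pred_def)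
  have exist: "AE z in ?N. \<exists>y\<in>V. capacious_at M y (fst z)"
  proof (rule AB.AE_pair_measure)
    have "Measurable.pred ?N (\<lambda>z. \<exists>y\<in>V. capacious_at M y (fst z))"
      by (intro pred_Bex_countable countable_V measurable_compose[OF measurable_fst])
        (unfold A_def, rule cap)
    then show "{z \<in> space ?N. \<exists>y\<in>V. capacious_at M y (fst z)} \<in> sets ?N" by (simp add: pred_def)
    have "AE a in A. \<exists>y\<in>V. capacious_at M y a"
      unfolding A_def
      by (rule AE_exists_capacious[OF infinite_V[OF x0 z growth] M(2) x0 M(3)[unfolded A_def]])
    then show "AE a in A. AE b in B. \<exists>y\<in>V. capacious_at M y (fst (a, b))" by simp
  qed
  have transport: "AE z in ?N. \<forall>x\<in>V. infinite (?C x z) \<longrightarrow> (\<forall>d. ?C x z \<inter> ?W d z = {} \<or> infinite (?C x z \<inter> ?W d z))"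
    by (rule AE_cluster_meets_never_finitely[OF A_def B_def sp(2)])
  have bridge: "AE z in ?N. \<forall>x\<in>V. \<forall>d. \<not> (?C x z \<inter> ?W d z = {} \<and>
      infinite {y \<in> ?C x z. \<exists>w\<in>?W d z. {y, w} \<in> E})"
  proof (intro AE_ball_countable[THEN iffD2, OF countable_V] ballI AE_all_countable[THEN iffD2] allI)
    fix x d assume x: "x \<in> V"
    show "AE z in ?N. \<not> (?C x z \<inter> ?W d z = {} \<and> infinite {y \<in> ?C x z. \<exists>w\<in>?W d z. {y, w} \<in> E})"
    proof (rule AB.AE_pair_measure)
      have "Measurable.pred ?N (\<lambda>z. \<not> ((\<forall>y\<in>V. \<not> (y \<in> ?C x z \<and> y \<in> ?W d z)) \<and>
          infinite {y \<in> ?C x z. \<exists>w\<in>V. w \<in> ?W d z \<and> {y, w} \<in> E}))"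
      proof (rule pred_intros_logic(2), rule pred_intros_logic(3))
        show "Measurable.pred ?N (\<lambda>z. \<forall>y\<in>V. \<not> (y \<in> ?C x z \<and> y \<in> ?W d z))"
          by (intro pred_Ball_countable pred_intros_logic(2-3) countable_V C[OF x] W)
        have "Measurable.pred ?N (\<lambda>z. y \<in> ?C x z \<and> (\<exists>w\<in>V. w \<in> ?W d z \<and> {y, w} \<in> E))" for y
          by (intro pred_intros_logic(3) pred_Bex_countable countable_V C[OF x] W) simp
        then show "Measurable.pred ?N (\<lambda>z. infinite {y \<in> ?C x z. \<exists>w\<in>V. w \<in> ?W d z \<and> {y, w} \<in> E})"
          by (intro pred_infinite_subset) (use cluster_sub in auto)
      qed
      also have "(\<lambda>z. \<not> ((\<forall>y\<in>V. \<not> (y \<in> ?C x z \<and> y \<in> ?W d z)) \<and>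
          infinite {y \<in> ?C x z. \<exists>w\<in>V. w \<in> ?W d z \<and> {y, w} \<in> E})) =
          (\<lambda>z. \<not> (?C x z \<inter> ?W d z = {} \<and> infinite {y \<in> ?C x z. \<exists>w\<in>?W d z. {y, w} \<in> E}))"
      proof
        fix z
        have "{y \<in> ?C x z. \<exists>w\<in>V. w \<in> ?W d z \<and> {y, w} \<in> E} = {y \<in> ?C x z. \<exists>w\<in>?W d z. {y, w} \<in> E}"
          using vicinity_sub[of M d "fst z"] by blast
        moreover have "(\<forall>y\<in>V. \<not> (y \<in> ?C x z \<and> y \<in> ?W d z)) \<longleftrightarrow> ?C x z \<inter> ?W d z = {}"
          using vicinity_sub[of M d "fst z"] by blast
        ultimately show "(\<not> ((\<forall>y\<in>V. \<not> (y \<in> ?C x z \<and> y \<in> ?W d z)) \<and>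
          infinite {y \<in> ?C x z. \<exists>w\<in>V. w \<in> ?W d z \<and> {y, w} \<in> E})) =
          (\<not> (?C x z \<inter> ?W d z = {} \<and> infinite {y \<in> ?C x z. \<exists>w\<in>?W d z. {y, w} \<in> E}))" by simp
      qed
      finally show "{z \<in> space ?N. \<not> (?C x z \<inter> ?W d z = {} \<and>
          infinite {y \<in> ?C x z. \<exists>w\<in>?W d z. {y, w} \<in> E})} \<in> sets ?N" by (simp add: pred_def)
      have "AE b in B. \<not> (cluster (sprinkle a b) x \<inter> vicinity M d a = {} \<and>
          infinite {y \<in> cluster (sprinkle a b) x. \<exists>w\<in>vicinity M d a. {y, w} \<in> E})" if a: "a \<in> space A" for a
      proof -
        have "(\<lambda>b. sprinkle a b) \<in> measurable B ?P"
          using measurable_compose[OF measurable_Pair1'[OF a] sp(2)] by simp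
        then show ?thesis unfolding B_def by (rule AE_no_untaken_bridges[OF eps vicinity_sub x])
      qed
      then show "AE a in A. AE b in B. \<not> (?C x (a, b) \<inter> ?W d (a, b) = {} \<and>
          infinite {y \<in> ?C x (a, b). \<exists>w\<in>?W d (a, b). {y, w} \<in> E})"
        unfolding fst_conv snd_conv by (rule AE_I2)
    qed
  qed
  define R where "R \<omega> \<longleftrightarrow> (\<forall>x\<in>V. infinite (cluster \<omega> x) \<longrightarrow> (\<exists>y\<in>V. y \<in> cluster \<omega> x \<and> capacious_at M y \<omega>))" for \<omega>
  have R: "Measurable.pred ?P R"
    unfolding R_def[abs_def]
    by (intro pred_intros_logic pred_Ball_countable pred_Bex_countable countable_V pred_infinite_subset
        pred_cluster cap cluster_sub)
  have "AE z in ?N. R (sprinkle (fst z) (snd z))"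
    using exist transport bridge
  proof (eventually_elim, goal_cases)
    case (1 z)
    let ?w = "sprinkle (fst z) (snd z)"
    show ?case
      unfolding R_def
    proof (intro ballI impI)
      fix x assume x: "x \<in> V" and inf: "infinite (cluster ?w x)"
      obtain i where i: "i \<in> V" "capacious_at M i (fst z)" using 1 by blast
      have meets: "\<exists>d. ?C x z \<inter> ?W d z \<noteq> {}"
      proof -
        obtain d where "x \<in> thicken V E d {i}" using UN_thicken[OF i(1)] x by blast
        also have "thicken V E d {i} \<subseteq> ?W d z"
          unfolding vicinity_def using i by (intro thicken_mono_set) auto
        finally have "x \<in> ?C x z \<inter> ?W d z" using x by (simp add: component_of_def)
        then show ?thesis by blast
      qed
      define d where "d = (LEAST d. ?C x z \<inter> ?W d z \<noteq> {})"
      have d: "?C x z \<inter> ?W d z \<noteq> {}" unfolding d_def using meets by (rule LeastI_ex)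
      have "d = 0"
      proof (cases d)
        case (Suc k)
        have k: "?C x z \<inter> ?W k z = {}"
          using not_less_Least[of k "\<lambda>d. ?C x z \<inter> ?W d z \<noteq> {}"] Suc unfolding d_def by auto
        have "infinite (?C x z \<inter> ?W d z)" using 1 x inf d by blast
        moreover have "?C x z \<inter> ?W d z \<subseteq> {y \<in> ?C x z. \<exists>w\<in>?W k z. {y, w} \<in> E}"
        proof
          fix y assume y: "y \<in> ?C x z \<inter> ?W d z"
          then have "y \<notin> ?W k z" using k by auto
          then obtain w where "w \<in> ?W k z" "y \<in> nbrs V E w"
            using y unfolding Suc vicinity_def by auto
          then show "y \<in> {y \<in> ?C x z. \<exists>w\<in>?W k z. {y, w} \<in> E}"
            using y by (auto simp: nbrs_def insert_commute)
        qed
        ultimately have "infinite {y \<in> ?C x z. \<exists>w\<in>?W k z. {y, w} \<in> E}"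
          using finite_subset by blast
        then show ?thesis using 1 x k by blast
      qed
      then obtain y where y: "y \<in> ?C x z" "y \<in> V" "capacious_at M y (fst z)"
        using d by (auto simp: vicinity_def)
      have "open_edges E (fst z) \<subseteq> open_edges E ?w" by (auto simp: open_edges_def sprinkle_def)
      then have "capacious_at M y ?w"
        by (rule capacious_mono[OF y(3) M(1)]) (rule finite_nbrs_open)
      with y show "\<exists>y\<in>V. y \<in> cluster ?w x \<and> capacious_at M y ?w" by blast
    qed
  qed
  then have "AE \<omega> in distr ?N ?P (\<lambda>z. sprinkle (fst z) (snd z)). R \<omega>"
    by (subst AE_distr_iff[OF sp(2)]) (use R in \<open>auto simp: pred_def\<close>)
  then show ?thesis unfolding sp(1) R_def by blast
qed

end

section \<open>Transience of infinite clusters\<close>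

theorem theorem1p8:
  fixes G :: "('a, 'b) monoid_scheme" and S :: "'a set" and x0 :: 'a and \<zeta> p :: real
  assumes "group G"
    and "finite S" and "S \<subseteq> carrier G" and "generate G S = carrier G"
    and "x0 \<in> carrier G"
    and "\<zeta> > 1"
    and "\<And>n :: nat. real (card (graph_ball (carrier G) (cayley_edges G S) x0 n)) \<ge> \<zeta> ^ n"
    and "p \<in> {1 / \<zeta> <.. 1}"
  shows "AE \<omega> in bond_percolation (cayley_edges G S) p.
    \<forall>C \<in> graph_components (carrier G) (open_edges (cayley_edges G S) \<omega>).
      infinite C \<longrightarrow> transient_graph C (open_edges (cayley_edges G S) \<omega>)"
proof -
  interpret group G by fact
  interpret cayley_graph G S by unfold_locales (use assms in auto)
  have growth: "\<zeta> ^ n \<le> real (card (thicken V E n {x0}))" for n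
    using assms(7)[of n] graph_ball_eq_thicken[OF assms(5)] by simp
  have p: "1 / \<zeta> < p" "p \<le> 1" using assms(8) by auto
  obtain M where M: "AE \<omega> in bond_percolation E p. \<forall>x\<in>V. infinite (cluster \<omega> x) \<longrightarrow>
    (\<exists>y\<in>V. y \<in> cluster \<omega> x \<and> capacious_at M y \<omega>)"
    using AE_infinite_cluster_capacious[OF assms(5) growth assms(6) p] by blast
  show ?thesis
    using M
  proof (rule eventually_mono)
    fix \<omega> assume \<omega>: "\<forall>x\<in>V. infinite (cluster \<omega> x) \<longrightarrow> (\<exists>y\<in>V. y \<in> cluster \<omega> x \<and> capacious_at M y \<omega>)"
    show "\<forall>C \<in> graph_components V (open_edges E \<omega>). infinite C \<longrightarrow> transient_graph C (open_edges E \<omega>)"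
    proof (intro ballI impI)
      fix C assume C: "C \<in> graph_components V (open_edges E \<omega>)" "infinite C"
      then obtain x where x: "x \<in> V" "C = cluster \<omega> x"
        by (auto simp: graph_components_def component_of_def)
      with \<omega> C obtain y where "y \<in> cluster \<omega> x" "capacious_at M y \<omega>" by blast
      with x C show "transient_graph C (open_edges E \<omega>)"
        using transient_component[OF finite_nbrs_open, of x \<omega> y M] by simp
    qed
  qed
qed

end
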